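(* Let $p=1$, let $K$ satisfy (H1), (H2), (H3), let $g\in L^1(\Omega)$ and $f\in L^1([0,T];L^1(\Omega))$. For any $T>0$ there exists a unique solution on $[0,T]$ of problem (P) for $p=1$ with kernel $K$ and data $(f,g)$, in the sense defined below.
   Context: $d\ge1$, $\Omega=[0,1]^d$, $T>0$. A kernel $K:\Omega\times\Omega\to\mathbb R$ may satisfy: (H1) $K$ is nonnegative and measurable; (H2) $K(x,y)=K(y,x)$; (H3) $\sup_{x\in\Omega}\int_\Omega K(x,y)\,dy<+\infty$. Let $\partial|\cdot|(s)=\{1\}$ if $s>0$, $[-1,1]$ if $s=0$, $\{-1\}$ if $s<0$. The $1$-Laplacian $\Delta_1^K$ is the set-valued operator on $L^1(\Omega)$ with $\eta\in\Delta_1^Ku$ iff $\eta(x)=-\int_\Omega K(x,y)w(x,y)\,dy$ a.e. for some $w$ with $\|w\|_{L^\infty(\Omega^2)}\le1$, $w(x,y)=-w(y,x)$ and $w(x,y)\in\partial|\cdot|(u(y)-u(x))$. A solution of (P) for $p=1$ with kernel $K$ and data $(f,g)$ on $[0,T]$ is $u\in C([0,T];L^1(\Omega))\cap W^{1,1}(]0,T[;L^1(\Omega))$ with $u(\cdot,0)=g$ a.e. and $\partial_tu(x,t)=-\eta(x,t)+f(x,t)$ a.e. in $\Omega\times]0,T[$, where $\eta(\cdot,t)\in\Delta_1^Ku(\cdot,t)$. *)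

theory Defs
  imports "HOL-Analysis.Analysis"
begin

definition Omega :: "(real^'d) set" where
  "Omega = {x. \<forall>i. 0 \<le> x$i \<and> x$i \<le> 1}"

definition subdiff_abs :: "real \<Rightarrow> real set" where
  "subdiff_abs s = (if s > 0 then {1} else if s = 0 then {-1..1} else {-1})"

definition H1 :: "(real^'d \<Rightarrow> real^'d \<Rightarrow> real) \<Rightarrow> bool" where
  "H1 K \<longleftrightarrow> (\<forall>x\<in>Omega. \<forall>y\<in>Omega. 0 \<le> K x y) \<and>
     (\<lambda>z. K (fst z) (snd z)) \<in> borel_measurable (lebesgue_on (Omega \<times> Omega))"

definition H2 :: "(real^'d \<Rightarrow> real^'d \<Rightarrow> real) \<Rightarrow> bool" where
  "H2 K \<longleftrightarrow> (\<forall>x\<in>Omega. \<forall>y\<in>Omega. K x y = K y x)"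

definition H3 :: "(real^'d \<Rightarrow> real^'d \<Rightarrow> real) \<Rightarrow> bool" where
  "H3 K \<longleftrightarrow> (SUP x\<in>Omega. \<integral>\<^sup>+ y. ennreal (K x y) \<partial>lebesgue_on Omega) < \<infinity>"

definition one_laplacian ::
  "(real^'d \<Rightarrow> real^'d \<Rightarrow> real) \<Rightarrow> (real^'d \<Rightarrow> real) \<Rightarrow> (real^'d \<Rightarrow> real) \<Rightarrow> bool" where
  "one_laplacian K u \<eta> \<longleftrightarrow>
     integrable (lebesgue_on Omega) u \<and> integrable (lebesgue_on Omega) \<eta> \<and>
     (\<exists>w :: real^'d \<Rightarrow> real^'d \<Rightarrow> real.
        (\<lambda>z. w (fst z) (snd z)) \<in> borel_measurable (lebesgue_on (Omega \<times> Omega)) \<and>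
        (AE z in lebesgue_on (Omega \<times> Omega).
            \<bar>w (fst z) (snd z)\<bar> \<le> 1 \<and>
            w (fst z) (snd z) = - w (snd z) (fst z) \<and>
            w (fst z) (snd z) \<in> subdiff_abs (u (snd z) - u (fst z))) \<and>
        (AE x in lebesgue_on Omega. \<eta> x = - (\<integral>y. K x y * w x y \<partial>lebesgue_on Omega)))"

definition test_fun :: "real \<Rightarrow> (real \<Rightarrow> real) \<Rightarrow> bool" where
  "test_fun T \<phi> \<longleftrightarrow> (\<forall>n. \<forall>t. ((deriv ^^ n) \<phi>) differentiable (at t)) \<and>
     (\<exists>a b. 0 < a \<and> a \<le> b \<and> b < T \<and> (\<forall>t. t \<notin> {a..b} \<longrightarrow> \<phi> t = 0))"

text \<open>v is the weak time derivative of u in L^1(0,T;L^1(Omega)), where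
  L^1(0,T;L^1(Omega)) is identified with L^1(Omega x ]0,T[).\<close>
definition weak_time_deriv ::
  "real \<Rightarrow> (real^'d \<Rightarrow> real \<Rightarrow> real) \<Rightarrow> (real^'d \<Rightarrow> real \<Rightarrow> real) \<Rightarrow> bool" where
  "weak_time_deriv T u v \<longleftrightarrow>
     integrable (lebesgue_on (Omega \<times> {0<..<T})) (\<lambda>z. u (fst z) (snd z)) \<and>
     integrable (lebesgue_on (Omega \<times> {0<..<T})) (\<lambda>z. v (fst z) (snd z)) \<and>
     (\<forall>\<phi>. test_fun T \<phi> \<longrightarrow>
        (AE x in lebesgue_on Omega.
           (\<integral>t. u x t * deriv \<phi> t \<partial>lebesgue_on {0<..<T})
             = - (\<integral>t. v x t * \<phi> t \<partial>lebesgue_on {0<..<T})))"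

definition solution_P1 ::
  "(real^'d \<Rightarrow> real^'d \<Rightarrow> real) \<Rightarrow> (real^'d \<Rightarrow> real \<Rightarrow> real) \<Rightarrow> (real^'d \<Rightarrow> real)
    \<Rightarrow> real \<Rightarrow> (real^'d \<Rightarrow> real \<Rightarrow> real) \<Rightarrow> bool" where
  "solution_P1 K f g T u \<longleftrightarrow>
     (\<lambda>z. u (fst z) (snd z)) \<in> borel_measurable (lebesgue_on (Omega \<times> {0..T})) \<and>
     (\<forall>t\<in>{0..T}. integrable (lebesgue_on Omega) (\<lambda>x. u x t)) \<and>
     (\<forall>t\<in>{0..T}. ((\<lambda>s. \<integral>x. \<bar>u x s - u x t\<bar> \<partial>lebesgue_on Omega) \<longlongrightarrow> 0) (at t within {0..T})) \<and>
     (AE x in lebesgue_on Omega. u x 0 = g x) \<and>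
     (\<exists>v \<eta>. weak_time_deriv T u v \<and>
        (AE z in lebesgue_on (Omega \<times> {0<..<T}).
            v (fst z) (snd z) = - \<eta> (fst z) (snd z) + f (fst z) (snd z)) \<and>
        (AE t in lebesgue_on {0<..<T}. one_laplacian K (\<lambda>x. u x t) (\<lambda>x. \<eta> x t)))"

end

theory Submission
  imports Defs
begin

text \<open>
  Write \<open>u = h + z\<close> with \<open>h(x,t) = g(x) + \<integral>\<^sub>0\<^sup>t f(x,s) ds\<close>; then \<open>z\<close> has a bounded time
  derivative and only the measurability of \<open>h\<close> matters. Replacing \<open>z(\<cdot>,s)\<close> by \<open>z(\<cdot>,s-\<delta>)\<close> inside the
  sign gives an explicitly solvable delay equation with solution \<open>z\<^sub>\<delta>\<close>. Since \<open>z\<^sub>\<delta>\<close> is Lipschitz in time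
  uniformly in \<open>\<delta>\<close>, symmetrizing the kernel and using monotonicity of the sign yields
  \<open>\<parallel>z\<^sub>\<delta> - z\<^sub>\<epsilon>\<parallel>\<^sup>2 \<le> c (\<delta> + \<epsilon>)\<close> in \<open>L\<^sup>2(\<Omega>)\<close> at each time, hence convergence. The signs converge weakly; convex
  combinations of the tails converge almost everywhere, and this preserves antisymmetry, the bound
  by \<open>1\<close>, the linear equation, and the value \<open>\<plusminus>1\<close> wherever the limit difference is nonzero.

  For uniqueness, the difference of two solutions is the primitive of its weak derivative, which is
  bounded, and the same symmetrization shows that its \<open>L\<^sup>2\<close> norm does not increase.
\<close>

subsection \<open>Almost everywhere convergence\<close>

text \<open>The delay acts on \<open>z\<close> alone because \<open>z\<close> moves by at most
  \<open>C\<close> times the lag, while \<open>h\<close> has no modulus of continuity uniform in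
  \<open>x\<close>. Solutions and data need not be square integrable: the L^2 estimates concern only
  differences, whose time derivatives are bounded by \<open>2 * C\<close>. Limits of convex
  combinations need not respect a nonlinear relation. The sign relation survives because the
  arguments of the signs converge almost everywhere along the whole sequence, so the signs are
  eventually constant wherever the limit argument is nonzero; where it vanishes, all of [-1,1] is
  admissible. For uniqueness, the null set in \<open>weak_time_deriv\<close> depends on the test
  function, and a solution is continuous in time only as an L^1-valued map. Hence the equation is
  paired with a bounded function of \<open>x\<close> before it is integrated in time. Lebesgue
  measure on a product is the completion of the product measure, so Fubini is applied to Borel
  representatives, altered on null sets until the kernel is symmetric and bounded everywhere in the
  required sense.\<close>

lemma abs_le_weighted_square:
  fixes d :: real
  assumes "0 < c"
  shows "\<bar>d\<bar> \<le> c * d\<^sup>2 + 1 / c"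
proof -
  have "0 \<le> (sqrt c * \<bar>d\<bar> - 1 / sqrt c)\<^sup>2" by simp
  also have "\<dots> = c * d\<^sup>2 + 1 / c - 2 * \<bar>d\<bar>"
    using assms by (simp add: power2_diff power_mult_distrib power_divide)
  finally show ?thesis by simp
qed

text \<open>The weight \<open>2^n\<close> in \<open>abs_le_weighted_square\<close> turns the L^2
  decay \<open>(1/8)^n\<close> into the L^1 decay \<open>(1/2)^n\<close>: the two terms are of size
  \<open>(1/4)^n\<close> and \<open>(1/2)^n\<close>. The total variation of the sequence is then
  integrable, hence finite almost everywhere, and the increments telescope.\<close>

lemma (in finite_measure) AE_convergent_if_square_diffs_summable:
  fixes F :: "nat \<Rightarrow> 'a \<Rightarrow> real"
  assumes [measurable]: "\<And>n. F n \<in> borel_measurable M"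
    and B: "0 \<le> B"
    and sq: "\<And>n. (\<integral>\<^sup>+x. ennreal ((F (Suc n) x - F n x)\<^sup>2) \<partial>M) \<le> ennreal (B * (1/8)^n)"
  shows "AE x in M. convergent (\<lambda>n. F n x)"
proof -
  define m where "m = measure M (space M)"
  have m: "emeasure M (space M) = ennreal m" by (simp add: m_def emeasure_eq_measure)
  have m0: "0 \<le> m" by (simp add: m_def)
  have step: "(\<integral>\<^sup>+x. ennreal \<bar>F (Suc n) x - F n x\<bar> \<partial>M) \<le> ennreal ((B + m) * (1/2)^n)" for n
  proof -
    have "(\<integral>\<^sup>+x. ennreal \<bar>F (Suc n) x - F n x\<bar> \<partial>M)
        \<le> (\<integral>\<^sup>+x. ennreal (2^n) * ennreal ((F (Suc n) x - F n x)\<^sup>2) + ennreal ((1/2)^n) \<partial>M)"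
    proof (rule nn_integral_mono)
      fix x
      have "\<bar>F (Suc n) x - F n x\<bar> \<le> 2^n * (F (Suc n) x - F n x)\<^sup>2 + 1 / 2^n"
        by (rule abs_le_weighted_square) simp
      then show "ennreal \<bar>F (Suc n) x - F n x\<bar>
          \<le> ennreal (2^n) * ennreal ((F (Suc n) x - F n x)\<^sup>2) + ennreal ((1/2)^n)"
        by (simp add: ennreal_mult[symmetric] ennreal_plus[symmetric] power_one_over ennreal_leI
            del: ennreal_plus)
    qed
    also have "\<dots> = ennreal (2^n) * (\<integral>\<^sup>+x. ennreal ((F (Suc n) x - F n x)\<^sup>2) \<partial>M) + ennreal ((1/2)^n) * ennreal m"
      by (simp add: nn_integral_add nn_integral_cmult m)
    also have "\<dots> \<le> ennreal (2^n) * ennreal (B * (1/8)^n) + ennreal ((1/2)^n) * ennreal m"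
      by (intro add_mono mult_left_mono sq) auto
    also have "\<dots> = ennreal (2^n * (B * (1/8)^n) + (1/2)^n * m)"
      using B m0 by (simp add: ennreal_mult[symmetric] ennreal_plus[symmetric] del: ennreal_plus)
    also have "\<dots> \<le> ennreal ((B + m) * (1/2)^n)"
    proof (rule ennreal_leI)
      have "(2::real)^n * (1/8)^n = (1/4)^n" by (simp add: power_mult_distrib[symmetric])
      also have "\<dots> \<le> (1/2)^n" by (rule power_mono) auto
      finally have "B * (2^n * (1/8)^n) \<le> B * (1/2)^n" using B by (rule mult_left_mono)
      then show "2^n * (B * (1/8)^n) + (1/2)^n * m \<le> (B + m) * (1/2)^n"
        by (simp add: algebra_simps)
    qed
    finally show ?thesis .
  qed
  have "(\<integral>\<^sup>+x. (\<Sum>n. ennreal \<bar>F (Suc n) x - F n x\<bar>) \<partial>M)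
      = (\<Sum>n. \<integral>\<^sup>+x. ennreal \<bar>F (Suc n) x - F n x\<bar> \<partial>M)"
    by (rule nn_integral_suminf) measurable
  also have "\<dots> \<le> (\<Sum>n. ennreal ((B + m) * (1/2)^n))"
    by (intro suminf_le step) auto
  also have "\<dots> = ennreal (\<Sum>n. (B + m) * (1/2)^n)"
    using B m0 by (intro suminf_ennreal2) (auto intro!: summable_mult summable_geometric)
  finally have "(\<integral>\<^sup>+x. (\<Sum>n. ennreal \<bar>F (Suc n) x - F n x\<bar>) \<partial>M) \<noteq> \<infinity>"
    by (auto simp: top_unique)
  then have "AE x in M. (\<Sum>n. ennreal \<bar>F (Suc n) x - F n x\<bar>) \<noteq> \<infinity>"
    by (intro nn_integral_noteq_infinite) auto
  then show ?thesis
  proof (rule AE_mp, intro AE_I2 impI)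
    fix x assume "(\<Sum>n. ennreal \<bar>F (Suc n) x - F n x\<bar>) \<noteq> \<infinity>"
    then have "summable (\<lambda>n. \<bar>F (Suc n) x - F n x\<bar>)"
      by (intro summable_suminf_not_top) auto
    then have "summable (\<lambda>n. F (Suc n) x - F n x)"
      by (rule summable_rabs_cancel)
    then have "convergent (\<lambda>n. \<Sum>i<n. F (Suc i) x - F i x)"
      by (simp add: summable_iff_convergent)
    then have "convergent (\<lambda>n. (F n x - F 0 x) + F 0 x)"
      by (intro convergent_add convergent_const) (simp add: sum_lessThan_telescope[of "\<lambda>n. F n x"])
    then show "convergent (\<lambda>n. F n x)" by simp
  qed
qed

section \<open>Convex combinations of the tails of a sequence\<close>

text \<open>The explicit upper index \<open>N\<close> keeps every combination a finite sum, so
  combinations commute with kernel integrals and with primitives in time by plain linearity.\<close>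

definition tail_weights :: "nat \<Rightarrow> nat \<Rightarrow> (nat \<Rightarrow> real) \<Rightarrow> bool" where
  "tail_weights n N c \<longleftrightarrow> (\<forall>k. 0 \<le> c k) \<and> (\<forall>k. k < n \<or> N \<le> k \<longrightarrow> c k = 0) \<and> (\<Sum>k<N. c k) = 1"

lemma tail_weights_mono:
  assumes "tail_weights n N c" "n' \<le> n" "N \<le> N'"
  shows "tail_weights n' N' c"
proof -
  have "(\<Sum>k<N'. c k) = (\<Sum>k<N. c k)"
    using assms by (intro sum.mono_neutral_right) (auto simp: tail_weights_def)
  then show ?thesis using assms by (auto simp: tail_weights_def)
qed

lemma tail_weights_sum_cong:
  fixes a :: "nat \<Rightarrow> real"
  assumes "tail_weights n N c" "N \<le> N'"
  shows "(\<Sum>k<N'. c k * a k) = (\<Sum>k<N. c k * a k)"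
  using assms by (intro sum.mono_neutral_right) (auto simp: tail_weights_def)

lemma tail_weights_abs_le:
  fixes a :: "nat \<Rightarrow> real"
  assumes c: "tail_weights n N c" and "\<And>k. n \<le> k \<Longrightarrow> \<bar>a k - l\<bar> \<le> e"
  shows "\<bar>(\<Sum>k<N. c k * a k) - l\<bar> \<le> e"
proof -
  have one: "(\<Sum>k<N. c k) = 1" and nn: "\<And>k. 0 \<le> c k" using c by (auto simp: tail_weights_def)
  have "(\<Sum>k<N. c k * a k) - l = (\<Sum>k<N. c k * (a k - l))"
    using one by (simp add: right_diff_distrib sum_subtractf sum_distrib_right[symmetric])
  also have "\<bar>\<dots>\<bar> \<le> (\<Sum>k<N. \<bar>c k * (a k - l)\<bar>)" by (rule sum_abs)
  also have "\<dots> \<le> (\<Sum>k<N. c k * e)"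
  proof (rule sum_mono)
    fix k
    show "\<bar>c k * (a k - l)\<bar> \<le> c k * e"
    proof (cases "n \<le> k")
      case True
      then show ?thesis using assms(2)[OF True] nn[of k] by (simp add: abs_mult mult_left_mono)
    next
      case False
      then have "c k = 0" using c by (simp add: tail_weights_def)
      then show ?thesis by simp
    qed
  qed
  also have "\<dots> = e" using one by (simp add: sum_distrib_right[symmetric])
  finally show ?thesis .
qed

text \<open>All the weight sits on indices at least \<open>n\<close>, where the sequence is already
  close to its limit. This transfers limits from a sequence to its convex combinations, which later
  identifies both the limit trajectory and the values 1 and -1 of the limit sign.\<close>

lemma tail_weights_tendsto:
  fixes a :: "nat \<Rightarrow> real"
  assumes c: "\<And>n. tail_weights n (N n) (c n)" and a: "a \<longlonglongrightarrow> l"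
  shows "(\<lambda>n. \<Sum>k<N n. c n k * a k) \<longlonglongrightarrow> l"
proof (rule LIMSEQ_I)
  fix e :: real assume "0 < e"
  then obtain m where m: "\<And>k. m \<le> k \<Longrightarrow> \<bar>a k - l\<bar> < e / 2"
    using LIMSEQ_D[OF a, of "e/2"] by auto
  have "\<bar>(\<Sum>k<N n. c n k * a k) - l\<bar> < e" if "m \<le> n" for n
  proof -
    have "\<bar>(\<Sum>k<N n. c n k * a k) - l\<bar> \<le> e / 2"
      using c[of n] by (rule tail_weights_abs_le) (use m that in \<open>force intro: less_imp_le\<close>)
    then show ?thesis using \<open>0 < e\<close> by linarith
  qed
  then show "\<exists>no. \<forall>n\<ge>no. norm ((\<Sum>k<N n. c n k * a k) - l) < e" by auto
qed

text \<open>A strong form of weak sequential compactness of bounded sets in \<open>L\<^sup>2\<close>: almost minimal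
  elements of the convex hulls of the tails are Cauchy by the parallelogram law.\<close>
lemma (in finite_measure) AE_convergent_tail_convex_combinations:
  fixes w :: "nat \<Rightarrow> 'a \<Rightarrow> real"
  assumes [measurable]: "\<And>k. w k \<in> borel_measurable M"
    and bnd: "\<And>k x. \<bar>w k x\<bar> \<le> 1"
  obtains N c where "\<And>n. tail_weights n (N n) (c n)"
    "AE x in M. convergent (\<lambda>n. \<Sum>k<N n. c n k * w k x)"
proof -
  define v where "v N c x = (\<Sum>k<N. c k * w k x)" for N c x
  define Q where "Q N c = (\<integral>x. (v N c x)\<^sup>2 \<partial>M)" for N c
  define S where "S n = {Q N c | N c. tail_weights n N c}" for n
  define d where "d n = Inf (S n)" for n
  define m where "m = measure M (space M)"
  have [measurable]: "v N c \<in> borel_measurable M" for N c unfolding v_def by measurable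
  have v_bnd: "\<bar>v N c x\<bar> \<le> 1" if "tail_weights n N c" for n N c x
    using tail_weights_abs_le[OF that, of "\<lambda>k. w k x" 0 1] bnd by (simp add: v_def)
  have v_int: "integrable M (\<lambda>x. v N c x * v N' c' x)"
    if "tail_weights n N c" "tail_weights n' N' c'" for n N c n' N' c'
    by (rule integrable_const_bound[of _ 1])
      (auto simp: abs_mult intro!: AE_I2 mult_le_one v_bnd[OF that(1)] v_bnd[OF that(2)])
  have Q_le: "Q N c \<le> m" if "tail_weights n N c" for n N c
  proof -
    have "Q N c \<le> (\<integral>x. 1 \<partial>M)" unfolding Q_def
      using v_int[OF that that] v_bnd[OF that]
      by (intro integral_mono) (auto simp: power2_eq_square abs_square_le_1[unfolded power2_eq_square])
    then show ?thesis by (simp add: m_def)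
  qed
  have S_ne: "S n \<noteq> {}" for n
  proof -
    have "tail_weights n (Suc n) (\<lambda>k. if k = n then 1 else 0)" by (auto simp: tail_weights_def)
    then show ?thesis unfolding S_def by blast
  qed
  have S_bdd: "bdd_below (S n)" for n
    by (rule bdd_belowI[of _ 0]) (auto simp: S_def Q_def)
  have S_anti: "S n' \<subseteq> S n" if "n \<le> n'" for n n'
    using tail_weights_mono[OF _ that order_refl] by (auto simp: S_def)
  have d_lower: "d n \<le> Q N c" if "tail_weights n N c" for n N c
    unfolding d_def using that by (intro cInf_lower[OF _ S_bdd]) (auto simp: S_def)
  have d_mono: "incseq d"
    unfolding incseq_def d_def using S_anti S_ne S_bdd by (intro allI impI cInf_superset_mono) auto
  have d_le: "d n \<le> m" for n
    using S_ne[of n] d_lower[of n] Q_le[of n] by (fastforce simp: S_def)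
  obtain D where D: "d \<longlonglongrightarrow> D" "\<And>n. d n \<le> D"
    using incseq_convergent[OF d_mono] d_le by metis
  \<comment> \<open>\<open>d n\<close> is the infimum of the squared L^2 norms over the
    \<open>n\<close>-th tail hull; it increases to \<open>D\<close>. The tail index is pushed out
    until the infimum is within \<open>(1/8)^n\<close> of \<open>D\<close>.\<close>
  have "\<exists>r. n \<le> r \<and> D - (1/8)^n < d r" for n
  proof -
    have "eventually (\<lambda>r. D - (1/8)^n < d r) sequentially"
      using D(1) by (rule order_tendstoD) simp
    then show ?thesis
      by (metis eventually_sequentially nle_le)
  qed
  then obtain r0 where r0: "\<And>n. n \<le> r0 n" "\<And>n. D - (1/8)^n < d (r0 n)" by metis
  \<comment> \<open>The running maximum makes \<open>r\<close> monotone, so the combination chosen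
    at stage \<open>Suc n\<close> is also admissible for the tail used at stage
    \<open>n\<close>.\<close>
  define r where "r n = Max (r0 ` {..n})" for n
  have r_mono: "r n \<le> r n'" if "n \<le> n'" for n n'
    unfolding r_def using that by (intro Max_mono) auto
  have r0_le: "r0 n \<le> r n" for n unfolding r_def by (rule Max_ge) auto
  have r: "n \<le> r n" "D - (1/8)^n < d (r n)" for n
    using r0[of n] r0_le[of n] incseqD[OF d_mono r0_le[of n]] by auto
  have "\<exists>N c. tail_weights (r n) N c \<and> Q N c < D + (1/8)^n" for n
  proof -
    have "Inf (S (r n)) < D + (1/8)^n"
      using D(2)[of "r n"] by (simp add: d_def add_strict_increasing2 le_less_trans[of _ D])
    then obtain q where "q \<in> S (r n)" "q < D + (1/8)^n"
      using cInf_lessD[OF S_ne] by blast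
    then show ?thesis by (auto simp: S_def)
  qed
  then obtain N c where Nc: "\<And>n. tail_weights (r n) (N n) (c n)" "\<And>n. Q (N n) (c n) < D + (1/8)^n"
    by metis
  have "AE x in M. convergent (\<lambda>n. v (N n) (c n) x)"
  proof (rule AE_convergent_if_square_diffs_summable[where B = 8])
    fix n
    let ?a = "v (N n) (c n)" and ?b = "v (N (Suc n)) (c (Suc n))"
    define N' where "N' = max (N n) (N (Suc n))"
    \<comment> \<open>The midpoint of two admissible combinations is admissible for the tail
      \<open>r n\<close>, so its squared norm is at least \<open>d (r n)\<close>; this is where
      convexity enters.\<close>
    define c' where "c' k = (c n k + c (Suc n) k) / 2" for k
    have t1: "tail_weights (r n) N' (c n)"
      using Nc(1)[of n] by (rule tail_weights_mono) (auto simp: N'_def)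
    have t2: "tail_weights (r n) N' (c (Suc n))"
      using Nc(1)[of "Suc n"] by (rule tail_weights_mono) (auto simp: N'_def intro: r_mono)
    have t: "tail_weights (r n) N' c'"
      using t1 t2 unfolding tail_weights_def c'_def
      by (simp add: sum.distrib sum_divide_distrib[symmetric])
    have vc': "v N' c' x = (?a x + ?b x) / 2" for x
    proof -
      have "?a x = v N' (c n) x" "?b x = v N' (c (Suc n)) x" unfolding v_def
        by (rule tail_weights_sum_cong[OF Nc(1), symmetric]; simp add: N'_def)+
      then show ?thesis unfolding v_def c'_def
        by (simp add: sum.distrib[symmetric] sum_divide_distrib[symmetric] algebra_simps)
    qed
    have ints: "integrable M (\<lambda>x. (?a x)\<^sup>2)" "integrable M (\<lambda>x. (?b x)\<^sup>2)" "integrable M (\<lambda>x. (v N' c' x)\<^sup>2)"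
      using v_int[OF Nc(1)[of n] Nc(1)[of n]] v_int[OF Nc(1)[of "Suc n"] Nc(1)[of "Suc n"]] v_int[OF t t]
      by (simp_all add: power2_eq_square)
    have eq: "(?b x - ?a x)\<^sup>2 = 2 * (?a x)\<^sup>2 + 2 * (?b x)\<^sup>2 - 4 * (v N' c' x)\<^sup>2" for x
      unfolding vc' by (simp add: power2_eq_square algebra_simps add_divide_distrib)
    have "(\<integral>x. (?b x - ?a x)\<^sup>2 \<partial>M) = 2 * Q (N n) (c n) + 2 * Q (N (Suc n)) (c (Suc n)) - 4 * Q N' c'"
      unfolding Q_def eq using ints by simp
    \<comment> \<open>With \<open>e = (1/8)^n\<close>, the two norms are below \<open>D + e\<close>
      and the midpoint is above \<open>D - e\<close>, so the parallelogram identity leaves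
      \<open>2 (D + e) + 2 (D + e) - 4 (D - e) = 8 e\<close>.\<close>
    also have "\<dots> \<le> 8 * (1/8)^n"
    proof -
      have "(1/8::real)^Suc n \<le> (1/8)^n" by (rule power_decreasing) auto
      then show ?thesis
        using Nc(2)[of n] Nc(2)[of "Suc n"] d_lower[OF t] r(2)[of n] by argo
    qed
    finally have le: "(\<integral>x. (?b x - ?a x)\<^sup>2 \<partial>M) \<le> 8 * (1/8)^n" .
    have "(\<integral>\<^sup>+x. ennreal ((?b x - ?a x)\<^sup>2) \<partial>M) = ennreal (\<integral>x. (?b x - ?a x)\<^sup>2 \<partial>M)"
    proof (rule nn_integral_eq_integral)
      show "integrable M (\<lambda>x. (?b x - ?a x)\<^sup>2)" unfolding eq using ints by auto
    qed simp
    also have "\<dots> \<le> ennreal (8 * (1/8)^n)" using le by (rule ennreal_leI)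
    finally show "(\<integral>\<^sup>+x. ennreal ((?b x - ?a x)\<^sup>2) \<partial>M) \<le> ennreal (8 * (1/8)^n)" .
  qed auto
  then show thesis
    by (intro that[of N c]) (auto simp: v_def intro: tail_weights_mono[OF Nc(1) r(1)])
qed

subsection \<open>Borel representatives\<close>

text \<open>The restriction of \<open>lborel\<close> to \<open>S\<close>, kept as a measure on the whole space so that products of
  such measures are again of this form and all measurability conditions are plain Borel ones.\<close>
definition borel_on :: "'a::euclidean_space set \<Rightarrow> 'a measure" where
  "borel_on S = density lborel (indicator S)"

lemma space_borel_on [simp]: "space (borel_on S) = UNIV"
  by (simp add: borel_on_def)

lemma sets_borel_on [simp, measurable_cong]: "sets (borel_on S) = sets borel"
  by (simp add: borel_on_def)

lemma AE_borel_on: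
  assumes "S \<in> sets borel"
  shows "(AE x in borel_on S. P x) \<longleftrightarrow> (AE x in lborel. x \<in> S \<longrightarrow> P x)"
  using assms unfolding borel_on_def
  by (subst AE_density) (auto simp: indicator_def split: if_splits intro!: AE_cong)

lemma AE_in_borel_on:
  assumes "S \<in> sets borel"
  shows "AE x in borel_on S. x \<in> S"
  using assms by (simp add: AE_borel_on)

lemma AE_lebesgue_on_iff:
  assumes "S \<in> sets borel"
  shows "(AE x in lebesgue_on S. P x) \<longleftrightarrow> (AE x in borel_on S. P x)"
  using assms by (subst AE_restrict_space_iff) (auto simp: AE_completion_iff AE_borel_on)

lemma emeasure_borel_on:
  assumes "S \<in> sets borel" "A \<in> sets borel"
  shows "emeasure (borel_on S) A = emeasure lborel (S \<inter> A)"
  unfolding borel_on_def using assms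
  by (subst emeasure_density) (auto simp: indicator_inter_arith[symmetric])

lemma finite_measure_borel_on:
  assumes "S \<in> sets borel" "emeasure lborel S < \<infinity>"
  shows "finite_measure (borel_on S)"
  by standard (use assms in \<open>simp add: emeasure_borel_on\<close>)

lemma integral_borel_on:
  fixes f :: "'a::euclidean_space \<Rightarrow> real"
  assumes [measurable]: "S \<in> sets borel" "f \<in> borel_measurable borel"
  shows "integral\<^sup>L (borel_on S) f = (\<integral>x. indicator S x * f x \<partial>lborel)"
    and "integrable (borel_on S) f \<longleftrightarrow> integrable lborel (\<lambda>x. indicator S x * f x)"
proof -
  have "borel_on S = density lborel (\<lambda>x. ennreal (indicator S x))"
    unfolding borel_on_def by (rule arg_cong2[where f=density]) (auto simp: indicator_def)
  then show "integral\<^sup>L (borel_on S) f = (\<integral>x. indicator S x * f x \<partial>lborel)"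
    "integrable (borel_on S) f \<longleftrightarrow> integrable lborel (\<lambda>x. indicator S x * f x)"
    by (simp_all add: integral_density integrable_density)
qed

text \<open>Completeness of Lebesgue measure: the preimages under \<open>f\<close> and
  \<open>f'\<close> differ by a null set. Extending both functions by 0 outside \<open>S\<close>
  allows the argument to run on the whole space.\<close>

lemma borel_measurable_lebesgue_onI:
  fixes f :: "'a::euclidean_space \<Rightarrow> real"
  assumes [measurable]: "S \<in> sets borel" "f' \<in> borel_measurable borel"
    and ae: "AE x in borel_on S. f x = f' x"
  shows "f \<in> borel_measurable (lebesgue_on S)"
proof -
  have 1: "AE x in lborel. (if x \<in> S then f' x else 0) = (if x \<in> S then f x else 0)"
    using ae by (auto simp: AE_borel_on)
  have 2: "(\<lambda>x. if x \<in> S then f' x else 0) \<in> borel_measurable lebesgue"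
    by (intro measurable_completion) measurable
  have "(\<lambda>x. if x \<in> S then f x else 0) \<in> borel_measurable lebesgue"
  proof (rule measurableI)
    fix A :: "real set" assume [measurable]: "A \<in> sets borel"
    show "(\<lambda>x. if x \<in> S then f x else 0) -` A \<inter> space lebesgue \<in> sets lebesgue"
    proof (rule completion.in_sets_AE)
      show "(\<lambda>x. if x \<in> S then f' x else 0) -` A \<inter> space lebesgue \<in> sets lebesgue"
        using 2 by (rule measurable_sets) fact
      show "AE x in lebesgue. (x \<in> (\<lambda>x. if x \<in> S then f' x else 0) -` A \<inter> space lebesgue)
          = (x \<in> (\<lambda>x. if x \<in> S then f x else 0) -` A \<inter> space lebesgue)"
        using 1[THEN AE_completion] by eventually_elim auto
    qed auto
  qed auto
  then show ?thesis by (subst (asm) borel_measurable_if) auto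
qed

lemma borel_representative:
  fixes f :: "'a::euclidean_space \<Rightarrow> real"
  assumes [measurable]: "S \<in> sets borel" and "f \<in> borel_measurable (lebesgue_on S)"
  obtains f' where "f' \<in> borel_measurable borel" "AE x in borel_on S. f x = f' x"
proof -
  have "(\<lambda>x. if x \<in> S then f x else 0) \<in> borel_measurable lebesgue"
    using assms by (subst borel_measurable_if) auto
  then obtain f' where "f' \<in> borel_measurable lborel" "AE x in lborel. (if x \<in> S then f x else 0) = f' x"
    using completion_ex_borel_measurable_real by blast
  then show thesis by (intro that[of f']) (auto simp: AE_borel_on)
qed

text \<open>The bridge from the integrals in the definitions of the problem to Borel integrands. The
  equality of integrals also covers the nonintegrable case, in which both sides take the default
  value 0.\<close>

lemma lebesgue_on_eq_borel_on:
  fixes f :: "'a::euclidean_space \<Rightarrow> real"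
  assumes S [measurable]: "S \<in> sets borel" and f' [measurable]: "f' \<in> borel_measurable borel"
    and ae: "AE x in borel_on S. f x = f' x"
  shows integral_lebesgue_on_eq: "integral\<^sup>L (lebesgue_on S) f = integral\<^sup>L (borel_on S) f'"
    and integrable_lebesgue_on_iff: "integrable (lebesgue_on S) f \<longleftrightarrow> integrable (borel_on S) f'"
proof -
  have f: "f \<in> borel_measurable (lebesgue_on S)"
    using S f' ae by (rule borel_measurable_lebesgue_onI)
  have f'm: "f' \<in> borel_measurable (lebesgue_on S)"
    using S f' by (rule borel_measurable_lebesgue_onI) simp
  have ae': "AE x in lebesgue_on S. f x = f' x" using ae by (simp add: AE_lebesgue_on_iff)
  have "integral\<^sup>L (lebesgue_on S) f = integral\<^sup>L (lebesgue_on S) f'"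
    by (rule integral_cong_AE[OF f f'm ae'])
  also have "\<dots> = (\<integral>x. indicator S x * f' x \<partial>lebesgue)"
    by (subst integral_restrict_space) auto
  also have "\<dots> = integral\<^sup>L (borel_on S) f'"
    by (subst integral_completion) (auto simp: integral_borel_on)
  finally show "integral\<^sup>L (lebesgue_on S) f = integral\<^sup>L (borel_on S) f'" .
  have "integrable (lebesgue_on S) f \<longleftrightarrow> integrable (lebesgue_on S) f'"
    by (rule integrable_cong_AE[OF f f'm ae'])
  also have "\<dots> \<longleftrightarrow> integrable lebesgue (\<lambda>x. indicator S x * f' x)"
    by (subst integrable_restrict_space) auto
  also have "\<dots> \<longleftrightarrow> integrable (borel_on S) f'"
    by (subst integrable_completion) (auto simp: integral_borel_on)
  finally show "integrable (lebesgue_on S) f \<longleftrightarrow> integrable (borel_on S) f'" .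
qed

lemma integrable_borel_representative:
  fixes f :: "'a::euclidean_space \<Rightarrow> real"
  assumes S: "S \<in> sets borel" and f: "integrable (lebesgue_on S) f"
  obtains f' where "f' \<in> borel_measurable borel" "AE x in borel_on S. f x = f' x"
    "integrable (borel_on S) f'"
proof -
  obtain f' where f': "f' \<in> borel_measurable borel" "AE x in borel_on S. f x = f' x"
    using borel_representative[OF S borel_measurable_integrable[OF f]] .
  then show thesis using that f integrable_lebesgue_on_iff[OF S f'] by blast
qed

lemma borel_on_prod:
  assumes [measurable]: "S \<in> sets borel" "S' \<in> sets borel" and "emeasure lborel S' < \<infinity>"
  shows "borel_on S \<Otimes>\<^sub>M borel_on S' = borel_on (S \<times> S')"
proof -
  interpret finite_measure "borel_on S'" by (rule finite_measure_borel_on) fact+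
  have "borel_on S \<Otimes>\<^sub>M borel_on S'
      = density (lborel \<Otimes>\<^sub>M lborel) (\<lambda>(x,y). indicator S x * indicator S' y)"
    unfolding borel_on_def
    by (rule pair_measure_density)
      (auto intro: lborel.sigma_finite_measure_axioms
        sigma_finite_measure_axioms[unfolded borel_on_def])
  also have "\<dots> = borel_on (S \<times> S')"
    unfolding borel_on_def lborel_prod
    by (rule arg_cong2[where f=density]) (auto simp: indicator_def fun_eq_iff)
  finally show ?thesis .
qed

text \<open>The weak derivative is posed on the open time interval and the data on the closed one.
  As the endpoints are null, one measure serves both.\<close>

lemma borel_on_Icc_Ioo: "borel_on {a..b::real} = borel_on {a<..<b}"
  unfolding borel_on_def
proof (rule density_cong)
  have "AE x in lborel. x \<noteq> a" "AE x in lborel. x \<noteq> b" for a b :: real by (rule AE_lborel_singleton)+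
  then have "AE x in lborel. x \<noteq> a \<and> x \<noteq> b" by (intro AE_conjI)
  then show "AE x in lborel. (indicator {a..b} x :: ennreal) = indicator {a<..<b} x"
    by eventually_elim (auto simp: indicator_def)
qed auto

subsection \<open>Primitives in time\<close>

lemma finite_measure_Icc: "finite_measure (borel_on {a..b::real})"
  by (rule finite_measure_borel_on) (auto simp: emeasure_lborel_Icc_eq)

lemma AE_borel_on_neq: "AE s in borel_on {a..b::real}. s \<noteq> c"
  using AE_lborel_singleton[of c] by (subst AE_borel_on) (auto elim!: eventually_mono)

lemma sets_borel_Pair [measurable_cong]:
  "sets (borel_on S \<Otimes>\<^sub>M M) = sets (borel \<Otimes>\<^sub>M M)" "sets (M \<Otimes>\<^sub>M borel_on S) = sets (M \<Otimes>\<^sub>M borel)"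
  by (auto intro!: sets_pair_measure_cong)

lemma (in pair_sigma_finite) integrable_prod_mult:
  fixes f g :: "_ \<Rightarrow> real"
  assumes f: "integrable M1 f" and g: "integrable M2 g"
  shows "integrable (M1 \<Otimes>\<^sub>M M2) (\<lambda>(x, y). f x * g y)"
proof (rule Fubini_integrable)
  have [measurable]: "f \<in> borel_measurable M1" "g \<in> borel_measurable M2" using f g by auto
  show "(\<lambda>(x, y). f x * g y) \<in> borel_measurable (M1 \<Otimes>\<^sub>M M2)" by measurable
  show "integrable M1 (\<lambda>x. \<integral>y. norm (case (x, y) of (x, y) \<Rightarrow> f x * g y) \<partial>M2)"
    using f by (simp add: abs_mult)
  show "AE x in M1. integrable M2 (\<lambda>y. case (x, y) of (x, y) \<Rightarrow> f x * g y)"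
    using g by simp
qed

text \<open>Outside of \<open>[0, T]\<close> this is the constant extension of the primitive on \<open>[0, T]\<close>.\<close>
definition cum :: "real \<Rightarrow> (real \<Rightarrow> real) \<Rightarrow> real \<Rightarrow> real" where
  "cum T V t = (\<integral>s. indicator {..<t} s * V s \<partial>borel_on {0..T})"

lemma cum_nonpos: "t \<le> 0 \<Longrightarrow> cum T V t = 0"
  unfolding cum_def
proof -
  assume "t \<le> 0"
  then have "AE s in borel_on {0..T}. indicator {..<t} s * V s = 0"
    using AE_in_borel_on[of "{0..T}"] by (auto simp: indicator_def elim!: eventually_mono)
  then show "(\<integral>s. indicator {..<t} s * V s \<partial>borel_on {0..T}) = 0" by (rule integral_eq_zero_AE)
qed

lemma integrable_indicator_mult:
  fixes V :: "real \<Rightarrow> real"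
  assumes "integrable (borel_on S) V" "A \<in> sets borel"
  shows "integrable (borel_on S) (\<lambda>s. indicator A s * V s)"
  using integrable_real_mult_indicator[of A "borel_on S" V] assms by (simp add: mult.commute)

text \<open>Causality of the primitive, the property on which the method of steps rests.\<close>

lemma cum_cong: "(\<And>s. s < t \<Longrightarrow> V s = W s) \<Longrightarrow> cum T V t = cum T W t"
  unfolding cum_def by (intro Bochner_Integration.integral_cong) (auto simp: indicator_def)

lemma cum_cong_AE:
  assumes "V \<in> borel_measurable borel" "W \<in> borel_measurable borel"
    "AE s in borel_on {0..T}. s < t \<longrightarrow> V s = W s"
  shows "cum T V t = cum T W t"
  unfolding cum_def
  using assms by (intro integral_cong_AE) (auto simp: indicator_def elim!: eventually_mono)

lemma cum_diff:
  assumes "integrable (borel_on {0..T}) V" "integrable (borel_on {0..T}) W"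
  shows "cum T (\<lambda>s. V s - W s) t = cum T V t - cum T W t"
  unfolding cum_def right_diff_distrib
  using assms by (intro Bochner_Integration.integral_diff integrable_indicator_mult) auto

lemma cum_add:
  assumes "integrable (borel_on {0..T}) V" "integrable (borel_on {0..T}) W"
  shows "cum T (\<lambda>s. V s + W s) t = cum T V t + cum T W t"
  unfolding cum_def distrib_left
  using assms by (intro Bochner_Integration.integral_add integrable_indicator_mult) auto

lemma cum_sum:
  assumes "\<And>k. k \<in> A \<Longrightarrow> integrable (borel_on {0..T}) (V k)"
  shows "cum T (\<lambda>s. \<Sum>k\<in>A. c k * V k s) t = (\<Sum>k\<in>A. c k * cum T (V k) t)"
proof -
  have "cum T (\<lambda>s. \<Sum>k\<in>A. c k * V k s) t
      = (\<integral>s. (\<Sum>k\<in>A. c k * (indicator {..<t} s * V k s)) \<partial>borel_on {0..T})"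
    unfolding cum_def by (simp add: sum_distrib_left mult.left_commute)
  also have "\<dots> = (\<Sum>k\<in>A. (\<integral>s. c k * (indicator {..<t} s * V k s) \<partial>borel_on {0..T}))"
    using assms by (intro Bochner_Integration.integral_sum integrable_mult_right integrable_indicator_mult) auto
  finally show ?thesis unfolding cum_def by simp
qed

lemma cum_increment:
  assumes "integrable (borel_on {0..T}) V" "s \<le> t"
  shows "cum T V t - cum T V s = (\<integral>r. indicator {s..<t} r * V r \<partial>borel_on {0..T})"
proof -
  have "cum T V t - cum T V s
      = (\<integral>r. indicator {..<t} r * V r - indicator {..<s} r * V r \<partial>borel_on {0..T})"
    unfolding cum_def using assms(1)
    by (intro Bochner_Integration.integral_diff[symmetric] integrable_indicator_mult) auto
  also have "\<dots> = (\<integral>r. indicator {s..<t} r * V r \<partial>borel_on {0..T})"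
    using assms(2) by (intro Bochner_Integration.integral_cong) (auto simp: indicator_def)
  finally show ?thesis .
qed

lemma integrable_bounded_Icc:
  fixes V :: "real \<Rightarrow> real"
  assumes "V \<in> borel_measurable borel" "\<And>s. \<bar>V s\<bar> \<le> C"
  shows "integrable (borel_on {0..T}) V"
  by (rule finite_measure.integrable_const_bound[OF finite_measure_Icc, of _ C]) (use assms in auto)

lemma cum_abs_le_integral:
  assumes "integrable (borel_on {0..T}) V"
  shows "\<bar>cum T V t\<bar> \<le> (\<integral>s. \<bar>V s\<bar> \<partial>borel_on {0..T})"
proof -
  have "\<bar>cum T V t\<bar> \<le> (\<integral>s. \<bar>indicator {..<t} s * V s\<bar> \<partial>borel_on {0..T})"
    unfolding cum_def by (rule integral_abs_bound)
  also have "\<dots> \<le> (\<integral>s. \<bar>V s\<bar> \<partial>borel_on {0..T})"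
    using assms by (intro integral_mono integrable_abs integrable_indicator_mult) (auto simp: indicator_def)
  finally show ?thesis .
qed

lemma measure_borel_on_Ico_le:
  assumes "s \<le> t"
  shows "measure (borel_on {0..T}) {s..<t::real} \<le> t - s"
proof -
  have "emeasure (borel_on {0..T}) {s..<t} \<le> emeasure lborel {s..<t}"
    by (simp add: emeasure_borel_on emeasure_mono)
  also have "\<dots> = ennreal (t - s)" using assms by simp
  finally show ?thesis using assms
    by (auto simp: measure_def intro: enn2real_leI)
qed

text \<open>The bound holds for all real times because the primitive is constant outside of the
  interval; delayed times may be negative.\<close>

lemma cum_lipschitz:
  assumes [measurable]: "V \<in> borel_measurable borel" and C: "\<And>s. \<bar>V s\<bar> \<le> C"
  shows "\<bar>cum T V t - cum T V s\<bar> \<le> C * \<bar>t - s\<bar>"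
proof -
  interpret finite_measure "borel_on {0..T}" by (rule finite_measure_Icc)
  have int: "integrable (borel_on {0..T}) V" using integrable_bounded_Icc[OF assms] .
  have C0: "0 \<le> C" using C[of 0] by simp
  have main: "\<bar>cum T V t - cum T V s\<bar> \<le> C * (t - s)" if "s \<le> t" for s t
  proof -
    have "\<bar>cum T V t - cum T V s\<bar> \<le> (\<integral>r. \<bar>indicator {s..<t} r * V r\<bar> \<partial>borel_on {0..T})"
      unfolding cum_increment[OF int that] by (rule integral_abs_bound)
    also have "\<dots> \<le> (\<integral>r. C * indicator {s..<t} r \<partial>borel_on {0..T})"
    proof (rule integral_mono)
      show "integrable (borel_on {0..T}) (\<lambda>r. C * indicator {s..<t} r)"
        by (intro integrable_mult_right integrable_real_indicator) (auto simp: emeasure_eq_measure)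
      show "integrable (borel_on {0..T}) (\<lambda>r. \<bar>indicator {s..<t} r * V r\<bar>)"
        by (intro integrable_abs integrable_indicator_mult int) auto
    qed (use C C0 in \<open>auto simp: indicator_def\<close>)
    also have "\<dots> = C * measure (borel_on {0..T}) {s..<t}" by simp
    also have "\<dots> \<le> C * (t - s)" using measure_borel_on_Ico_le[OF that] C0 by (rule mult_left_mono)
    finally show ?thesis .
  qed
  show ?thesis using main[of s t] main[of t s] by (cases "s \<le> t") (auto simp: abs_minus_commute)
qed

lemma borel_measurable_cum [measurable (raw)]:
  assumes [measurable]: "(\<lambda>(x, s). V x s) \<in> borel_measurable (M \<Otimes>\<^sub>M borel)"
    "t \<in> borel_measurable M"
  shows "(\<lambda>x. cum T (V x) (t x)) \<in> borel_measurable M"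
proof -
  interpret finite_measure "borel_on {0..T}" by (rule finite_measure_Icc)
  show ?thesis unfolding cum_def
  proof (rule borel_measurable_lebesgue_integral)
    have "(\<lambda>(x, s). (if s < t x then 1 else 0) * V x s) \<in> borel_measurable (M \<Otimes>\<^sub>M borel)"
      by measurable
    then have "(\<lambda>(x, s). indicator {..<t x} s * V x s) \<in> borel_measurable (M \<Otimes>\<^sub>M borel)"
      by (simp add: indicator_def if_distrib cong: if_cong)
    then show "(\<lambda>(x, s). indicator {..<t x} s * V x s) \<in> borel_measurable (M \<Otimes>\<^sub>M borel_on {0..T})"
      by (simp cong: measurable_cong_sets)
  qed
qed

lemma borel_measurable_cum_time:
  assumes [measurable]: "V \<in> borel_measurable borel"
  shows "cum T V \<in> borel_measurable borel"
proof -
  have "(\<lambda>(x, s). V s) \<in> borel_measurable (borel \<Otimes>\<^sub>M borel)" by measurable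
  from borel_measurable_cum[OF this, of "\<lambda>t. t"] show ?thesis by simp
qed

text \<open>Fubini on the triangle \<open>s < t\<close>. It replaces integration by parts for
  primitives of functions that are merely integrable.\<close>

lemma cum_triangle:
  assumes A: "integrable (borel_on {0..T}) A" and V: "integrable (borel_on {0..T}) V"
  shows "(\<integral>t. A t * cum T V t \<partial>borel_on {0..T})
    = (\<integral>s. V s * (\<integral>t. indicator {s<..} t * A t \<partial>borel_on {0..T}) \<partial>borel_on {0..T})"
proof -
  let ?I = "borel_on {0..T}"
  interpret finite_measure ?I by (rule finite_measure_Icc)
  interpret P: pair_sigma_finite ?I ?I ..
  have [measurable]: "A \<in> borel_measurable borel" "V \<in> borel_measurable borel"
    using borel_measurable_integrable[OF A] borel_measurable_integrable[OF V]
    by (simp_all cong: measurable_cong_sets)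
  have int: "integrable (?I \<Otimes>\<^sub>M ?I) (\<lambda>(t, s). (if s < t then 1 else 0) * (A t * V s))"
    by (rule Bochner_Integration.integrable_bound[OF P.integrable_prod_mult[OF A V]]) auto
  have "(\<integral>t. A t * cum T V t \<partial>?I) = (\<integral>t. \<integral>s. (if s < t then 1 else 0) * (A t * V s) \<partial>?I \<partial>?I)"
    unfolding cum_def integral_mult_right_zero[symmetric]
    by (intro Bochner_Integration.integral_cong) (auto simp: indicator_def)
  also have "\<dots> = (\<integral>s. \<integral>t. (if s < t then 1 else 0) * (A t * V s) \<partial>?I \<partial>?I)"
    by (rule P.Fubini_integral[symmetric]) (use int in \<open>simp add: case_prod_beta'\<close>)
  also have "\<dots> = (\<integral>s. V s * (\<integral>t. indicator {s<..} t * A t \<partial>?I) \<partial>?I)"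
    unfolding integral_mult_right_zero[symmetric]
    by (intro Bochner_Integration.integral_cong) (auto simp: indicator_def)
  finally show ?thesis .
qed

text \<open>The chain rule for the square of an absolutely continuous function, obtained without
  differentiating: \<open>cum_triangle\<close> for \<open>W\<close> against itself gives
  \<open>X = J * J - X\<close>, where \<open>X\<close> is the integral of \<open>W * cum T W\<close>
  and \<open>J\<close> that of \<open>W\<close>.\<close>

lemma cum_square:
  assumes V: "integrable (borel_on {0..T}) V"
  shows "(cum T V t)\<^sup>2 = 2 * cum T (\<lambda>s. V s * cum T V s) t"
proof -
  let ?I = "borel_on {0..T}"
  interpret finite_measure ?I by (rule finite_measure_Icc)
  \<comment> \<open>Cutting \<open>V\<close> off at \<open>t\<close> turns the primitive at time
    \<open>t\<close> into the integral over the whole interval.\<close>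
  define W where "W s = indicator {..<t} s * V s" for s
  have W: "integrable ?I W" unfolding W_def using V by (rule integrable_indicator_mult) auto
  have [measurable]: "W \<in> borel_measurable borel"
    using borel_measurable_integrable[OF W] by (simp cong: measurable_cong_sets)
  define J where "J = integral\<^sup>L ?I W"
  have split: "(\<integral>r. indicator {s<..} r * W r \<partial>?I) = J - cum T W s" for s
  proof -
    have "J = (\<integral>r. indicator {..<s} r * W r + indicator {s<..} r * W r \<partial>?I)"
      unfolding J_def
      using AE_borel_on_neq[of s 0 T] by (intro integral_cong_AE) (auto elim!: eventually_mono simp: indicator_def)
    also have "\<dots> = cum T W s + (\<integral>r. indicator {s<..} r * W r \<partial>?I)"
      unfolding cum_def using W by (intro Bochner_Integration.integral_add integrable_indicator_mult) auto
    finally show ?thesis by simp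
  qed
  note cumb = cum_abs_le_integral[OF W]
  have [measurable]: "cum T W \<in> borel_measurable borel"
    by (rule borel_measurable_cum_time) fact
  have int: "integrable ?I (\<lambda>s. W s * cum T W s)"
  proof (rule Bochner_Integration.integrable_bound)
    show "integrable ?I (\<lambda>s. W s * (\<integral>r. \<bar>W r\<bar> \<partial>?I))" using W by simp
    show "AE s in ?I. norm (W s * cum T W s) \<le> norm (W s * (\<integral>r. \<bar>W r\<bar> \<partial>?I))"
      using cumb by (intro AE_I2) (auto simp: abs_mult intro!: mult_left_mono order_trans[OF cumb])
  qed (simp cong: measurable_cong_sets)
  have "(\<integral>s. W s * cum T W s \<partial>?I) = (\<integral>s. W s * (J - cum T W s) \<partial>?I)"
    using cum_triangle[OF W W] by (simp add: split)
  also have "\<dots> = J * J - (\<integral>s. W s * cum T W s \<partial>?I)"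
    using W int by (simp add: right_diff_distrib J_def)
  finally have "J\<^sup>2 = 2 * (\<integral>s. W s * cum T W s \<partial>?I)" by (simp add: power2_eq_square)
  moreover have "W s * cum T W s = indicator {..<t} s * (V s * cum T V s)" for s
  proof (cases "s < t")
    case True
    then have "cum T W s = cum T V s" unfolding cum_def W_def
      by (intro Bochner_Integration.integral_cong) (auto simp: indicator_def)
    then show ?thesis by (simp add: W_def)
  qed (simp add: W_def)
  moreover have "J = cum T V t" unfolding J_def W_def cum_def ..
  ultimately show ?thesis unfolding cum_def[of T "\<lambda>s. V s * cum T V s"] by simp
qed

section \<open>Testing primitives against smooth functions\<close>

lemma test_fun_has_deriv:
  assumes "test_fun T \<phi>"
  shows "(\<phi> has_real_derivative deriv \<phi> t) (at t)" "continuous_on A (deriv \<phi>)"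
    "continuous_on A \<phi>"
proof -
  have "((deriv ^^ 0) \<phi>) differentiable (at t)" "((deriv ^^ 1) \<phi>) differentiable (at t)" for t
    using assms unfolding test_fun_def by blast+
  then show "(\<phi> has_real_derivative deriv \<phi> t) (at t)" "continuous_on A (deriv \<phi>)"
    "continuous_on A \<phi>"
    by (auto simp: DERIV_deriv_iff_real_differentiable
        intro!: continuous_at_imp_continuous_on differentiable_imp_continuous_within)
qed

lemma test_fun_ends:
  assumes "test_fun T \<phi>"
  shows "\<phi> 0 = 0" "\<phi> T = 0"
  using assms unfolding test_fun_def by (metis atLeastAtMost_iff not_le)+

lemma test_fun_measurable:
  assumes "test_fun T \<phi>"
  shows "\<phi> \<in> borel_measurable borel" "deriv \<phi> \<in> borel_measurable borel"
  by (intro borel_measurable_continuous_onI test_fun_has_deriv(2,3)[OF assms])+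

lemma test_fun_deriv_bounded:
  assumes "test_fun T \<phi>"
  obtains B where "\<And>t. \<bar>deriv \<phi> t\<bar> \<le> B" "\<And>t. \<bar>\<phi> t\<bar> \<le> B"
proof -
  obtain a b where ab: "0 < a" "a \<le> b" "b < T" "\<And>t. t \<notin> {a..b} \<Longrightarrow> \<phi> t = 0"
    using assms unfolding test_fun_def by blast
  have "compact (deriv \<phi> ` {a..b} \<union> \<phi> ` {a..b})"
    by (intro compact_Un compact_continuous_image test_fun_has_deriv(2,3)[OF assms] compact_Icc)
  then have "bounded (deriv \<phi> ` {a..b} \<union> \<phi> ` {a..b})" by (rule compact_imp_bounded)
  then obtain B where B: "\<And>y. y \<in> deriv \<phi> ` {a..b} \<union> \<phi> ` {a..b} \<Longrightarrow> \<bar>y\<bar> \<le> B"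
    unfolding bounded_iff real_norm_def by blast
  have "\<bar>\<phi> a\<bar> \<le> B" using ab by (intro B) auto
  then have B0: "0 \<le> B" by linarith
  have "deriv \<phi> t = 0" if "t \<notin> {a..b}" for t
  proof -
    \<comment> \<open>The complement of the support interval is open, so the function vanishes near
      \<open>t\<close> and not only at \<open>t\<close>; this makes its derivative vanish
      too.\<close>
    have "eventually (\<lambda>s. s \<in> - {a..b}) (nhds t)"
      using that by (intro eventually_nhds_in_open) auto
    then have "eventually (\<lambda>s. \<phi> s = 0) (nhds t)"
      by eventually_elim (use ab in auto)
    then have "deriv \<phi> t = deriv (\<lambda>_. 0) t" by (intro deriv_cong_ev) auto
    then show ?thesis by simp
  qed
  then have "\<bar>deriv \<phi> t\<bar> \<le> B" "\<bar>\<phi> t\<bar> \<le> B" for t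
    using B[of "deriv \<phi> t"] B[of "\<phi> t"] B0 ab(4)[of t] by (cases "t \<in> {a..b}"; simp)+
  then show thesis by (rule that)
qed

lemma integral_deriv_test_fun:
  assumes \<phi>: "test_fun T \<phi>" and s: "0 \<le> s" "s \<le> T"
  shows "(\<integral>t. indicator {s<..} t * deriv \<phi> t \<partial>borel_on {0..T}) = - \<phi> s"
proof -
  note [measurable] = test_fun_measurable[OF \<phi>]
  have "(\<integral>t. indicator {s<..} t * deriv \<phi> t \<partial>borel_on {0..T})
      = (\<integral>t. indicator {0..T} t * (indicator {s<..} t * deriv \<phi> t) \<partial>lborel)"
    by (rule integral_borel_on) auto
  also have "\<dots> = (\<integral>t. deriv \<phi> t * indicator {s..T} t \<partial>lborel)"
  proof (rule integral_cong_AE)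
    show "AE t in lborel. indicator {0..T} t * (indicator {s<..} t * deriv \<phi> t)
        = deriv \<phi> t * indicator {s..T} t"
      using AE_lborel_singleton[of s] by eventually_elim (use s in \<open>auto simp: indicator_def\<close>)
  qed auto
  also have "\<dots> = \<phi> T - \<phi> s"
    by (rule integral_FTC_Icc_real)
      (use s test_fun_has_deriv(1)[OF \<phi>] test_fun_has_deriv(2)[OF \<phi>, of UNIV]
        in \<open>auto simp: continuous_on_eq_continuous_at\<close>)
  finally show ?thesis using test_fun_ends[OF \<phi>] by simp
qed

text \<open>By \<open>cum_triangle\<close> the derivative of the test function is integrated over
  the times after \<open>s\<close>, which gives \<open>- \<phi> s\<close>. The constant
  \<open>c\<close> drops out because the test function vanishes at both ends.\<close>

lemma cum_weak_derivative:
  assumes \<phi>: "test_fun T \<phi>" and V: "integrable (borel_on {0..T}) V"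
  shows "(\<integral>t. (c + cum T V t) * deriv \<phi> t \<partial>borel_on {0..T}) = - (\<integral>t. V t * \<phi> t \<partial>borel_on {0..T})"
proof (cases "0 \<le> T")
  case True
  let ?I = "borel_on {0..T}"
  note [measurable] = test_fun_measurable[OF \<phi>]
  obtain B where B: "\<And>t. \<bar>deriv \<phi> t\<bar> \<le> B" using test_fun_deriv_bounded[OF \<phi>] by metis
  have int: "integrable ?I (deriv \<phi>)" using B by (intro integrable_bounded_Icc) auto
  have [measurable]: "V \<in> borel_measurable borel"
    using borel_measurable_integrable[OF V] by (simp cong: measurable_cong_sets)
  have "(\<integral>t. deriv \<phi> t \<partial>?I) = (\<integral>t. indicator {0<..} t * deriv \<phi> t \<partial>?I)"
  proof (rule integral_cong_AE)
    have "AE t in ?I. t \<in> {0..T}" by (rule AE_in_borel_on) simp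
    with AE_borel_on_neq[of 0 0 T] show "AE t in ?I. deriv \<phi> t = indicator {0<..} t * deriv \<phi> t"
      by eventually_elim auto
  qed auto
  then have 0: "(\<integral>t. deriv \<phi> t \<partial>?I) = 0"
    using integral_deriv_test_fun[OF \<phi>, of 0] True test_fun_ends[OF \<phi>] by simp
  have [measurable]: "cum T V \<in> borel_measurable borel"
    by (rule borel_measurable_cum_time) fact
  note cumb = cum_abs_le_integral[OF V]
  have int2: "integrable ?I (\<lambda>s. deriv \<phi> s * cum T V s)"
  proof (rule integrable_bounded_Icc)
    show "\<bar>deriv \<phi> s * cum T V s\<bar> \<le> B * (\<integral>r. \<bar>V r\<bar> \<partial>?I)" for s
      unfolding abs_mult using B[of s] cumb[of s] by (intro mult_mono) auto
  qed measurable
  have "(\<integral>t. (c + cum T V t) * deriv \<phi> t \<partial>?I) = (\<integral>t. c * deriv \<phi> t + deriv \<phi> t * cum T V t \<partial>?I)"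
    by (simp add: algebra_simps)
  also have "\<dots> = (\<integral>t. deriv \<phi> t * cum T V t \<partial>?I)"
    using int int2 0 by simp
  also have "\<dots> = (\<integral>s. V s * (\<integral>t. indicator {s<..} t * deriv \<phi> t \<partial>?I) \<partial>?I)"
    using int V by (rule cum_triangle)
  also have "\<dots> = (\<integral>s. - (V s * \<phi> s) \<partial>?I)"
  proof (rule integral_cong_AE)
    show "AE s in ?I. V s * (\<integral>t. indicator {s<..} t * deriv \<phi> t \<partial>?I) = - (V s * \<phi> s)"
      using AE_in_borel_on[OF borel_closed[OF closed_atLeastAtMost]]
      by eventually_elim (simp add: integral_deriv_test_fun[OF \<phi>])
    interpret finite_measure ?I by (rule finite_measure_Icc)
    have "(\<lambda>(s, t). (if s < t then 1 else 0) * deriv \<phi> t) \<in> borel_measurable (borel \<Otimes>\<^sub>M borel)"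
      by measurable
    then have "(\<lambda>s. \<integral>t. indicator {s<..} t * deriv \<phi> t \<partial>?I) \<in> borel_measurable borel"
      by (intro borel_measurable_lebesgue_integral)
        (simp add: indicator_def if_distrib cong: if_cong measurable_cong_sets)
    then show "(\<lambda>s. V s * (\<integral>t. indicator {s<..} t * deriv \<phi> t \<partial>?I)) \<in> borel_measurable ?I"
      by (simp cong: measurable_cong_sets)
  qed simp
  finally show ?thesis by simp
next
  case False
  \<comment> \<open>For negative \<open>T\<close> the measure is zero, and so are both
    integrals.\<close>
  then have "{0..T} = {}" by auto
  then have "AE t in borel_on {0..T}. False" using AE_in_borel_on[of "{0..T}"] by simp
  then show ?thesis by (simp add: integral_eq_zero_AE eventually_mono)
qed

lemma cum_dominated_convergence:
  assumes [measurable]: "\<And>n. V n \<in> borel_measurable borel" "W \<in> borel_measurable borel"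
    and C: "\<And>n s. \<bar>V n s\<bar> \<le> C" and lim: "AE s in borel_on {0..T}. (\<lambda>n. V n s) \<longlonglongrightarrow> W s"
  shows "(\<lambda>n. cum T (V n) t) \<longlonglongrightarrow> cum T W t"
  unfolding cum_def
proof (rule integral_dominated_convergence[where w = "\<lambda>_. C"])
  show "integrable (borel_on {0..T}) (\<lambda>_. C)"
    by (rule integrable_bounded_Icc[where C = "\<bar>C\<bar>"]) auto
  have "0 \<le> C" using C[of 0 0] by simp
  then show "AE s in borel_on {0..T}. norm (indicator {..<t} s * V n s) \<le> C" for n
    using C by (auto simp: indicator_def)
  show "AE s in borel_on {0..T}. (\<lambda>n. indicator {..<t} s * V n s) \<longlonglongrightarrow> indicator {..<t} s * W s"
    using lim by eventually_elim (rule tendsto_mult_left)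
qed measurable

lemma cum_abs_le:
  assumes [measurable]: "V \<in> borel_measurable borel" and C: "\<And>s. \<bar>V s\<bar> \<le> C" and "0 \<le> T"
  shows "\<bar>cum T V t\<bar> \<le> C * T"
proof -
  interpret finite_measure "borel_on {0..T}" by (rule finite_measure_Icc)
  have int: "integrable (borel_on {0..T}) V" by (rule integrable_bounded_Icc) fact+
  have "emeasure (borel_on {0..T}) UNIV = ennreal T"
    using \<open>0 \<le> T\<close> by (simp add: emeasure_borel_on)
  then have T: "measure (borel_on {0..T}) UNIV = T" using \<open>0 \<le> T\<close> by (simp add: measure_def)
  have "\<bar>cum T V t\<bar> \<le> (\<integral>s. \<bar>V s\<bar> \<partial>borel_on {0..T})" using int by (rule cum_abs_le_integral)
  also have "\<dots> \<le> (\<integral>s. C \<partial>borel_on {0..T})"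
    using C int by (intro integral_mono) auto
  also have "\<dots> = C * T" by (simp add: T)
  finally show ?thesis .
qed

lemma cum_tendsto:
  assumes V: "integrable (borel_on {0..T}) V"
  shows "(cum T V \<longlongrightarrow> cum T V t) (at t within S)"
  unfolding tendsto_at_iff_sequentially comp_def
proof (intro allI impI)
  fix X :: "nat \<Rightarrow> real" assume X: "X \<longlonglongrightarrow> t"
  have [measurable]: "V \<in> borel_measurable borel"
    using borel_measurable_integrable[OF V] by (simp cong: measurable_cong_sets)
  show "(\<lambda>n. cum T V (X n)) \<longlonglongrightarrow> cum T V t"
    unfolding cum_def
  proof (rule integral_dominated_convergence[where w = "\<lambda>s. \<bar>V s\<bar>"])
    show "AE s in borel_on {0..T}. (\<lambda>n. indicator {..<X n} s * V s) \<longlonglongrightarrow> indicator {..<t} s * V s"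
      using AE_borel_on_neq[of t 0 T]
    proof eventually_elim
      case (elim s)
      consider "s < t" | "t < s" using elim by linarith
      then have "eventually (\<lambda>n. indicator {..<X n} s * V s = indicator {..<t} s * V s) sequentially"
      proof cases
        case 1
        show ?thesis using order_tendstoD(1)[OF X 1] by eventually_elim (use 1 in simp)
      next
        case 2
        show ?thesis using order_tendstoD(2)[OF X 2] by eventually_elim (use 2 in simp)
      qed
      then show ?case by (rule tendsto_eventually)
    qed
  qed (use V in \<open>auto simp: indicator_def\<close>)
qed

lemma (in pair_sigma_finite) AE_pair_swap:
  assumes "AE z in M1 \<Otimes>\<^sub>M M2. Q z"
  shows "AE z in M2 \<Otimes>\<^sub>M M1. Q (snd z, fst z)"
proof -
  have "AE z in distr (M2 \<Otimes>\<^sub>M M1) (M1 \<Otimes>\<^sub>M M2) (\<lambda>(x, y). (y, x)). Q z"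
    using assms by (subst distr_pair_swap[symmetric])
  from AE_distrD[OF measurable_pair_swap' this] show ?thesis by (simp add: case_prod_beta')
qed

section \<open>Primitives in time of functions that also depend on a space variable\<close>

context finite_measure
begin

text \<open>The integral of \<open>\<bar>V x s\<bar>\<close> over all \<open>s\<close> dominates the
  primitive at every time at once. Hence every time slice is integrable, and not just almost every
  one as Fubini alone would give.\<close>

lemma integrable_pair_cum:
  assumes V [measurable]: "(\<lambda>(x, s). V x s) \<in> borel_measurable (M \<Otimes>\<^sub>M borel)"
    and int: "integrable (M \<Otimes>\<^sub>M borel_on {0..T}) (\<lambda>(x, s). V x s)"
  shows "integrable (M \<Otimes>\<^sub>M borel_on {0..T}) (\<lambda>(x, t). cum T (V x) t)"
    and "integrable M (\<lambda>x. cum T (V x) t)"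
proof -
  let ?I = "borel_on {0..T}"
  interpret I: finite_measure ?I by (rule finite_measure_Icc)
  interpret MI: pair_sigma_finite M ?I ..
  have ae: "AE x in M. integrable ?I (V x)" using MI.AE_integrable_fst'[OF int] by simp
  have abs: "integrable (M \<Otimes>\<^sub>M ?I) (\<lambda>(x, s). \<bar>V x s\<bar>)"
    using integrable_abs[OF int] by (simp add: case_prod_beta')
  have b: "integrable M (\<lambda>x. \<integral>s. \<bar>V x s\<bar> \<partial>?I)" using MI.integrable_fst'[OF abs] by simp
  have meas: "(\<lambda>(x, t). cum T (V x) t) \<in> borel_measurable (M \<Otimes>\<^sub>M borel)"
  proof -
    have "(\<lambda>p. cum T (V (fst p)) (snd p)) \<in> borel_measurable (M \<Otimes>\<^sub>M borel)"
      by (rule borel_measurable_cum) measurable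
    then show ?thesis by (simp add: case_prod_beta')
  qed
  have ae_le: "AE x in M. \<forall>t. \<bar>cum T (V x) t\<bar> \<le> (\<integral>s. \<bar>V x s\<bar> \<partial>?I)"
    using ae by eventually_elim (simp add: cum_abs_le_integral)
  have bound: "integrable (M \<Otimes>\<^sub>M ?I) (\<lambda>(x, t). (\<integral>s. \<bar>V x s\<bar> \<partial>?I) * 1)"
    by (rule MI.integrable_prod_mult[OF b]) simp
  show "integrable (M \<Otimes>\<^sub>M ?I) (\<lambda>(x, t). cum T (V x) t)"
  proof (rule Bochner_Integration.integrable_bound[OF bound])
    show m: "(\<lambda>(x, t). cum T (V x) t) \<in> borel_measurable (M \<Otimes>\<^sub>M ?I)"
      using meas by (simp cong: measurable_cong_sets)
    have [measurable]: "(\<lambda>x. \<integral>s. \<bar>V x s\<bar> \<partial>?I) \<in> borel_measurable M" using b by auto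
    have "AE x in M. AE t in ?I. \<bar>cum T (V x) t\<bar> \<le> (\<integral>s. \<bar>V x s\<bar> \<partial>?I)"
      using ae_le by eventually_elim simp
    then have "AE z in M \<Otimes>\<^sub>M ?I. \<bar>cum T (V (fst z)) (snd z)\<bar> \<le> (\<integral>s. \<bar>V (fst z) s\<bar> \<partial>?I)"
    proof (subst (asm) MI.AE_pair_iff)
      have [measurable]: "(\<lambda>z. cum T (V (fst z)) (snd z)) \<in> borel_measurable (M \<Otimes>\<^sub>M ?I)"
        using m by (simp add: case_prod_beta')
      show "{z \<in> space (M \<Otimes>\<^sub>M ?I). \<bar>cum T (V (fst z)) (snd z)\<bar> \<le> (\<integral>s. \<bar>V (fst z) s\<bar> \<partial>?I)}
          \<in> sets (M \<Otimes>\<^sub>M ?I)"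
        by measurable
    qed
    then show "AE z in M \<Otimes>\<^sub>M ?I. norm (case z of (x, t) \<Rightarrow> cum T (V x) t)
        \<le> norm (case z of (x, t) \<Rightarrow> (\<integral>s. \<bar>V x s\<bar> \<partial>?I) * 1)"
      by eventually_elim (auto simp: case_prod_beta')
  qed
  show "integrable M (\<lambda>x. cum T (V x) t)"
  proof (rule Bochner_Integration.integrable_bound[OF b])
    show "(\<lambda>x. cum T (V x) t) \<in> borel_measurable M" by (rule borel_measurable_cum) measurable
    show "AE x in M. norm (cum T (V x) t) \<le> norm (\<integral>s. \<bar>V x s\<bar> \<partial>?I)"
      using ae_le by eventually_elim auto
  qed
qed

text \<open>The L^1 distance of two time slices is at most the increment of the scalar primitive of
  \<open>v s\<close>, the L^1 norm of the slice of \<open>V\<close>, and scalar primitives are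
  continuous.\<close>

lemma cum_L1_continuous:
  assumes V [measurable]: "(\<lambda>(x, s). V x s) \<in> borel_measurable (M \<Otimes>\<^sub>M borel)"
    and int: "integrable (M \<Otimes>\<^sub>M borel_on {0..T}) (\<lambda>(x, s). V x s)"
  shows "((\<lambda>s. \<integral>x. \<bar>cum T (V x) s - cum T (V x) t\<bar> \<partial>M) \<longlongrightarrow> 0) (at t within S)"
proof -
  let ?I = "borel_on {0..T}"
  interpret I: finite_measure ?I by (rule finite_measure_Icc)
  interpret MI: pair_sigma_finite M ?I ..
  have ae: "AE x in M. integrable ?I (V x)" using MI.AE_integrable_fst'[OF int] by simp
  have abs: "integrable (M \<Otimes>\<^sub>M ?I) (\<lambda>(x, s). \<bar>V x s\<bar>)"
    using integrable_abs[OF int] by (simp add: case_prod_beta')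
  define v where "v s = (\<integral>x. \<bar>V x s\<bar> \<partial>M)" for s
  have v: "integrable ?I v" unfolding v_def by (rule MI.integrable_snd) (rule abs)
  have main: "(\<integral>x. \<bar>cum T (V x) s - cum T (V x) r\<bar> \<partial>M) \<le> cum T v s - cum T v r" if "r \<le> s" for r s
  proof -
    have J: "integrable (M \<Otimes>\<^sub>M ?I) (\<lambda>(x, q). indicator {r..<s} q * \<bar>V x q\<bar>)"
    proof (rule Bochner_Integration.integrable_bound[OF abs])
      have "(\<lambda>p. indicator {r..<s} (snd p) * \<bar>V (fst p) (snd p)\<bar>) \<in> borel_measurable (M \<Otimes>\<^sub>M borel)"
        by measurable
      then show "(\<lambda>(x, q). indicator {r..<s} q * \<bar>V x q\<bar>) \<in> borel_measurable (M \<Otimes>\<^sub>M ?I)"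
        by (simp add: case_prod_beta' cong: measurable_cong_sets)
    qed (auto simp: indicator_def)
    have "(\<integral>x. \<bar>cum T (V x) s - cum T (V x) r\<bar> \<partial>M) \<le> (\<integral>x. \<integral>q. indicator {r..<s} q * \<bar>V x q\<bar> \<partial>?I \<partial>M)"
    proof (rule integral_mono_AE)
      show "integrable M (\<lambda>x. \<bar>cum T (V x) s - cum T (V x) r\<bar>)"
        by (intro integrable_abs Bochner_Integration.integrable_diff integrable_pair_cum(2)[OF assms])
      show "integrable M (\<lambda>x. \<integral>q. indicator {r..<s} q * \<bar>V x q\<bar> \<partial>?I)"
        using MI.integrable_fst'[OF J] by simp
      show "AE x in M. \<bar>cum T (V x) s - cum T (V x) r\<bar> \<le> (\<integral>q. indicator {r..<s} q * \<bar>V x q\<bar> \<partial>?I)"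
        using ae
      proof eventually_elim
        case (elim x)
        have "\<bar>cum T (V x) s - cum T (V x) r\<bar> \<le> (\<integral>q. \<bar>indicator {r..<s} q * V x q\<bar> \<partial>?I)"
          unfolding cum_increment[OF elim that] by (rule integral_abs_bound)
        then show ?case by (simp add: abs_mult)
      qed
    qed
    also have "\<dots> = (\<integral>q. \<integral>x. indicator {r..<s} q * \<bar>V x q\<bar> \<partial>M \<partial>?I)"
      by (rule MI.Fubini_integral[symmetric]) (rule J)
    also have "\<dots> = cum T v s - cum T v r"
      unfolding cum_increment[OF v that] v_def by simp
    finally show ?thesis .
  qed
  have le: "(\<integral>x. \<bar>cum T (V x) s - cum T (V x) t\<bar> \<partial>M) \<le> \<bar>cum T v s - cum T v t\<bar>" for s
  proof (cases "t \<le> s")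
    case True
    then show ?thesis using main[of t s] by linarith
  next
    case False
    then show ?thesis using main[of s t] by (simp add: abs_minus_commute)
  qed
  have "((\<lambda>s. \<bar>cum T v s - cum T v t\<bar>) \<longlongrightarrow> \<bar>cum T v t - cum T v t\<bar>) (at t within S)"
    by (intro tendsto_intros cum_tendsto v)
  then have "((\<lambda>s. \<bar>cum T v s - cum T v t\<bar>) \<longlongrightarrow> 0) (at t within S)" by simp
  then show ?thesis
    by (rule Lim_null_comparison[rotated]) (use le in \<open>auto intro!: always_eventually\<close>)
qed

text \<open>The energy estimate behind both existence and uniqueness: \<open>cum_square\<close> is
  integrated over \<open>x\<close> and the order of integration is exchanged. After time
  \<open>t\<close> the integrand is 0, which \<open>0 \<le> B\<close> lets one bound by
  \<open>B\<close> as well; this gives the factor \<open>T\<close>.\<close>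

lemma cum_square_integral_le:
  assumes V [measurable]: "(\<lambda>(x, s). V x s) \<in> borel_measurable (M \<Otimes>\<^sub>M borel)"
    and c: "\<And>x s. \<bar>V x s\<bar> \<le> c" and "0 \<le> T" and B: "0 \<le> B"
    and le: "AE s in borel_on {0..T}. (\<integral>x. V x s * cum T (V x) s \<partial>M) \<le> B"
  shows "integrable M (\<lambda>x. (cum T (V x) t)\<^sup>2)"
    and "(\<integral>x. (cum T (V x) t)\<^sup>2 \<partial>M) \<le> 2 * B * T"
proof -
  let ?I = "borel_on {0..T}"
  interpret I: finite_measure ?I by (rule finite_measure_Icc)
  interpret MI: pair_sigma_finite M ?I ..
  interpret MIf: finite_measure "M \<Otimes>\<^sub>M ?I"
    using I.finite_measure_axioms finite_measure_axioms by (rule finite_measure_pair_measure)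
  have sect [measurable]: "V x \<in> borel_measurable borel" if "x \<in> space M" for x
    using that by measurable
  have c0: "0 \<le> c" using c[of undefined 0] by simp
  define F where "F x s = indicator {..<t} s * (V x s * cum T (V x) s)" for x s
  have F_int: "integrable (M \<Otimes>\<^sub>M ?I) (\<lambda>(x, s). F x s)"
  proof (rule MIf.integrable_const_bound[of _ "c * (c * T)"])
    show "AE p in M \<Otimes>\<^sub>M ?I. norm (case p of (x, s) \<Rightarrow> F x s) \<le> c * (c * T)"
    proof (rule AE_I2)
      fix p assume "p \<in> space (M \<Otimes>\<^sub>M ?I)"
      then obtain x s where p: "p = (x, s)" and x: "x \<in> space M" by (auto simp: space_pair_measure)
      have "\<bar>cum T (V x) s\<bar> \<le> c * T" by (rule cum_abs_le[OF sect[OF x] c \<open>0 \<le> T\<close>])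
      then have "\<bar>V x s * cum T (V x) s\<bar> \<le> c * (c * T)"
        unfolding abs_mult using c[of x s] c0 by (intro mult_mono) auto
      then show "norm (case p of (x, s) \<Rightarrow> F x s) \<le> c * (c * T)"
        using c0 \<open>0 \<le> T\<close> by (auto simp: p F_def indicator_def)
    qed
    have [measurable]: "(\<lambda>p. cum T (V (fst p)) (snd p)) \<in> borel_measurable (M \<Otimes>\<^sub>M borel)"
      by (rule borel_measurable_cum) measurable
    have "(\<lambda>p. indicator {..<t} (snd p) * (V (fst p) (snd p) * cum T (V (fst p)) (snd p)))
        \<in> borel_measurable (M \<Otimes>\<^sub>M borel)"
      by measurable
    then show "(\<lambda>(x, s). F x s) \<in> borel_measurable (M \<Otimes>\<^sub>M ?I)"
      by (simp add: F_def case_prod_beta' cong: measurable_cong_sets)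
  qed
  have sq: "(cum T (V x) t)\<^sup>2 = 2 * (\<integral>s. F x s \<partial>?I)" if "x \<in> space M" for x
  proof -
    have "integrable ?I (V x)" by (rule integrable_bounded_Icc[OF sect[OF that] c])
    then show ?thesis by (simp add: cum_square cum_def[of T "\<lambda>s. V x s * _ s"] F_def)
  qed
  have "integrable M (\<lambda>x. 2 * (\<integral>s. F x s \<partial>?I))"
    by (intro integrable_mult_right MI.integrable_fst) (rule F_int)
  then show "integrable M (\<lambda>x. (cum T (V x) t)\<^sup>2)"
    by (simp add: sq cong: Bochner_Integration.integrable_cong)
  have "(\<integral>x. (cum T (V x) t)\<^sup>2 \<partial>M) = (\<integral>x. 2 * (\<integral>s. F x s \<partial>?I) \<partial>M)"
    by (intro Bochner_Integration.integral_cong) (simp_all add: sq)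
  also have "\<dots> = 2 * (\<integral>x. \<integral>s. F x s \<partial>?I \<partial>M)" by simp
  also have "(\<integral>x. \<integral>s. F x s \<partial>?I \<partial>M) = (\<integral>s. \<integral>x. F x s \<partial>M \<partial>?I)"
    by (rule MI.Fubini_integral[symmetric]) (rule F_int)
  also have "\<dots> \<le> (\<integral>s. B \<partial>?I)"
  proof (rule integral_mono_AE)
    show "integrable ?I (\<lambda>s. \<integral>x. F x s \<partial>M)" by (rule MI.integrable_snd) (rule F_int)
    show "AE s in ?I. (\<integral>x. F x s \<partial>M) \<le> B"
      using le by eventually_elim (use B in \<open>simp add: F_def indicator_def\<close>)
  qed simp
  also have "\<dots> = B * T"
  proof -
    have "emeasure ?I UNIV = ennreal T" using \<open>0 \<le> T\<close> by (simp add: emeasure_borel_on)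
    then show ?thesis using \<open>0 \<le> T\<close> by (simp add: measure_def)
  qed
  finally show "(\<integral>x. (cum T (V x) t)\<^sup>2 \<partial>M) \<le> 2 * B * T" by simp
qed

end

subsection \<open>Test functions\<close>

text \<open>The functions \<open>p / q\<^sup>k \<cdot> exp (-1/q)\<close> with \<open>q = t (r - t)\<close>, extended by \<open>0\<close>
  outside of \<open>]0, r[\<close>, form a class that is closed under differentiation.\<close>
definition bump :: "real \<Rightarrow> real poly \<Rightarrow> nat \<Rightarrow> real \<Rightarrow> real" where
  "bump r p k t = (if 0 < t \<and> t < r then poly p t / (t * (r - t))^k * exp (- 1 / (t * (r - t))) else 0)"

text \<open>A single term of the exponential series at \<open>1 / q\<close> suffices. Its index
  \<open>k + 2\<close> leaves two spare powers of \<open>q\<close>, exactly what makes a bump vanish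
  quadratically at its ends.\<close>

lemma exp_neg_inverse_le:
  fixes q :: real
  assumes "0 < q"
  shows "exp (- 1 / q) / q ^ k \<le> fact (k + 2) * q\<^sup>2"
proof -
  have "exp (- 1 / q) \<le> fact n * q ^ n" for n
  proof -
    have "(1 / q) ^ n /\<^sub>R fact n \<le> (\<Sum>n. (1 / q) ^ n /\<^sub>R fact n)"
      using sum_le_suminf[OF summable_exp_generic[of "1 / q"], of "{n}"] assms by simp
    then have "(1 / q) ^ n / fact n \<le> exp (1 / q)"
      by (simp add: exp_def divide_inverse mult.commute)
    then have "exp (- 1 / q) * ((1 / q) ^ n / fact n) \<le> exp (- 1 / q) * exp (1 / q)"
      by (rule mult_left_mono) simp
    also have "\<dots> = 1" by (simp add: exp_add[symmetric])
    finally show ?thesis using assms by (simp add: power_one_over divide_le_eq mult.commute)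
  qed
  then have "exp (- 1 / q) \<le> fact (k + 2) * q ^ (k + 2)" .
  also have "\<dots> = (fact (k + 2) * q\<^sup>2) * q ^ k" by (simp add: power_add power2_eq_square)
  finally show ?thesis using assms by (simp add: divide_le_eq)
qed

text \<open>Inside the interval \<open>q = s * (r - s)\<close> is at most \<open>s * r\<close> and
  at most \<open>r * (r - s)\<close>, so the spare factor \<open>q\<^sup>2\<close> controls both
  ends with one constant.\<close>

lemma bump_quadratic_bound:
  assumes "0 < r"
  obtains B where "\<And>s. \<bar>bump r p k s\<bar> \<le> B * s\<^sup>2" "\<And>s. \<bar>bump r p k s\<bar> \<le> B * (s - r)\<^sup>2"
proof -
  have "compact (poly p ` {0..r})"
    by (intro compact_continuous_image continuous_intros compact_Icc)
  then have "bounded (poly p ` {0..r})" by (rule compact_imp_bounded)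
  then obtain P where P: "\<And>s. s \<in> {0..r} \<Longrightarrow> \<bar>poly p s\<bar> \<le> P"
    unfolding bounded_iff real_norm_def by blast
  have P0: "0 \<le> P" using P[of 0] assms by force
  define B where "B = P * (fact (k + 2) * r\<^sup>2)"
  have B0: "0 \<le> B" using P0 by (simp add: B_def)
  have main: "\<bar>bump r p k s\<bar> \<le> B * s\<^sup>2 \<and> \<bar>bump r p k s\<bar> \<le> B * (s - r)\<^sup>2" for s
  proof (cases "0 < s \<and> s < r")
    case True
    define q where "q = s * (r - s)"
    have q: "0 < q" using True by (simp add: q_def)
    have "\<bar>bump r p k s\<bar> = \<bar>poly p s\<bar> * (exp (- 1 / q) / q ^ k)"
      using True q by (simp add: bump_def q_def[symmetric] abs_mult)
    also have "\<dots> \<le> P * (fact (k + 2) * q\<^sup>2)"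
      using P[of s] True q by (intro mult_mono exp_neg_inverse_le) auto
    finally have le: "\<bar>bump r p k s\<bar> \<le> P * (fact (k + 2) * q\<^sup>2)" .
    have "q \<le> s * r" "q \<le> r * (r - s)" using True by (auto simp: q_def intro: mult_left_mono mult_right_mono)
    then have "q\<^sup>2 \<le> (s * r)\<^sup>2" "q\<^sup>2 \<le> (r * (r - s))\<^sup>2" using q by (auto intro: power_mono)
    then have "P * (fact (k + 2) * q\<^sup>2) \<le> P * (fact (k + 2) * (s * r)\<^sup>2)"
      "P * (fact (k + 2) * q\<^sup>2) \<le> P * (fact (k + 2) * (r * (r - s))\<^sup>2)"
      using P0 by (auto intro!: mult_left_mono)
    with le show ?thesis
      unfolding B_def by (simp add: power_mult_distrib power2_commute[of r s] mult_ac)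
  next
    case False
    then have "bump r p k s = 0" by (auto simp: bump_def)
    then show ?thesis using B0 by simp
  qed
  then show thesis using that by blast
qed

lemma has_derivative_zero_if_quadratic:
  fixes f :: "real \<Rightarrow> real"
  assumes "f t = 0" "\<And>s. \<bar>f s\<bar> \<le> B * (s - t)\<^sup>2"
  shows "(f has_real_derivative 0) (at t)"
proof -
  have "((\<lambda>s. (f s - f t) / (s - t)) \<longlongrightarrow> 0) (at t)"
  proof (rule Lim_null_comparison)
    show "\<forall>\<^sub>F s in at t. norm ((f s - f t) / (s - t)) \<le> \<bar>B\<bar> * \<bar>s - t\<bar>"
    proof (rule always_eventually, rule allI)
      fix s
      have "\<bar>f s\<bar> \<le> \<bar>B\<bar> * \<bar>s - t\<bar> * \<bar>s - t\<bar>"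
        using assms(2)[of s] abs_ge_self[of B] mult_right_mono[of B "\<bar>B\<bar>" "(s - t)\<^sup>2"]
        by (simp add: power2_eq_square mult.assoc)
      then show "norm ((f s - f t) / (s - t)) \<le> \<bar>B\<bar> * \<bar>s - t\<bar>"
        using assms(1) by (cases "s = t") (auto simp: abs_divide divide_le_eq)
    qed
    have "((\<lambda>s. \<bar>B\<bar> * \<bar>s - t\<bar>) \<longlongrightarrow> \<bar>B\<bar> * \<bar>t - t\<bar>) (at t)" by (intro tendsto_intros)
    then show "((\<lambda>s. \<bar>B\<bar> * \<bar>s - t\<bar>) \<longlongrightarrow> 0) (at t)" by simp
  qed
  then show ?thesis by (simp add: has_field_derivative_iff)
qed

text \<open>With \<open>Q = t (r - t)\<close>, differentiating \<open>p / Q^k * exp (-1/Q)\<close>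
  raises the exponent of the denominator by 2 and yields the displayed numerator. At 0 and
  \<open>r\<close> the quadratic bound forces the derivative 0.\<close>

lemma bump_has_deriv:
  assumes r: "0 < r"
  defines "Q \<equiv> [:0, r, -1:]"
  shows "(bump r p k has_real_derivative
    bump r (pderiv p * Q\<^sup>2 - of_nat k * p * pderiv Q * Q + p * pderiv Q) (k + 2) t) (at t)"
proof -
  have Q: "poly Q s = s * (r - s)" "poly (pderiv Q) s = r - 2 * s" for s
    by (simp_all add: Q_def pderiv_pCons algebra_simps)
  let ?P = "pderiv p * Q\<^sup>2 - of_nat k * p * pderiv Q * Q + p * pderiv Q"
  consider "0 < t \<and> t < r" | "t < 0 \<or> r < t" | "t = 0" | "t = r" by linarith
  then show ?thesis
  proof cases
    case 1
    define q where "q = poly Q t"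
    have q: "q > 0" using 1 by (simp add: q_def Q)
    let ?f = "\<lambda>t. poly p t / poly Q t ^ k * exp (- 1 / poly Q t)"
    have "(?f has_real_derivative
        ((poly (pderiv p) t * q ^ k - poly p t * (of_nat k * (poly (pderiv Q) t * q ^ (k - 1)))) / (q ^ k * q ^ k)
          * exp (- 1 / q) + poly p t / q ^ k * (exp (- 1 / q) * (poly (pderiv Q) t / (q * q))))) (at t)"
      unfolding q_def by (rule derivative_eq_intros refl | use q q_def in \<open>force simp: divide_simps\<close>)+
    moreover have "(poly (pderiv p) t * q ^ k - poly p t * (of_nat k * (poly (pderiv Q) t * q ^ (k - 1)))) / (q ^ k * q ^ k)
          * exp (- 1 / q) + poly p t / q ^ k * (exp (- 1 / q) * (poly (pderiv Q) t / (q * q)))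
        = poly ?P t / q ^ (k + 2) * exp (- 1 / q)"
    proof -
      \<comment> \<open>Truncated subtraction makes \<open>k - 1\<close> useless for
        \<open>k = 0\<close>, but then the factor \<open>of_nat k\<close> annihilates both
        sides.\<close>
      have "poly p t * (of_nat k * (poly (pderiv Q) t * q ^ (k - 1)))
          = poly p t * poly (pderiv Q) t * (of_nat k * q ^ k / q)"
        using q by (cases k) auto
      note eq = this
      show ?thesis unfolding eq
        using q by (simp add: q_def[symmetric] divide_simps) (simp add: algebra_simps power2_eq_square)
    qed
    ultimately have "(?f has_real_derivative bump r ?P (k + 2) t) (at t)"
      using 1 by (simp add: bump_def q_def Q)
    then show ?thesis
      by (rule has_field_derivative_transform_within_open[of _ _ _ "{0<..<r}"])
        (use 1 in \<open>auto simp: bump_def Q\<close>)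
  next
    case 2
    have "((\<lambda>_. 0) has_real_derivative 0) (at t)" by simp
    then have "(bump r p k has_real_derivative 0) (at t)"
      by (rule has_field_derivative_transform_within_open[of _ _ _ "{..<0} \<union> {r<..}"])
        (use 2 in \<open>auto simp: bump_def\<close>)
    moreover have "bump r ?P (k + 2) t = 0" using 2 by (auto simp: bump_def)
    ultimately show ?thesis by simp
  next
    case 3
    obtain B where "\<And>s. \<bar>bump r p k s\<bar> \<le> B * s\<^sup>2" using bump_quadratic_bound[OF r] by blast
    then have "(bump r p k has_real_derivative 0) (at t)"
      using 3 by (intro has_derivative_zero_if_quadratic[of _ _ B]) (auto simp: bump_def)
    then show ?thesis using 3 by (simp add: bump_def)
  next
    case 4
    obtain B where "\<And>s. \<bar>bump r p k s\<bar> \<le> B * (s - r)\<^sup>2" using bump_quadratic_bound[OF r] by blast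
    then have "(bump r p k has_real_derivative 0) (at t)"
      using 4 by (intro has_derivative_zero_if_quadratic[of _ _ B]) (auto simp: bump_def)
    then show ?thesis using 4 by (simp add: bump_def)
  qed
qed

text \<open>Closure of a class under differentiation gives smoothness of its members without any
  formula for the \<open>n\<close>-th derivative.\<close>

lemma differentiable_deriv_funpow:
  assumes closed: "\<And>f. f \<in> A \<Longrightarrow> \<exists>f'\<in>A. \<forall>t. (f has_real_derivative f' t) (at t)"
    and "f \<in> A"
  shows "((deriv ^^ n) f) differentiable (at t)"
  using \<open>f \<in> A\<close>
proof (induction n arbitrary: f)
  case 0
  then show ?case using closed real_differentiable_def by fastforce
next
  case (Suc n)
  then obtain f' where f': "f' \<in> A" "\<And>t. (f has_real_derivative f' t) (at t)" using closed by blast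
  then have "deriv f = f'" by (intro ext DERIV_imp_deriv)
  then show ?case using Suc.IH[OF f'(1)] by (simp only: funpow_Suc_right o_apply)
qed

lemma bump_primitive:
  assumes r: "0 < r"
  obtains R where "\<And>t. (R has_real_derivative bump r 1 0 t) (at t)" "\<And>t. t \<le> 0 \<Longrightarrow> R t = 0"
    "\<And>t. r \<le> t \<Longrightarrow> R t = R r" "0 < R r"
proof -
  let ?\<rho> = "bump r 1 0"
  \<comment> \<open>Starting at -1 instead of 0 makes 0 an interior point, so the derivative there
    is two-sided.\<close>
  define R where "R t = integral {-1..t} ?\<rho>" for t
  have cont: "continuous_on A ?\<rho>" for A
    by (rule DERIV_continuous_on[OF bump_has_deriv[OF r, THEN DERIV_subset]]) simp
  have R0: "R t = 0" if "t \<le> 0" for t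
  proof -
    have "R t = integral {-1..t} (\<lambda>_. 0)" unfolding R_def
      using that by (intro integral_cong) (auto simp: bump_def)
    then show ?thesis by simp
  qed
  have der: "(R has_real_derivative ?\<rho> t) (at t)" for t
  proof (cases "t < 0")
    case True
    have "((\<lambda>_. 0) has_real_derivative 0) (at t)" by simp
    then have "(R has_real_derivative 0) (at t)"
      by (rule has_field_derivative_transform_within_open[of _ _ _ "{..<0}"]) (use True R0 in auto)
    then show ?thesis using True by (simp add: bump_def)
  next
    case False
    have "(R has_real_derivative ?\<rho> t) (at t within {-1..t + 1})"
      unfolding R_def using False by (intro integral_has_real_derivative cont) auto
    moreover have "at t within {-1..t + 1} = at t"
      using False by (intro at_within_interior) (auto simp: interior_atLeastAtMost_real)
    ultimately show ?thesis by simp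
  qed
  have Rr: "R t = R r" if "r \<le> t" for t
  proof -
    have "R t = R r + integral {r..t} ?\<rho>" unfolding R_def
      using that r by (intro Henstock_Kurzweil_Integration.integral_combine[symmetric]
          integrable_continuous_real cont) auto
    also have "integral {r..t} ?\<rho> = integral {r..t} (\<lambda>_. 0)"
      using r by (intro integral_cong) (auto simp: bump_def)
    finally show ?thesis by simp
  qed
  have "R 0 < R r"
  proof (rule DERIV_pos_imp_increasing_open[OF r])
    show "\<exists>y. (R has_real_derivative y) (at x) \<and> 0 < y" if "0 < x" "x < r" for x
      using der[of x] that by (auto simp: bump_def intro!: exI[of _ "?\<rho> x"])
    show "continuous_on {0..r} R"
      by (rule DERIV_continuous_on[OF der[THEN DERIV_subset]]) simp
  qed
  then have pos: "0 < R r" by (simp add: R0)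
  show thesis by (rule that[OF der R0 Rr pos])
qed

text \<open>A bump has positive mass and is therefore not the derivative of a test function; the
  difference of two translates of equal mass \<open>J\<close> is. Its primitive vanishes after
  \<open>b + r\<close> because both translated primitives have reached the same constant.\<close>

lemma test_fun_bump_difference:
  assumes r: "0 < r" and ab: "0 < a" "a < b" "b + r < T"
  obtains \<phi> J where "test_fun T \<phi>" "\<And>t. deriv \<phi> t = bump r 1 0 (t - a) - bump r 1 0 (t - b)"
    "0 < J" "\<And>c. 0 < c \<Longrightarrow> c + r < T \<Longrightarrow> (\<integral>t. bump r 1 0 (t - c) * indicator {0..T} t \<partial>lborel) = J"
proof -
  obtain R where R: "\<And>t. (R has_real_derivative bump r 1 0 t) (at t)" "\<And>t. t \<le> 0 \<Longrightarrow> R t = 0"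
    "\<And>t. r \<le> t \<Longrightarrow> R t = R r" "0 < R r"
    by (rule bump_primitive[OF r], rule that)
  define \<phi> where "\<phi> t = R (t - a) - R (t - b)" for t
  have shift: "((\<lambda>t. F (t - c)) has_real_derivative F' (t - c)) (at t)"
    if "\<And>t. (F has_real_derivative F' t) (at t)" for F F' :: "real \<Rightarrow> real" and c t
    using DERIV_shift[of F "F' (t - c)" t "- c"] that by simp
  have \<phi>': "(\<phi> has_real_derivative bump r 1 0 (t - a) - bump r 1 0 (t - b)) (at t)" for t
    unfolding \<phi>_def by (intro DERIV_diff shift R(1))
  \<comment> \<open>The primitive itself is not of the form \<open>bump\<close>, only its
    derivatives are, so it is added to the class by hand.\<close>
  define A where "A = insert \<phi> (range (\<lambda>(p, k) t. bump r p k (t - a) - bump r p k (t - b)))"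
  have "((deriv ^^ n) \<phi>) differentiable (at t)" for n t
  proof (rule differentiable_deriv_funpow)
    show "\<phi> \<in> A" by (simp add: A_def)
    fix f assume "f \<in> A"
    then consider "f = \<phi>" | p k where "f = (\<lambda>t. bump r p k (t - a) - bump r p k (t - b))"
      by (auto simp: A_def)
    then show "\<exists>f'\<in>A. \<forall>t. (f has_real_derivative f' t) (at t)"
    proof cases
      case 1
      have "(\<lambda>t. bump r 1 0 (t - a) - bump r 1 0 (t - b)) \<in> A"
        unfolding A_def by (auto intro!: image_eqI[of _ _ "(1, 0)"])
      with \<phi>' show ?thesis unfolding 1 by (intro bexI allI)
    next
      case 2
      obtain p' k' where "\<And>t. (bump r p k has_real_derivative bump r p' k' t) (at t)"
        using bump_has_deriv[OF r] by blast
      then have "\<forall>t. (f has_real_derivative bump r p' k' (t - a) - bump r p' k' (t - b)) (at t)"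
        unfolding 2 by (intro allI DERIV_diff shift)
      moreover have "(\<lambda>t. bump r p' k' (t - a) - bump r p' k' (t - b)) \<in> A"
        unfolding A_def by (auto intro!: image_eqI[of _ _ "(p', k')"])
      ultimately show ?thesis by (intro bexI)
    qed
  qed
  moreover have "\<phi> t = 0" if "t \<notin> {a..b + r}" for t
  proof (cases "t < a")
    case True
    then show ?thesis using R(2)[of "t - a"] R(2)[of "t - b"] ab by (simp add: \<phi>_def)
  next
    case False
    then have "r \<le> t - a" "r \<le> t - b" using that ab by auto
    then show ?thesis using R(3)[of "t - a"] R(3)[of "t - b"] by (simp add: \<phi>_def)
  qed
  ultimately have "test_fun T \<phi>"
    unfolding test_fun_def using ab r by (intro conjI allI exI[of _ a] exI[of _ "b + r"]) auto
  moreover have "deriv \<phi> t = bump r 1 0 (t - a) - bump r 1 0 (t - b)" for t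
    using \<phi>' by (rule DERIV_imp_deriv)
  moreover have "(\<integral>t. bump r 1 0 (t - c) * indicator {0..T} t \<partial>lborel) = R r" if "0 < c" "c + r < T" for c
  proof -
    have "(\<integral>t. bump r 1 0 (t - c) * indicator {0..T} t \<partial>lborel) = R (T - c) - R (0 - c)"
    proof (rule integral_FTC_Icc_real)
      show "isCont (\<lambda>t. bump r 1 0 (t - c)) t" for t
        using shift[OF bump_has_deriv[OF r]] DERIV_isCont by blast
    qed (use that r shift[OF R(1)] in auto)
    then show ?thesis using R(2)[of "- c"] R(3)[of "T - c"] that by simp
  qed
  ultimately show thesis using that R(4) by blast
qed

text \<open>If \<open>G\<close> took different values at two interior points, bumps concentrated
  near them would give weighted averages of \<open>G\<close> on opposite sides of a gap, whereas the
  weak equation makes these averages equal. Continuity carries the constancy to the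
  endpoints.\<close>

lemma du_Bois_Reymond_continuous:
  fixes G :: "real \<Rightarrow> real"
  assumes cont: "continuous_on {0..T} G" and "0 < T"
    and weak: "\<And>\<phi>. test_fun T \<phi> \<Longrightarrow> (\<integral>t. indicator {0..T} t * (G t * deriv \<phi> t) \<partial>lborel) = 0"
    and st: "s \<in> {0..T}" "t \<in> {0..T}"
  shows "G s = G t"
proof -
  \<comment> \<open>The sign \<open>\<sigma>\<close>, later 1 and -1, treats both possible
    inequalities between the two values with one argument.\<close>
  have not_less: "\<not> \<sigma> * G a < \<sigma> * G b" if ab: "0 < a" "a < b" "b < T" for a b \<sigma>
  proof
    assume less: "\<sigma> * G a < \<sigma> * G b"
    define m where "m = (\<sigma> * G a + \<sigma> * G b) / 2"
    \<comment> \<open>A second level strictly below \<open>m\<close> provides the gap: the tested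
      difference is at most \<open>(m1 - m) * J < 0\<close>.\<close>
    define m1 where "m1 = (\<sigma> * G a + m) / 2"
    have m: "\<sigma> * G a < m1" "m1 < m" "m < \<sigma> * G b" using less by (auto simp: m_def m1_def)
    have cont': "isCont (\<lambda>t. \<sigma> * G t) c" if "0 < c" "c < T" for c
      using continuous_on_interior[OF cont, of c] that
      by (intro continuous_intros) (auto simp: interior_atLeastAtMost_real)
    have "((\<lambda>t. \<sigma> * G t) \<longlongrightarrow> \<sigma> * G a) (nhds a)" "((\<lambda>t. \<sigma> * G t) \<longlongrightarrow> \<sigma> * G b) (nhds b)"
      using cont'[of a] cont'[of b] ab tendsto_at_iff_tendsto_nhds[of "\<lambda>t. \<sigma> * G t"]
      by (auto simp: isCont_def)
    then have "eventually (\<lambda>t. \<sigma> * G t < m1) (nhds a)" "eventually (\<lambda>t. m < \<sigma> * G t) (nhds b)"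
      using m by (auto intro: order_tendstoD)
    then obtain e1 e2 where e: "0 < e1" "0 < e2" "\<And>t. dist t a < e1 \<Longrightarrow> \<sigma> * G t < m1"
      "\<And>t. dist t b < e2 \<Longrightarrow> m < \<sigma> * G t"
      unfolding eventually_nhds_metric by blast
    \<comment> \<open>Half the minimum keeps each bump inside the neighbourhood where its level
      estimate holds and keeps the right one inside the time interval.\<close>
    define r where "r = min (min e1 e2) (T - b) / 2"
    have r: "0 < r" "r < e1" "r < e2" "b + r < T" using e(1,2) ab by (auto simp: r_def min_def field_simps)
    obtain \<phi> J where \<phi>: "test_fun T \<phi>" "\<And>t. deriv \<phi> t = bump r 1 0 (t - a) - bump r 1 0 (t - b)"
      and J: "0 < J" "\<And>c. 0 < c \<Longrightarrow> c + r < T \<Longrightarrow> (\<integral>t. bump r 1 0 (t - c) * indicator {0..T} t \<partial>lborel) = J"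
      by (rule test_fun_bump_difference[OF r(1) ab(1,2) r(4)], rule that)
    have contb: "continuous_on {0..T} (\<lambda>t. bump r 1 0 (t - c))" for c
    proof -
      have "continuous_on UNIV (bump r 1 0)"
        by (rule DERIV_continuous_on[OF bump_has_deriv[OF r(1), THEN DERIV_subset]]) simp
      then show ?thesis by (rule continuous_on_compose2) (auto intro: continuous_intros)
    qed
    have int: "integrable lborel (\<lambda>t. indicator {0..T} t * (bump r 1 0 (t - c) * H t))"
      if "continuous_on {0..T} H" for c H
      using borel_integrable_compact[OF compact_Icc continuous_on_mult[OF contb that], of c] by simp
    have nn: "0 \<le> bump r 1 0 t" for t by (simp add: bump_def)
    have zero: "bump r 1 0 (t - c) = 0" if "\<not> (c < t \<and> t < c + r)" for c t using that by (auto simp: bump_def)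
    have contG: "continuous_on {0..T} (\<lambda>t. \<sigma> * G t)" using cont by (intro continuous_intros)
    have "0 = \<sigma> * (\<integral>t. indicator {0..T} t * (G t * deriv \<phi> t) \<partial>lborel)" using weak[OF \<phi>(1)] by simp
    also have "\<dots> = (\<integral>t. indicator {0..T} t * (bump r 1 0 (t - a) * (\<sigma> * G t))
        - indicator {0..T} t * (bump r 1 0 (t - b) * (\<sigma> * G t)) \<partial>lborel)"
      unfolding integral_mult_right_zero[symmetric] \<phi>(2)
      by (intro Bochner_Integration.integral_cong) (auto simp: algebra_simps)
    also have "\<dots> = (\<integral>t. indicator {0..T} t * (bump r 1 0 (t - a) * (\<sigma> * G t)) \<partial>lborel)
        - (\<integral>t. indicator {0..T} t * (bump r 1 0 (t - b) * (\<sigma> * G t)) \<partial>lborel)"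
      using int[OF contG] by (rule Bochner_Integration.integral_diff) (rule int[OF contG])
    also have "\<dots> \<le> (\<integral>t. indicator {0..T} t * (bump r 1 0 (t - a) * m1) \<partial>lborel)
        - (\<integral>t. indicator {0..T} t * (bump r 1 0 (t - b) * m) \<partial>lborel)"
    proof (rule diff_mono)
      show "(\<integral>t. indicator {0..T} t * (bump r 1 0 (t - a) * (\<sigma> * G t)) \<partial>lborel)
          \<le> (\<integral>t. indicator {0..T} t * (bump r 1 0 (t - a) * m1) \<partial>lborel)"
      proof (rule integral_mono[OF int[OF contG] int[OF continuous_on_const]], rule mult_left_mono)
        fix t
        show "bump r 1 0 (t - a) * (\<sigma> * G t) \<le> bump r 1 0 (t - a) * m1"
        proof (cases "a < t \<and> t < a + r")
          case True
          then have "dist t a < e1" using r by (simp add: dist_real_def)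
          then show ?thesis using e(3)[of t] nn by (intro mult_left_mono) auto
        qed (simp add: zero)
      qed auto
      show "(\<integral>t. indicator {0..T} t * (bump r 1 0 (t - b) * m) \<partial>lborel)
          \<le> (\<integral>t. indicator {0..T} t * (bump r 1 0 (t - b) * (\<sigma> * G t)) \<partial>lborel)"
      proof (rule integral_mono[OF int[OF continuous_on_const] int[OF contG]], rule mult_left_mono)
        fix t
        show "bump r 1 0 (t - b) * m \<le> bump r 1 0 (t - b) * (\<sigma> * G t)"
        proof (cases "b < t \<and> t < b + r")
          case True
          then have "dist t b < e2" using r by (simp add: dist_real_def)
          then show ?thesis using e(4)[of t] nn by (intro mult_left_mono) auto
        qed (simp add: zero)
      qed auto
    qed
    also have "\<dots> = m1 * J - m * J"
      using J(2)[of a] J(2)[of b] ab r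
        integral_mult_right_zero[of lborel m1 "\<lambda>t. bump r 1 0 (t - a) * indicator {0..T} t"]
        integral_mult_right_zero[of lborel m "\<lambda>t. bump r 1 0 (t - b) * indicator {0..T} t"]
      by (simp add: mult_ac)
    also have "\<dots> < 0" using m J(1) by simp
    finally show False by simp
  qed
  have "G a = G b" if "0 < a" "a < b" "b < T" for a b
    using not_less[OF that, of 1] not_less[OF that, of "-1"] by simp
  then have const: "G a = G (T / 2)" if "a \<in> {0<..<T}" for a
    using that \<open>0 < T\<close> by (cases a "T / 2" rule: linorder_cases) force+
  have cl: "closure {0<..<T} = {0..T}" using \<open>0 < T\<close> by simp
  have "G a = G (T / 2)" if "a \<in> {0..T}" for a
    by (rule continuous_constant_on_closure[OF cont[folded cl] const]) (simp_all add: cl that[simplified])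
  from this[OF st(1)] this[OF st(2)] show ?thesis by (rule trans[OF _ sym])
qed

subsection \<open>Symmetric kernels\<close>

text \<open>A cylinder over a null set is null. The set where \<open>P\<close> fails may be
  nonmeasurable, hence the passage to a measurable null set \<open>N\<close> containing it.\<close>

lemma (in finite_measure) AE_fst_snd:
  assumes "AE x in M. P x"
  shows "AE z in M \<Otimes>\<^sub>M M. P (fst z)" "AE z in M \<Otimes>\<^sub>M M. P (snd z)"
proof -
  interpret P: pair_sigma_finite M M ..
  obtain N where N: "{x \<in> space M. \<not> P x} \<subseteq> N" "N \<in> null_sets M"
    using assms by (auto simp: eventually_ae_filter)
  have [measurable]: "N \<in> sets M" using N by auto
  have AE_N: "AE x in M. x \<notin> N" using N(2) by (rule AE_not_in)
  have "AE z in M \<Otimes>\<^sub>M M. fst z \<notin> N"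
    by (rule P.AE_pair_measure, measurable) (use AE_N in \<open>auto elim: eventually_mono\<close>)
  moreover have "AE z in M \<Otimes>\<^sub>M M. snd z \<notin> N"
    by (rule P.AE_pair_measure, measurable) (use AE_N in simp)
  ultimately have "AE z in M \<Otimes>\<^sub>M M. P (fst z) \<and> P (snd z)"
    using AE_space[of "M \<Otimes>\<^sub>M M"] by eventually_elim (use N(1) in \<open>auto simp: space_pair_measure\<close>)
  then show "AE z in M \<Otimes>\<^sub>M M. P (fst z)" "AE z in M \<Otimes>\<^sub>M M. P (snd z)"
    by (auto elim: eventually_mono)
qed

text \<open>Symmetry and the bound are imposed at every point, so that drifts are bounded for every
  \<open>x\<close> and no exceptional sets have to be carried through the construction;
  \<open>kernel_representative\<close> supplies such a version of the given kernel.\<close>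

locale kernel_space = finite_measure M for M :: "'a measure" +
  fixes K :: "'a \<Rightarrow> 'a \<Rightarrow> real" and C :: real
  assumes space_UNIV [simp]: "space M = UNIV"
    and K_measurable [measurable]: "(\<lambda>(x, y). K x y) \<in> borel_measurable (M \<Otimes>\<^sub>M M)"
    and K_nonneg: "\<And>x y. 0 \<le> K x y"
    and K_sym: "\<And>x y. K x y = K y x"
    and K_bound: "\<And>x. (\<integral>\<^sup>+y. ennreal (K x y) \<partial>M) \<le> ennreal C"
    and C_nonneg: "0 \<le> C"
begin

sublocale P: pair_sigma_finite M M ..

lemma K_integrable: "integrable M (K x)"
  and K_integral_le: "(\<integral>y. K x y \<partial>M) \<le> C"
proof -
  have [measurable]: "K x \<in> borel_measurable M" by measurable
  show int: "integrable M (K x)"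
    using K_nonneg K_bound[of x] by (intro integrableI_nonneg) (auto simp: le_less_trans)
  have "ennreal (\<integral>y. K x y \<partial>M) = (\<integral>\<^sup>+y. ennreal (K x y) \<partial>M)"
    using int K_nonneg by (intro nn_integral_eq_integral[symmetric]) auto
  also have "\<dots> \<le> ennreal C" by (rule K_bound)
  finally show "(\<integral>y. K x y \<partial>M) \<le> C" using C_nonneg by (simp add: ennreal_le_iff)
qed

lemma K_mult:
  assumes [measurable]: "\<omega> \<in> borel_measurable M" and c: "\<And>y. \<bar>\<omega> y\<bar> \<le> c"
  shows K_mult_integrable: "integrable M (\<lambda>y. K x y * \<omega> y)"
    and K_mult_integral_le: "\<bar>\<integral>y. K x y * \<omega> y \<partial>M\<bar> \<le> C * c"
proof -
  have [measurable]: "K x \<in> borel_measurable M" by measurable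
  have c0: "0 \<le> c" using c[of undefined] by simp
  have le: "\<bar>K x y * \<omega> y\<bar> \<le> K x y * c" for y
    using c[of y] K_nonneg[of x y] by (simp add: abs_mult mult_left_mono)
  show int: "integrable M (\<lambda>y. K x y * \<omega> y)"
    by (rule Bochner_Integration.integrable_bound[of _ "\<lambda>y. K x y * c"])
      (use K_integrable[of x] le c0 K_nonneg[of x] in \<open>auto\<close>)
  have "\<bar>\<integral>y. K x y * \<omega> y \<partial>M\<bar> \<le> (\<integral>y. \<bar>K x y * \<omega> y\<bar> \<partial>M)" by (rule integral_abs_bound)
  also have "\<dots> \<le> (\<integral>y. K x y * c \<partial>M)"
    using int K_integrable[of x] le by (intro integral_mono) auto
  also have "\<dots> \<le> C * c" using K_integral_le[of x] c0 by (simp add: mult_right_mono)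
  finally show "\<bar>\<integral>y. K x y * \<omega> y \<partial>M\<bar> \<le> C * c" .
qed

text \<open>Integrating over \<open>y\<close> first costs only the factor \<open>C * c\<close>, so
  integrability of \<open>d\<close> is inherited even though the kernel may be unbounded.\<close>

lemma K_pair_integrable:
  assumes d: "integrable M d" and [measurable]: "(\<lambda>(x, y). \<omega> x y) \<in> borel_measurable (M \<Otimes>\<^sub>M M)"
    and c: "\<And>x y. \<bar>\<omega> x y\<bar> \<le> c"
  shows "integrable (M \<Otimes>\<^sub>M M) (\<lambda>(x, y). d x * (K x y * \<omega> x y))"
proof (rule P.Fubini_integrable)
  have [measurable]: "d \<in> borel_measurable M" using d by auto
  show "(\<lambda>(x, y). d x * (K x y * \<omega> x y)) \<in> borel_measurable (M \<Otimes>\<^sub>M M)" by measurable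
  have int: "integrable M (\<lambda>y. K x y * \<omega> x y)" for x
    by (rule K_mult_integrable[where c = c]) (use c in auto)
  then show "AE x in M. integrable M (\<lambda>y. case (x, y) of (x, y) \<Rightarrow> d x * (K x y * \<omega> x y))" by simp
  have bnd: "\<bar>\<integral>y. K x y * \<bar>\<omega> x y\<bar> \<partial>M\<bar> \<le> C * c" for x
    by (rule K_mult_integral_le) (use c in auto)
  have "integrable M (\<lambda>x. \<bar>d x\<bar> * (\<integral>y. K x y * \<bar>\<omega> x y\<bar> \<partial>M))"
  proof (rule Bochner_Integration.integrable_bound[of _ "\<lambda>x. (C * c) * d x"])
    show "AE x in M. norm (\<bar>d x\<bar> * (\<integral>y. K x y * \<bar>\<omega> x y\<bar> \<partial>M)) \<le> norm (C * c * d x)"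
      using order_trans[OF bnd abs_ge_self]
      by (intro AE_I2) (simp add: abs_mult mult.commute[of "\<bar>d _\<bar>"] mult_right_mono
          del: abs_mult_self_eq)
  qed (use d in auto)
  then show "integrable M (\<lambda>x. \<integral>y. norm (case (x, y) of (x, y) \<Rightarrow> d x * (K x y * \<omega> x y)) \<partial>M)"
    using K_nonneg by (simp add: abs_mult)
qed

text \<open>Exchanging the variables preserves \<open>K\<close> and the integral but flips the sign
  of \<open>\<omega>\<close>; averaging the two expressions turns \<open>d x\<close> into a
  difference of \<open>d\<close> at the two points.\<close>

lemma kernel_symmetrize:
  assumes d: "integrable M d" and [measurable]: "(\<lambda>(x, y). \<omega> x y) \<in> borel_measurable (M \<Otimes>\<^sub>M M)"
    and c: "\<And>x y. \<bar>\<omega> x y\<bar> \<le> c"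
    and anti: "AE z in M \<Otimes>\<^sub>M M. \<omega> (fst z) (snd z) = - \<omega> (snd z) (fst z)"
  shows "(\<integral>x. d x * (\<integral>y. K x y * \<omega> x y \<partial>M) \<partial>M)
    = - (1/2) * (\<integral>z. K (fst z) (snd z) * ((d (snd z) - d (fst z)) * \<omega> (fst z) (snd z)) \<partial>(M \<Otimes>\<^sub>M M))"
    and "integrable (M \<Otimes>\<^sub>M M) (\<lambda>z. K (fst z) (snd z) * ((d (snd z) - d (fst z)) * \<omega> (fst z) (snd z)))"
proof -
  have [measurable]: "d \<in> borel_measurable M" using d by auto
  define F where "F = (\<lambda>(x, y). d x * (K x y * \<omega> x y))"
  have F: "integrable (M \<Otimes>\<^sub>M M) F" unfolding F_def by (rule K_pair_integrable) fact+
  have [measurable]: "F \<in> borel_measurable (M \<Otimes>\<^sub>M M)" using F by auto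
  define F' where "F' = (\<lambda>(x, y). F (y, x))"
  have F': "integrable (M \<Otimes>\<^sub>M M) F'" unfolding F'_def by (rule P.integrable_product_swap[OF F])
  have F'_eq: "integral\<^sup>L (M \<Otimes>\<^sub>M M) F' = integral\<^sup>L (M \<Otimes>\<^sub>M M) F"
    unfolding F'_def by (rule P.integral_product_swap) measurable
  have ae: "AE z in M \<Otimes>\<^sub>M M. - (F z + F' z)
      = K (fst z) (snd z) * ((d (snd z) - d (fst z)) * \<omega> (fst z) (snd z))"
    using anti
  proof eventually_elim
    case (elim z)
    obtain x y where z: "z = (x, y)" by (cases z)
    show ?case using elim by (simp add: z F_def F'_def K_sym[of y x] algebra_simps)
  qed
  have int: "integrable (M \<Otimes>\<^sub>M M) (\<lambda>z. - (F z + F' z))" using F F' by auto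
  then show "integrable (M \<Otimes>\<^sub>M M) (\<lambda>z. K (fst z) (snd z) * ((d (snd z) - d (fst z)) * \<omega> (fst z) (snd z)))"
    by (rule integrable_cong_AE_imp) (use ae in \<open>auto elim: eventually_mono\<close>)
  have "(\<integral>x. d x * (\<integral>y. K x y * \<omega> x y \<partial>M) \<partial>M) = (\<integral>x. \<integral>y. F (x, y) \<partial>M \<partial>M)"
    by (simp add: F_def)
  also have "\<dots> = integral\<^sup>L (M \<Otimes>\<^sub>M M) F" by (rule P.integral_fst'[OF F])
  also have "\<dots> = - (1/2) * (\<integral>z. - (F z + F' z) \<partial>(M \<Otimes>\<^sub>M M))"
    using F F' F'_eq by simp
  also have "(\<integral>z. - (F z + F' z) \<partial>(M \<Otimes>\<^sub>M M))
      = (\<integral>z. K (fst z) (snd z) * ((d (snd z) - d (fst z)) * \<omega> (fst z) (snd z)) \<partial>(M \<Otimes>\<^sub>M M))"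
    by (rule integral_cong_AE) (use ae int in auto)
  finally show "(\<integral>x. d x * (\<integral>y. K x y * \<omega> x y \<partial>M) \<partial>M)
    = - (1/2) * (\<integral>z. K (fst z) (snd z) * ((d (snd z) - d (fst z)) * \<omega> (fst z) (snd z)) \<partial>(M \<Otimes>\<^sub>M M))" .
qed

text \<open>After symmetrization the integrand is at least \<open>- e * K\<close>, and the total
  mass of \<open>K\<close> is at most \<open>C * measure M UNIV\<close>. The error \<open>e\<close>
  is of the order of the lags in the existence proof and 0 in the uniqueness proof.\<close>

lemma kernel_almost_dissipative:
  assumes d: "integrable M d" and [measurable]: "(\<lambda>(x, y). \<omega> x y) \<in> borel_measurable (M \<Otimes>\<^sub>M M)"
    and c: "\<And>x y. \<bar>\<omega> x y\<bar> \<le> c"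
    and anti: "AE z in M \<Otimes>\<^sub>M M. \<omega> (fst z) (snd z) = - \<omega> (snd z) (fst z)"
    and e: "0 \<le> e" "AE z in M \<Otimes>\<^sub>M M. - e \<le> (d (snd z) - d (fst z)) * \<omega> (fst z) (snd z)"
  shows "(\<integral>x. d x * (\<integral>y. K x y * \<omega> x y \<partial>M) \<partial>M) \<le> e / 2 * (C * measure M UNIV)"
proof -
  have Kint: "integrable (M \<Otimes>\<^sub>M M) (\<lambda>(x, y). K x y)"
    using K_pair_integrable[of "\<lambda>_. 1" "\<lambda>_ _. 1" 1] by simp
  have "(\<integral>x. \<integral>y. K x y \<partial>M \<partial>M) \<le> (\<integral>x. C \<partial>M)"
    using P.integrable_fst'[OF Kint] K_integral_le by (intro integral_mono) auto
  then have Kle: "integral\<^sup>L (M \<Otimes>\<^sub>M M) (\<lambda>(x, y). K x y) \<le> C * measure M UNIV"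
    using P.integral_fst'[OF Kint] by (simp add: mult.commute)
  have "- e * integral\<^sup>L (M \<Otimes>\<^sub>M M) (\<lambda>(x, y). K x y) = (\<integral>z. - e * K (fst z) (snd z) \<partial>(M \<Otimes>\<^sub>M M))"
    by (simp add: case_prod_beta')
  also have "\<dots> \<le> (\<integral>z. K (fst z) (snd z) * ((d (snd z) - d (fst z)) * \<omega> (fst z) (snd z)) \<partial>(M \<Otimes>\<^sub>M M))"
  proof (rule integral_mono_AE)
    show "integrable (M \<Otimes>\<^sub>M M) (\<lambda>z. - e * K (fst z) (snd z))" using Kint by (simp add: case_prod_beta')
    show "AE z in M \<Otimes>\<^sub>M M. - e * K (fst z) (snd z)
        \<le> K (fst z) (snd z) * ((d (snd z) - d (fst z)) * \<omega> (fst z) (snd z))"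
      using e(2)
    proof eventually_elim
      case (elim z)
      from mult_left_mono[OF this K_nonneg] show ?case by (simp add: mult.commute)
    qed
  qed (rule kernel_symmetrize(2), fact+)
  finally have "(\<integral>x. d x * (\<integral>y. K x y * \<omega> x y \<partial>M) \<partial>M)
      \<le> e / 2 * integral\<^sup>L (M \<Otimes>\<^sub>M M) (\<lambda>(x, y). K x y)"
    using kernel_symmetrize(1)[OF d _ c anti] by simp
  also have "\<dots> \<le> e / 2 * (C * measure M UNIV)" using Kle e(1) by (intro mult_left_mono) auto
  finally show ?thesis .
qed

lemma borel_measurable_kernel_integral:
  assumes [measurable]: "(\<lambda>(t, x, y). w t x y) \<in> borel_measurable (borel \<Otimes>\<^sub>M (M \<Otimes>\<^sub>M M))"
  shows "(\<lambda>(x, t). \<integral>y. K x y * w t x y \<partial>M) \<in> borel_measurable (M \<Otimes>\<^sub>M borel)"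
proof -
  have "(\<lambda>p. (snd (fst p), fst (fst p), snd p)) \<in> measurable ((M \<Otimes>\<^sub>M borel) \<Otimes>\<^sub>M M) (borel \<Otimes>\<^sub>M (M \<Otimes>\<^sub>M M))"
    by measurable
  from measurable_compose[OF this assms]
  have [measurable]: "(\<lambda>p. w (snd (fst p)) (fst (fst p)) (snd p)) \<in> borel_measurable ((M \<Otimes>\<^sub>M borel) \<Otimes>\<^sub>M M)"
    by simp
  show ?thesis by measurable
qed

end

subsection \<open>The delay scheme\<close>

lemma sgn_monotone_mult: "0 \<le> (a - b) * (sgn a - sgn b :: real)"
  by (auto simp: sgn_real_def mult_nonneg_nonneg mult_nonpos_nonpos)

text \<open>This rewrites convergence to a varying limit through \<open>Cauchy\<close> and
  \<open>lim\<close>, so that the set where it happens is seen to be measurable.\<close>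

lemma tendsto_iff_Cauchy_lim:
  fixes X :: "nat \<Rightarrow> real"
  shows "X \<longlonglongrightarrow> l \<longleftrightarrow> Cauchy X \<and> lim X = l"
  using convergent_LIMSEQ_iff[of X] limI[of X l] by (auto simp: Cauchy_convergent_iff convergent_def)

text \<open>Where the limit argument is nonzero the signs are eventually constant, and their tail
  combinations have the same limit. Where it is zero, the multivalued sign accepts whatever the
  combinations converge to.\<close>

lemma sgn_tendsto_in_subdiff_abs:
  fixes a v :: "nat \<Rightarrow> real"
  assumes a: "a \<longlonglongrightarrow> A" and N: "\<And>n. tail_weights n (N n) (c n)"
    and v: "(\<lambda>n. \<Sum>k<N n. c n k * sgn (a k)) \<longlonglongrightarrow> w" and w: "\<bar>w\<bar> \<le> 1"
  shows "w \<in> subdiff_abs A"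
proof -
  consider "0 < A" | "A < 0" | "A = 0" by linarith
  then show ?thesis
  proof cases
    case 1
    have "eventually (\<lambda>k. sgn (a k) = 1) sequentially"
      using order_tendstoD(1)[OF a 1] by eventually_elim simp
    then have "(\<lambda>k. sgn (a k)) \<longlonglongrightarrow> 1" by (rule tendsto_eventually)
    then have "w = 1" by (intro LIMSEQ_unique[OF v] tail_weights_tendsto N)
    then show ?thesis using 1 by (simp add: subdiff_abs_def)
  next
    case 2
    have "eventually (\<lambda>k. sgn (a k) = -1) sequentially"
      using order_tendstoD(2)[OF a 2] by eventually_elim simp
    then have "(\<lambda>k. sgn (a k)) \<longlonglongrightarrow> -1" by (rule tendsto_eventually)
    then have "w = -1" by (intro LIMSEQ_unique[OF v] tail_weights_tendsto N)
    then show ?thesis using 2 by (simp add: subdiff_abs_def)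
  next
    case 3
    then show ?thesis using w by (auto simp: subdiff_abs_def)
  qed
qed

locale delay_scheme = kernel_space M K C for M :: "'a measure" and K C +
  fixes h :: "'a \<Rightarrow> real \<Rightarrow> real" and T :: real
  assumes h_measurable [measurable]: "(\<lambda>(x, t). h x t) \<in> borel_measurable (M \<Otimes>\<^sub>M borel)"
    and T_pos: "0 < T"
begin

definition delayed_sgn :: "real \<Rightarrow> ('a \<Rightarrow> real \<Rightarrow> real) \<Rightarrow> real \<Rightarrow> 'a \<Rightarrow> 'a \<Rightarrow> real" where
  "delayed_sgn \<delta> z s x y = sgn ((h y s + z y (s - \<delta>)) - (h x s + z x (s - \<delta>)))"

definition drift :: "real \<Rightarrow> ('a \<Rightarrow> real \<Rightarrow> real) \<Rightarrow> 'a \<Rightarrow> real \<Rightarrow> real" where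
  "drift \<delta> z x s = (\<integral>y. K x y * delayed_sgn \<delta> z s x y \<partial>M)"

definition delay_map :: "real \<Rightarrow> ('a \<Rightarrow> real \<Rightarrow> real) \<Rightarrow> 'a \<Rightarrow> real \<Rightarrow> real" where
  "delay_map \<delta> z x t = cum T (drift \<delta> z x) t"

abbreviation jointly :: "('a \<Rightarrow> real \<Rightarrow> real) \<Rightarrow> bool" where
  "jointly z \<equiv> (\<lambda>(x, t). z x t) \<in> borel_measurable (M \<Otimes>\<^sub>M borel)"

lemma delayed_sgn_measurable:
  assumes [measurable]: "jointly z"
  shows "(\<lambda>(s, x, y). delayed_sgn \<delta> z s x y) \<in> borel_measurable (borel \<Otimes>\<^sub>M (M \<Otimes>\<^sub>M M))"
  unfolding delayed_sgn_def by measurable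

lemma delayed_sgn_bound: "\<bar>delayed_sgn \<delta> z s x y\<bar> \<le> 1"
  by (simp add: delayed_sgn_def sgn_real_def)

lemma delayed_sgn_anti: "delayed_sgn \<delta> z s x y = - delayed_sgn \<delta> z s y x"
  unfolding delayed_sgn_def by (subst sgn_minus[symmetric]) simp

lemma delayed_sgn_slice:
  assumes "jointly z"
  shows "(\<lambda>(x, y). delayed_sgn \<delta> z s x y) \<in> borel_measurable (M \<Otimes>\<^sub>M M)"
    "delayed_sgn \<delta> z s x \<in> borel_measurable M"
proof -
  note [measurable] = assms
  show "(\<lambda>(x, y). delayed_sgn \<delta> z s x y) \<in> borel_measurable (M \<Otimes>\<^sub>M M)"
    "delayed_sgn \<delta> z s x \<in> borel_measurable M"
    unfolding delayed_sgn_def by measurable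
qed

lemma drift_measurable:
  assumes "jointly z"
  shows "jointly (drift \<delta> z)" "drift \<delta> z x \<in> borel_measurable borel"
proof -
  show [measurable]: "jointly (drift \<delta> z)" unfolding drift_def
    by (rule borel_measurable_kernel_integral[OF delayed_sgn_measurable[OF assms]])
  show "drift \<delta> z x \<in> borel_measurable borel" by measurable
qed

lemma drift_bound:
  assumes "jointly z"
  shows "\<bar>drift \<delta> z x s\<bar> \<le> C"
  using K_mult_integral_le[OF delayed_sgn_slice(2)[OF assms] delayed_sgn_bound, of x \<delta> s x]
  by (simp add: drift_def)

lemma delay_map_measurable:
  assumes "jointly z"
  shows "jointly (delay_map \<delta> z)"
proof -
  note [measurable] = drift_measurable(1)[OF assms]
  have "(\<lambda>p. cum T (drift \<delta> z (fst p)) (snd p)) \<in> borel_measurable (M \<Otimes>\<^sub>M borel)"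
    by (rule borel_measurable_cum) measurable
  then show ?thesis unfolding delay_map_def by (simp add: case_prod_beta')
qed

lemma delay_map_cong:
  assumes "\<And>x s. s < t - \<delta> \<Longrightarrow> z x s = z' x s"
  shows "delay_map \<delta> z x t = delay_map \<delta> z' x t"
  unfolding delay_map_def
proof (rule cum_cong)
  fix s assume "s < t"
  then have "z y (s - \<delta>) = z' y (s - \<delta>)" for y using assms by simp
  then show "drift \<delta> z x s = drift \<delta> z' x s" by (simp add: drift_def delayed_sgn_def)
qed

text \<open>The method of steps: the \<open>n\<close>-th iterate is stationary on \<open>]-\<infinity>, n \<delta>]\<close>.\<close>
lemma delay_solution:
  assumes "0 < \<delta>"
  obtains z where "jointly z" "\<And>x t. z x t = cum T (drift \<delta> z x) t"
proof -
  define Z where "Z n = (delay_map \<delta> ^^ n) (\<lambda>_ _. 0)" for n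
  have Z_Suc: "Z (Suc n) = delay_map \<delta> (Z n)" for n by (simp add: Z_def)
  have Z_meas: "jointly (Z n)" for n
    by (induction n) (simp_all add: Z_Suc delay_map_measurable Z_def[of 0])
  have stat: "Z (Suc n) x t = Z n x t" if "t \<le> real n * \<delta>" for n x t
    using that
  proof (induction n arbitrary: x t)
    case 0
    then show ?case by (simp add: Z_def delay_map_def cum_nonpos)
  next
    case (Suc n)
    show ?case unfolding Z_Suc[of "Suc n"] unfolding Z_Suc[of n]
      using Suc by (intro delay_map_cong) (auto simp: Z_Suc[symmetric] algebra_simps)
  qed
  obtain N :: nat where N: "T < real N * \<delta>" using ex_less_of_nat_mult[OF assms] by blast
  \<comment> \<open>For \<open>s\<close> in the time interval, \<open>s - \<delta>\<close> is at
    most \<open>N * \<delta>\<close>, where \<open>Z N\<close> and \<open>Z (Suc N)\<close> agree.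
    Their drifts therefore coincide at every time the primitive sees, so \<open>Z (Suc N)\<close> is
    a fixed point.\<close>
  let ?z = "Z (Suc N)"
  have "?z x t = cum T (drift \<delta> ?z x) t" for x t
  proof -
    have "?z x t = cum T (drift \<delta> (Z N) x) t" by (simp add: Z_Suc delay_map_def)
    also have "\<dots> = cum T (drift \<delta> ?z x) t"
    proof (rule cum_cong_AE)
      show "AE s in borel_on {0..T}. s < t \<longrightarrow> drift \<delta> (Z N) x s = drift \<delta> ?z x s"
        using AE_in_borel_on[OF borel_closed[OF closed_atLeastAtMost]]
      proof eventually_elim
        case (elim s)
        then have "Z N y (s - \<delta>) = ?z y (s - \<delta>)" for y using stat N assms by simp
        then show ?case by (simp add: drift_def delayed_sgn_def)
      qed
    qed (rule drift_measurable(2)[OF Z_meas])+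
    finally show ?thesis .
  qed
  then show thesis using that Z_meas by blast
qed

section \<open>Convergence of the approximations\<close>

text \<open>The squared distance of two approximations is linear in the lags, so the ratio 1/8 is
  the one that \<open>AE_convergent_if_square_diffs_summable\<close> expects.\<close>

definition lag :: "nat \<Rightarrow> real" where "lag n = (1/8)^n"

definition approx :: "nat \<Rightarrow> 'a \<Rightarrow> real \<Rightarrow> real" where
  "approx n = (SOME z. jointly z \<and> (\<forall>x t. z x t = cum T (drift (lag n) z x) t))"

lemma approx: "jointly (approx n)" "approx n x t = cum T (drift (lag n) (approx n) x) t"
proof -
  have "0 < lag n" by (simp add: lag_def)
  then have "\<exists>z. jointly z \<and> (\<forall>x t. z x t = cum T (drift (lag n) z x) t)"
    by (rule delay_solution) blast
  from someI_ex[OF this] show "jointly (approx n)" "approx n x t = cum T (drift (lag n) (approx n) x) t"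
    unfolding approx_def by blast+
qed

lemma approx_lipschitz: "\<bar>approx n x t - approx n x s\<bar> \<le> C * \<bar>t - s\<bar>"
  unfolding approx(2)[of n x t] approx(2)[of n x s]
  by (rule cum_lipschitz[OF drift_measurable(2) drift_bound]) (rule approx(1))+

text \<open>The signs would be monotone in the difference of the approximations if they were
  evaluated at the current time. Evaluating them at delayed times costs the error \<open>q\<close>,
  and the energy estimate then yields a bound linear in the lags.\<close>

lemma approx_diff_square:
  "(\<integral>\<^sup>+x. ennreal ((approx n x t - approx m x t)\<^sup>2) \<partial>M)
    \<le> ennreal (4 * C\<^sup>2 * measure M UNIV * T * (lag n + lag m))"
proof -
  define d where "d x s = approx n x s - approx m x s" for x s
  define e where "e x s = drift (lag n) (approx n) x s - drift (lag m) (approx m) x s" for x s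
  define w where "w s x y = delayed_sgn (lag n) (approx n) s x y - delayed_sgn (lag m) (approx m) s x y" for s x y
  \<comment> \<open>Each of the two approximations is delayed at two points, an error of at most
    \<open>2 * C * (lag n + lag m)\<close> in the argument difference; the difference of the signs
    contributes another factor 2.\<close>
  define q where "q = 4 * C * (lag n + lag m)"
  define B where "B = q / 2 * (C * measure M UNIV)"
  note [measurable] = approx(1) drift_measurable[OF approx(1)]
  have lag: "0 < lag k" for k by (simp add: lag_def)
  have q0: "0 \<le> q" using lag[of n] lag[of m] C_nonneg by (simp add: q_def)
  have B0: "0 \<le> B" using q0 C_nonneg by (simp add: B_def)
  have d_cum: "d x s = cum T (e x) s" for x s
    unfolding d_def e_def approx(2)[of n x s] approx(2)[of m x s]
    by (intro cum_diff[symmetric] integrable_bounded_Icc[where C = C] drift_measurable(2) drift_bound approx(1))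
  have [measurable]: "jointly d" "jointly e" unfolding d_def e_def by measurable
  have [measurable]: "e x \<in> borel_measurable borel" "(\<lambda>x. d x s) \<in> borel_measurable M" for x s by measurable
  have e_bnd: "\<bar>e x s\<bar> \<le> 2 * C" for x s
    using drift_bound[OF approx(1), of "lag n" n x s] drift_bound[OF approx(1), of "lag m" m x s]
    by (simp add: e_def)
  have d_bnd: "\<bar>d x s\<bar> \<le> 2 * C * T" for x s
    unfolding d_cum using T_pos e_bnd by (intro cum_abs_le) auto
  have d_int: "integrable M (\<lambda>x. d x s)" for s
    by (rule integrable_const_bound[of _ "2 * C * T"]) (use d_bnd in auto)
  have diss: "(\<integral>x. d x s * e x s \<partial>M) \<le> B" for s
  proof -
    have "(\<integral>x. d x s * e x s \<partial>M) = (\<integral>x. d x s * (\<integral>y. K x y * w s x y \<partial>M) \<partial>M)"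
    proof (rule Bochner_Integration.integral_cong)
      fix x
      have "e x s = (\<integral>y. K x y * w s x y \<partial>M)"
        unfolding e_def drift_def w_def right_diff_distrib
        by (intro Bochner_Integration.integral_diff[symmetric]
            K_mult_integrable[OF delayed_sgn_slice(2) delayed_sgn_bound] approx(1))
      then show "d x s * e x s = d x s * (\<integral>y. K x y * w s x y \<partial>M)" by simp
    qed simp
    also have "\<dots> \<le> q / 2 * (C * measure M UNIV)"
    proof (rule kernel_almost_dissipative[where c = 2, OF d_int])
      show "(\<lambda>(x, y). w s x y) \<in> borel_measurable (M \<Otimes>\<^sub>M M)"
        unfolding w_def using delayed_sgn_slice(1)[OF approx(1)] by (simp add: case_prod_beta')
      show w2: "\<bar>w s x y\<bar> \<le> 2" for x y
        using delayed_sgn_bound[of "lag n" "approx n" s x y] delayed_sgn_bound[of "lag m" "approx m" s x y]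
        by (simp add: w_def)
      show "AE z in M \<Otimes>\<^sub>M M. w s (fst z) (snd z) = - w s (snd z) (fst z)"
        by (rule AE_I2) (simp add: w_def delayed_sgn_anti[of _ _ s "fst _"])
      show "AE z in M \<Otimes>\<^sub>M M. - q \<le> (d (snd z) s - d (fst z) s) * w s (fst z) (snd z)"
      proof (rule AE_I2)
        fix z :: "'a \<times> 'a"
        define x y where "x = fst z" and "y = snd z"
        define a where "a k = (h y s + approx k y (s - lag k)) - (h x s + approx k x (s - lag k))" for k
        \<comment> \<open>The discrepancy between current and delayed arguments. The contribution of
          \<open>h\<close> cancels in \<open>a n - a m\<close>, which is why no regularity of
          \<open>h\<close> in time enters.\<close>
        define \<rho> where "\<rho> = (d y s - d x s) - (a n - a m)"
        have "\<bar>approx k p s - approx k p (s - lag k)\<bar> \<le> C * lag k" for k p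
          using approx_lipschitz[of k p s "s - lag k"] lag[of k] by simp
        from this[of n x] this[of n y] this[of m x] this[of m y]
        have "\<bar>\<rho>\<bar> \<le> 2 * (C * lag n) + 2 * (C * lag m)"
          unfolding \<rho>_def d_def a_def abs_le_iff by linarith
        then have "\<bar>\<rho> * w s x y\<bar> \<le> (2 * (C * lag n) + 2 * (C * lag m)) * 2"
          unfolding abs_mult using w2[of x y] by (intro mult_mono) auto
        then have 1: "- q \<le> \<rho> * w s x y" by (simp add: q_def algebra_simps)
        have "0 \<le> (a n - a m) * (sgn (a n) - sgn (a m))" by (rule sgn_monotone_mult)
        also have "sgn (a n) - sgn (a m) = w s x y" by (simp add: w_def delayed_sgn_def a_def)
        finally have 2: "0 \<le> (a n - a m) * w s x y" .
        have "(d y s - d x s) * w s x y = \<rho> * w s x y + (a n - a m) * w s x y"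
          by (simp add: \<rho>_def algebra_simps)
        then show "- q \<le> (d (snd z) s - d (fst z) s) * w s (fst z) (snd z)"
          using 1 2 by (simp add: x_def y_def)
      qed
    qed (rule q0)
    finally show ?thesis by (simp add: B_def)
  qed
  have "AE s in borel_on {0..T}. (\<integral>x. e x s * cum T (e x) s \<partial>M) \<le> B"
    using diss by (simp add: d_cum mult.commute)
  note sq = cum_square_integral_le[OF \<open>jointly e\<close> e_bnd less_imp_le[OF T_pos] B0 this, of t]
  have "(\<integral>\<^sup>+x. ennreal ((d x t)\<^sup>2) \<partial>M) = ennreal (\<integral>x. (d x t)\<^sup>2 \<partial>M)"
    unfolding d_cum by (rule nn_integral_eq_integral[OF sq(1)]) simp
  also have "\<dots> \<le> ennreal (2 * B * T)" unfolding d_cum by (rule ennreal_leI[OF sq(2)])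
  also have "2 * B * T = 4 * C\<^sup>2 * measure M UNIV * T * (lag n + lag m)"
    by (simp add: B_def q_def power2_eq_square mult_ac)
  finally show ?thesis by (simp add: d_def)
qed

text \<open>The null set may depend on \<open>t\<close>. This is harmless because the inclusion is
  only examined at one time after the other.\<close>

lemma approx_AE_convergent: "AE x in M. convergent (\<lambda>n. approx n x t)"
proof (rule AE_convergent_if_square_diffs_summable)
  note [measurable] = approx(1)
  show "(\<lambda>x. approx n x t) \<in> borel_measurable M" for n by measurable
  let ?B = "4 * C\<^sup>2 * measure M UNIV * T"
  have B: "0 \<le> ?B" using C_nonneg T_pos by simp
  then show "0 \<le> 2 * ?B" by simp
  fix n
  have "?B * (lag (Suc n) + lag n) \<le> ?B * (2 * (1/8)^n)"
    using B by (intro mult_left_mono) (auto simp: lag_def)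
  then have "ennreal (?B * (lag (Suc n) + lag n)) \<le> ennreal (2 * ?B * (1/8)^n)"
    by (intro ennreal_leI) simp
  with approx_diff_square[of "Suc n" t n]
  show "(\<integral>\<^sup>+x. ennreal ((approx (Suc n) x t - approx n x t)\<^sup>2) \<partial>M) \<le> ennreal (2 * ?B * (1/8)^n)"
    by (rule order_trans)
qed

text \<open>Two kinds of limit are reconciled here: the signs converge only along tail combinations,
  the trajectories converge as they stand. Linearity of the kernel integral and of the primitive
  shows that the limit trajectory is driven by the limit sign.\<close>

lemma sign_selection_exists:
  obtains w where "(\<lambda>(t, x, y). w t x y) \<in> borel_measurable (borel \<Otimes>\<^sub>M (M \<Otimes>\<^sub>M M))"
    and "\<And>t x y. \<bar>w t x y\<bar> \<le> 1"
    and "AE t in borel_on {0..T}. AE z in M \<Otimes>\<^sub>M M.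
      w t (fst z) (snd z) = - w t (snd z) (fst z) \<and>
      w t (fst z) (snd z) \<in> subdiff_abs
        ((h (snd z) t + cum T (\<lambda>s. \<integral>y. K (snd z) y * w s (snd z) y \<partial>M) t)
         - (h (fst z) t + cum T (\<lambda>s. \<integral>y. K (fst z) y * w s (fst z) y \<partial>M) t))"
proof -
  let ?I = "borel_on {0..T}"
  interpret I: finite_measure ?I by (rule finite_measure_Icc)
  interpret MM: finite_measure "M \<Otimes>\<^sub>M M"
    using finite_measure_axioms finite_measure_axioms by (rule finite_measure_pair_measure)
  interpret IMM: pair_sigma_finite ?I "M \<Otimes>\<^sub>M M" ..
  interpret IM: pair_sigma_finite ?I M ..
  interpret IMMf: finite_measure "?I \<Otimes>\<^sub>M (M \<Otimes>\<^sub>M M)"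
    using MM.finite_measure_axioms I.finite_measure_axioms by (rule finite_measure_pair_measure)
  define ds where "ds k = delayed_sgn (lag k) (approx k)" for k
  have ds_meas [measurable]: "(\<lambda>(s, x, y). ds k s x y) \<in> borel_measurable (borel \<Otimes>\<^sub>M (M \<Otimes>\<^sub>M M))" for k
    unfolding ds_def by (rule delayed_sgn_measurable[OF approx(1)])
  have ds_bnd: "\<bar>ds k s x y\<bar> \<le> 1" for k s x y unfolding ds_def by (rule delayed_sgn_bound)
  obtain N c where N: "\<And>n. tail_weights n (N n) (c n)" and conv:
    "AE p in ?I \<Otimes>\<^sub>M (M \<Otimes>\<^sub>M M). convergent (\<lambda>n. \<Sum>k<N n. c n k * (case p of (s, x, y) \<Rightarrow> ds k s x y))"
  proof (rule IMMf.AE_convergent_tail_convex_combinations[where w = "\<lambda>k (s, x, y). ds k s x y"])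
    show "(\<lambda>(s, x, y). ds k s x y) \<in> borel_measurable (?I \<Otimes>\<^sub>M (M \<Otimes>\<^sub>M M))" for k
      using ds_meas[of k] by (simp cong: measurable_cong_sets)
  qed (use ds_bnd in auto)
  define V where "V n s x y = (\<Sum>k<N n. c n k * ds k s x y)" for n s x y
  \<comment> \<open>The value of \<open>lim\<close> is arbitrary where the combinations diverge; the
    clamp makes the bound hold everywhere and does nothing on the set of convergence.\<close>
  define w where "w s x y = max (-1) (min 1 (lim (\<lambda>n. V n s x y)))" for s x y
  have V_meas [measurable]: "(\<lambda>(s, x, y). V n s x y) \<in> borel_measurable (borel \<Otimes>\<^sub>M (M \<Otimes>\<^sub>M M))" for n
  proof -
    have "(\<lambda>p. \<Sum>k<N n. c n k * (case p of (s, x, y) \<Rightarrow> ds k s x y)) \<in> borel_measurable (borel \<Otimes>\<^sub>M (M \<Otimes>\<^sub>M M))"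
      by measurable
    then show ?thesis by (simp add: V_def case_prod_beta')
  qed
  have w_meas [measurable]: "(\<lambda>(s, x, y). w s x y) \<in> borel_measurable (borel \<Otimes>\<^sub>M (M \<Otimes>\<^sub>M M))"
  proof -
    have "(\<lambda>p. max (-1) (min 1 (lim (\<lambda>n. case p of (s, x, y) \<Rightarrow> V n s x y)))) \<in> borel_measurable (borel \<Otimes>\<^sub>M (M \<Otimes>\<^sub>M M))"
      by measurable
    then show ?thesis by (simp add: w_def case_prod_beta')
  qed
  have w_bnd: "\<bar>w s x y\<bar> \<le> 1" for s x y by (auto simp: w_def)
  have V_bnd: "\<bar>V n s x y\<bar> \<le> 1" for n s x y
    using tail_weights_abs_le[OF N[of n], of "\<lambda>k. ds k s x y" 0 1] ds_bnd by (simp add: V_def)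
  have V_lim: "(\<lambda>n. V n s x y) \<longlonglongrightarrow> w s x y" if conv: "convergent (\<lambda>n. V n s x y)" for s x y
  proof -
    have L: "(\<lambda>n. V n s x y) \<longlonglongrightarrow> lim (\<lambda>n. V n s x y)" using conv by (simp add: convergent_LIMSEQ_iff)
    have "\<bar>lim (\<lambda>n. V n s x y)\<bar> \<le> 1"
      by (rule tendsto_upperbound[OF tendsto_rabs[OF L]]) (use V_bnd in auto)
    then show ?thesis using L by (simp add: w_def abs_le_iff)
  qed
  have AE_V: "AE s in ?I. AE z in M \<Otimes>\<^sub>M M. (\<lambda>n. V n s (fst z) (snd z)) \<longlonglongrightarrow> w s (fst z) (snd z)"
    using IMM.AE_pair[OF conv]
    by (auto simp: V_def[symmetric] case_prod_beta' elim!: eventually_mono intro!: V_lim)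
  have sliceV: "V n s x \<in> borel_measurable M" for n s x
    using measurable_compose[OF _ V_meas[of n], of "\<lambda>y. (s, x, y)" M] by simp
  have slicew: "w s x \<in> borel_measurable M" for s x
    using measurable_compose[OF _ w_meas, of "\<lambda>y. (s, x, y)" M] by simp

  define b where "b x s = (\<integral>y. K x y * w s x y \<partial>M)" for x s
  define B where "B n x s = (\<integral>y. K x y * V n s x y \<partial>M)" for n x s
  have b_meas [measurable]: "jointly b" unfolding b_def by (rule borel_measurable_kernel_integral[OF w_meas])
  have B_meas [measurable]: "jointly (B n)" for n unfolding B_def by (rule borel_measurable_kernel_integral[OF V_meas])
  have B_bnd: "\<bar>B n x s\<bar> \<le> C" for n x s
    using K_mult_integral_le[OF sliceV V_bnd, of x n s x] by (simp add: B_def)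
  have B_sum: "B n x s = (\<Sum>k<N n. c n k * drift (lag k) (approx k) x s)" for n x s
  proof -
    have int: "integrable M (\<lambda>y. K x y * ds k s x y)" for k
      unfolding ds_def by (rule K_mult_integrable[OF delayed_sgn_slice(2)[OF approx(1)] delayed_sgn_bound])
    have "B n x s = (\<integral>y. (\<Sum>k<N n. c n k * (K x y * ds k s x y)) \<partial>M)"
      by (simp add: B_def V_def sum_distrib_left mult.left_commute)
    also have "\<dots> = (\<Sum>k<N n. (\<integral>y. c n k * (K x y * ds k s x y) \<partial>M))"
      using int by (intro Bochner_Integration.integral_sum integrable_mult_right)
    finally show ?thesis by (simp add: drift_def ds_def)
  qed
  have "AE s in ?I. AE x in M. (\<lambda>n. B n x s) \<longlonglongrightarrow> b x s"
    using AE_V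
  proof eventually_elim
    case (elim s)
    from P.AE_pair[OF elim] show ?case
    proof eventually_elim
      case (elim x)
      show ?case unfolding B_def b_def
      proof (rule integral_dominated_convergence[where w = "K x"])
        show "AE y in M. norm (K x y * V n s x y) \<le> K x y" for n
          using mult_left_mono[OF V_bnd K_nonneg] by (simp add: abs_mult K_nonneg)
        show "AE y in M. (\<lambda>n. K x y * V n s x y) \<longlonglongrightarrow> K x y * w s x y"
          using elim by eventually_elim (auto intro!: tendsto_mult_left)
        show "(\<lambda>y. K x y * w s x y) \<in> borel_measurable M" "(\<lambda>y. K x y * V n s x y) \<in> borel_measurable M" for n
          using slicew[of s x] sliceV[of n s x] by measurable
      qed (rule K_integrable)
    qed
  qed
  then have "AE x in M. AE s in ?I. (\<lambda>n. B n x s) \<longlonglongrightarrow> b x s"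
  \<comment> \<open>Passing to the limit in the time integral requires a fixed \<open>x\<close>, so
    the order of the two almost-everywhere quantifiers is exchanged; this calls for measurability of
    the set of convergence.\<close>
  proof (subst IM.AE_commute[symmetric])
    have "Measurable.pred (borel \<Otimes>\<^sub>M M)
        (\<lambda>p. Cauchy (\<lambda>n. B n (snd p) (fst p)) \<and> lim (\<lambda>n. B n (snd p) (fst p)) = b (snd p) (fst p))"
      by measurable
    then have "Measurable.pred (?I \<Otimes>\<^sub>M M) (\<lambda>p. (\<lambda>n. B n (snd p) (fst p)) \<longlonglongrightarrow> b (snd p) (fst p))"
      by (simp add: tendsto_iff_Cauchy_lim cong: measurable_cong_sets)
    then show "{p \<in> space (?I \<Otimes>\<^sub>M M). (\<lambda>n. B n (snd p) (fst p)) \<longlonglongrightarrow> b (snd p) (fst p)} \<in> sets (?I \<Otimes>\<^sub>M M)"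
      by (simp add: pred_def)
  qed
  then have AE_cum: "AE x in M. \<forall>t. (\<lambda>n. cum T (B n x) t) \<longlonglongrightarrow> cum T (b x) t"
  proof eventually_elim
    case (elim x)
    show ?case
    proof
      fix t
      show "(\<lambda>n. cum T (B n x) t) \<longlonglongrightarrow> cum T (b x) t"
        by (rule cum_dominated_convergence[where C = C, OF _ _ B_bnd elim]) measurable
    qed
  qed
  \<comment> \<open>The combinations of the trajectories tend to the primitive of the limit drift.
    The trajectories themselves converge, and combinations of a convergent sequence keep its limit,
    so the two limits agree.\<close>
  have approx_lim: "AE x in M. (\<lambda>k. approx k x t) \<longlonglongrightarrow> cum T (b x) t" for t
    using AE_cum approx_AE_convergent[of t]
  proof eventually_elim
    case (elim x)
    have "cum T (B n x) t = (\<Sum>k<N n. c n k * approx k x t)" for n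
    proof -
      have "cum T (B n x) t = (\<Sum>k<N n. c n k * cum T (drift (lag k) (approx k) x) t)"
        unfolding B_sum[abs_def]
        by (rule cum_sum, rule integrable_bounded_Icc[where C = C])
          (auto intro: drift_measurable(2) drift_bound approx(1))
      then show ?thesis by (simp add: approx(2)[symmetric])
    qed
    moreover have "(\<lambda>n. cum T (B n x) t) \<longlonglongrightarrow> cum T (b x) t" using elim by blast
    ultimately have "(\<lambda>n. \<Sum>k<N n. c n k * approx k x t) \<longlonglongrightarrow> cum T (b x) t" by simp
    moreover obtain l where l: "(\<lambda>k. approx k x t) \<longlonglongrightarrow> l" using elim by (auto simp: convergent_def)
    moreover have "(\<lambda>n. \<Sum>k<N n. c n k * approx k x t) \<longlonglongrightarrow> l" by (rule tail_weights_tendsto[OF N l])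
    ultimately show ?case using LIMSEQ_unique by blast
  qed
  show thesis
  proof (rule that[OF w_meas w_bnd])
    show "AE t in ?I. AE z in M \<Otimes>\<^sub>M M.
      w t (fst z) (snd z) = - w t (snd z) (fst z) \<and>
      w t (fst z) (snd z) \<in> subdiff_abs
        ((h (snd z) t + cum T (\<lambda>s. \<integral>y. K (snd z) y * w s (snd z) y \<partial>M) t)
         - (h (fst z) t + cum T (\<lambda>s. \<integral>y. K (fst z) y * w s (fst z) y \<partial>M) t))"
      using AE_V
    proof eventually_elim
      case (elim t)
      show ?case
        using elim AE_fst_snd[OF approx_lim[of t]]
      proof eventually_elim
        case (elim z)
        define x y where "x = fst z" and "y = snd z"
        have lims: "(\<lambda>n. V n t x y) \<longlonglongrightarrow> w t x y" "(\<lambda>k. approx k x t) \<longlonglongrightarrow> cum T (b x) t"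
          "(\<lambda>k. approx k y t) \<longlonglongrightarrow> cum T (b y) t"
          using elim by (simp_all add: x_def y_def)
        \<comment> \<open>Antisymmetry is exact before the limit, so convergence at
          \<open>(x, y)\<close> entails convergence at \<open>(y, x)\<close>.\<close>
        have "V n t y x = - V n t x y" for n
          unfolding V_def ds_def delayed_sgn_anti[of _ _ t y x] by (simp add: sum_negf)
        then have "(\<lambda>n. V n t y x) \<longlonglongrightarrow> - w t x y" using tendsto_minus[OF lims(1)] by simp
        moreover from this have "(\<lambda>n. V n t y x) \<longlonglongrightarrow> w t y x" by (intro V_lim) (auto simp: convergent_def)
        ultimately have anti: "w t x y = - w t y x" using LIMSEQ_unique by fastforce
        have lag0: "(\<lambda>k. C * lag k) \<longlonglongrightarrow> 0"
          unfolding lag_def by (intro tendsto_mult_right_zero LIMSEQ_power_zero) simp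
        \<comment> \<open>The uniform Lipschitz bound makes the delay invisible in the
          limit.\<close>
        have delay: "(\<lambda>k. approx k p (t - lag k)) \<longlonglongrightarrow> l" if "(\<lambda>k. approx k p t) \<longlonglongrightarrow> l" for p l
        proof -
          have "(\<lambda>k. approx k p t - approx k p (t - lag k)) \<longlonglongrightarrow> 0"
          proof (rule Lim_null_comparison[OF _ lag0], rule always_eventually, rule allI)
            fix k
            show "norm (approx k p t - approx k p (t - lag k)) \<le> C * lag k"
              using approx_lipschitz[of k p t "t - lag k"] by (simp add: lag_def)
          qed
          from tendsto_diff[OF that this] show ?thesis by simp
        qed
        let ?A = "(h y t + cum T (b y) t) - (h x t + cum T (b x) t)"
        have "(\<lambda>k. (h y t + approx k y (t - lag k)) - (h x t + approx k x (t - lag k))) \<longlonglongrightarrow> ?A"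
          by (intro tendsto_intros delay lims)
        then have "w t x y \<in> subdiff_abs ?A"
          by (rule sgn_tendsto_in_subdiff_abs[OF _ N _ w_bnd])
            (use lims(1) in \<open>simp add: V_def ds_def delayed_sgn_def\<close>)
        then show ?case using anti by (simp add: x_def y_def b_def[abs_def])
      qed
    qed
  qed
qed

end

subsection \<open>Borel representatives of the problem\<close>

lemma Omega_eq_cbox: "Omega = cbox 0 (1 :: real^'d)"
  by (auto simp: Omega_def mem_box_cart)

lemma Omega_borel [measurable, simp]: "Omega \<in> sets borel"
  by (simp add: Omega_eq_cbox)

lemma Omega_finite: "emeasure lborel (Omega :: (real^'d) set) < \<infinity>"
  unfolding Omega_eq_cbox by (rule emeasure_lborel_cbox_finite)

lemma finite_measure_Omega: "finite_measure (borel_on (Omega :: (real^'d) set))"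
  by (rule finite_measure_borel_on[OF Omega_borel Omega_finite])

lemma nn_integral_lebesgue_on_eq:
  assumes [measurable]: "S \<in> sets borel" "f' \<in> borel_measurable borel"
    and ae: "AE x in borel_on S. f x = f' x"
  shows "nn_integral (lebesgue_on S) f = nn_integral (borel_on S) f'"
proof -
  have "nn_integral (lebesgue_on S) f = (\<integral>\<^sup>+x. f x * indicator S x \<partial>lebesgue)"
    by (rule nn_integral_restrict_space) simp
  also have "\<dots> = (\<integral>\<^sup>+x. f x * indicator S x \<partial>lborel)" by (rule nn_integral_completion)
  also have "\<dots> = (\<integral>\<^sup>+x. indicator S x * f' x \<partial>lborel)"
    using ae by (intro nn_integral_cong_AE) (auto simp: AE_borel_on indicator_def elim!: eventually_mono)
  also have "\<dots> = nn_integral (borel_on S) f'"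
    unfolding borel_on_def by (rule nn_integral_density[symmetric]) auto
  finally show ?thesis .
qed

text \<open>A Borel version of the kernel has its properties only almost everywhere. They are
  restored everywhere by symmetrizing, truncating at 0 and deleting the rows and columns with too
  large an integral, all of which alters a null set only.\<close>

lemma kernel_representative:
  fixes K :: "real^'d \<Rightarrow> real^'d \<Rightarrow> real"
  assumes "H1 K" "H2 K" "H3 K"
  obtains K' C where "kernel_space (borel_on Omega) K' C"
    "AE z in borel_on Omega \<Otimes>\<^sub>M borel_on Omega. K (fst z) (snd z) = K' (fst z) (snd z)"
proof -
  let ?M = "borel_on (Omega :: (real^'d) set)"
  interpret M: finite_measure ?M by (rule finite_measure_Omega)
  interpret P: pair_sigma_finite ?M ?M ..
  have prod: "?M \<Otimes>\<^sub>M ?M = borel_on (Omega \<times> Omega)" by (rule borel_on_prod) (rule Omega_borel Omega_finite)+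
  have Om2: "(Omega \<times> Omega :: ((real^'d) \<times> (real^'d)) set) \<in> sets borel" by (rule borel_Times) auto
  have "(\<lambda>z. K (fst z) (snd z)) \<in> borel_measurable (lebesgue_on (Omega \<times> Omega))"
    using assms(1) by (simp add: H1_def)
  then obtain k where k: "k \<in> borel_measurable borel" "AE z in ?M \<Otimes>\<^sub>M ?M. K (fst z) (snd z) = k z"
    unfolding prod by (rule borel_representative[OF Om2])
  have [measurable]: "k \<in> borel_measurable (borel \<Otimes>\<^sub>M borel)" using k(1) by (simp only: borel_prod)
  define k1 where "k1 x y = max 0 ((k (x, y) + k (y, x)) / 2)" for x y
  have [measurable]: "(\<lambda>(x, y). k1 x y) \<in> borel_measurable (borel \<Otimes>\<^sub>M borel)"
    unfolding k1_def by measurable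
  have "AE z in ?M \<Otimes>\<^sub>M ?M. z \<in> Omega \<times> Omega"
    unfolding prod using Om2 by (rule AE_in_borel_on)
  with k(2) P.AE_pair_swap[OF k(2)]
  have k1: "AE z in ?M \<Otimes>\<^sub>M ?M. K (fst z) (snd z) = k1 (fst z) (snd z)"
  proof eventually_elim
    case (elim z)
    have "fst z \<in> Omega" "snd z \<in> Omega" using elim(3) by auto
    then have "K (fst z) (snd z) = K (snd z) (fst z)" "0 \<le> K (fst z) (snd z)"
      using assms(1,2) unfolding H1_def H2_def by blast+
    then show ?case using elim by (simp add: k1_def)
  qed
  define C where "C = enn2real (SUP x\<in>Omega. \<integral>\<^sup>+ y. ennreal (K x y) \<partial>lebesgue_on Omega)"
  have C: "0 \<le> C" "(SUP x\<in>Omega. \<integral>\<^sup>+ y. ennreal (K x y) \<partial>lebesgue_on Omega) = ennreal C"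
    using assms(3) unfolding H3_def C_def by (simp_all add: ennreal_enn2real)
  define G where "G = {x. (\<integral>\<^sup>+y. ennreal (k1 x y) \<partial>?M) \<le> ennreal C}"
  have [measurable]: "G \<in> sets borel" unfolding G_def by measurable
  have "AE x in ?M. x \<in> Omega" by (rule AE_in_borel_on) simp
  with P.AE_pair[OF k1] have AE_G: "AE x in ?M. x \<in> G"
  proof eventually_elim
    case (elim x)
    have "(\<integral>\<^sup>+y. ennreal (k1 x y) \<partial>?M) = (\<integral>\<^sup>+ y. ennreal (K x y) \<partial>lebesgue_on Omega)"
      by (rule nn_integral_lebesgue_on_eq[symmetric]) (use elim in \<open>auto elim!: eventually_mono\<close>)
    also have "\<dots> \<le> ennreal C" unfolding C(2)[symmetric] using elim by (intro SUP_upper)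
    finally show ?case by (simp add: G_def)
  qed
  \<comment> \<open>Requiring both coordinates to lie in \<open>G\<close> keeps the symmetry, and
    shrinking a nonnegative kernel cannot increase its row integrals.\<close>
  define K' where "K' x y = (if x \<in> G \<and> y \<in> G then k1 x y else 0)" for x y
  have "kernel_space ?M K' C"
  proof
    show "(\<lambda>(x, y). K' x y) \<in> borel_measurable (?M \<Otimes>\<^sub>M ?M)"
    proof -
      have "(\<lambda>(x, y). K' x y) \<in> borel_measurable (borel \<Otimes>\<^sub>M borel)" unfolding K'_def by measurable
      then show ?thesis by (simp cong: measurable_cong_sets)
    qed
    show "0 \<le> K' x y" "K' x y = K' y x" for x y by (auto simp: K'_def k1_def add.commute)
    show "(\<integral>\<^sup>+y. ennreal (K' x y) \<partial>?M) \<le> ennreal C" for x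
    proof (cases "x \<in> G")
      case True
      have "(\<integral>\<^sup>+y. ennreal (K' x y) \<partial>?M) \<le> (\<integral>\<^sup>+y. ennreal (k1 x y) \<partial>?M)"
        by (rule nn_integral_mono) (simp add: K'_def k1_def)
      also have "\<dots> \<le> ennreal C" using True by (simp add: G_def)
      finally show ?thesis .
    qed (simp add: K'_def)
  qed (use C in auto)
  moreover have "AE z in ?M \<Otimes>\<^sub>M ?M. K (fst z) (snd z) = K' (fst z) (snd z)"
    using k1 M.AE_fst_snd[OF AE_G] by eventually_elim (simp add: K'_def)
  ultimately show thesis by (rule that)
qed

lemma subdiff_abs_bounded: "w \<in> subdiff_abs a \<Longrightarrow> \<bar>w\<bar> \<le> 1"
  by (auto simp: subdiff_abs_def split: if_splits)

text \<open>An element of the subdifferential attains \<open>a * v = \<bar>a\<bar>\<close>, while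
  any number of modulus at most 1 gives at most \<open>\<bar>a\<bar>\<close>; expanding the product
  combines the two.\<close>

lemma subdiff_abs_monotone:
  assumes "v \<in> subdiff_abs a" "w \<in> subdiff_abs b"
  shows "0 \<le> (a - b) * (v - w)"
proof -
  have *: "a * v = \<bar>a\<bar>" "b * w = \<bar>b\<bar>"
    using assms by (auto simp: subdiff_abs_def split: if_splits)
  have "a * w \<le> \<bar>a\<bar>" "b * v \<le> \<bar>b\<bar>"
    using subdiff_abs_bounded[OF assms(1)] subdiff_abs_bounded[OF assms(2)]
      abs_ge_self[of "a * w"] abs_ge_self[of "b * v"]
      mult_left_le[of "\<bar>w\<bar>" "\<bar>a\<bar>"] mult_left_le[of "\<bar>v\<bar>" "\<bar>b\<bar>"]
    by (auto simp: abs_mult)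
  then show ?thesis using * by (simp add: algebra_simps)
qed

lemma one_laplacian_representative:
  fixes K :: "real^'d \<Rightarrow> real^'d \<Rightarrow> real"
  assumes lap: "one_laplacian K u \<eta>" and K': "kernel_space (borel_on Omega) K' C"
    and KK': "AE z in borel_on Omega \<Otimes>\<^sub>M borel_on Omega. K (fst z) (snd z) = K' (fst z) (snd z)"
  obtains w where "(\<lambda>(x, y). w x y) \<in> borel_measurable (borel_on Omega \<Otimes>\<^sub>M borel_on Omega)"
    "\<And>x y. \<bar>w x y\<bar> \<le> 1"
    "AE z in borel_on Omega \<Otimes>\<^sub>M borel_on Omega. w (fst z) (snd z) = - w (snd z) (fst z) \<and>
      w (fst z) (snd z) \<in> subdiff_abs (u (snd z) - u (fst z))"
    "AE x in borel_on Omega. \<eta> x = - (\<integral>y. K' x y * w x y \<partial>borel_on Omega)"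
proof -
  let ?M = "borel_on (Omega :: (real^'d) set)"
  interpret kernel_space ?M K' C by (rule K')
  have prod: "?M \<Otimes>\<^sub>M ?M = borel_on (Omega \<times> Omega)" by (rule borel_on_prod) (rule Omega_borel Omega_finite)+
  have Om2: "(Omega \<times> Omega :: ((real^'d) \<times> (real^'d)) set) \<in> sets borel" by (rule borel_Times) auto
  obtain w0 where w0: "(\<lambda>z. w0 (fst z) (snd z)) \<in> borel_measurable (lebesgue_on (Omega \<times> Omega))"
    and w0_props: "AE z in ?M \<Otimes>\<^sub>M ?M. \<bar>w0 (fst z) (snd z)\<bar> \<le> 1 \<and> w0 (fst z) (snd z) = - w0 (snd z) (fst z) \<and>
      w0 (fst z) (snd z) \<in> subdiff_abs (u (snd z) - u (fst z))"
    and \<eta>: "AE x in ?M. \<eta> x = - (\<integral>y. K x y * w0 x y \<partial>lebesgue_on Omega)"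
    using lap unfolding one_laplacian_def prod
    by (auto simp: AE_lebesgue_on_iff[OF Om2] AE_lebesgue_on_iff[OF Omega_borel])
  obtain w1 where w1: "w1 \<in> borel_measurable borel" "AE z in ?M \<Otimes>\<^sub>M ?M. w0 (fst z) (snd z) = w1 z"
    unfolding prod by (rule borel_representative[OF Om2 w0])
  have [measurable]: "w1 \<in> borel_measurable (borel \<Otimes>\<^sub>M borel)" using w1(1) by (simp only: borel_prod)
  \<comment> \<open>Clamping a Borel version gives the bound at every point and leaves it unchanged
    almost everywhere, since \<open>w0\<close> already obeys the bound there.\<close>
  define w where "w x y = max (-1) (min 1 (w1 (x, y)))" for x y
  have w_meas [measurable]: "(\<lambda>(x, y). w x y) \<in> borel_measurable (borel \<Otimes>\<^sub>M borel)"
    unfolding w_def by measurable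
  have ww0: "AE z in ?M \<Otimes>\<^sub>M ?M. w0 (fst z) (snd z) = w (fst z) (snd z)"
    using w0_props w1(2) by eventually_elim (auto simp: w_def abs_le_iff)
  show thesis
  proof (rule that[of w])
    show "(\<lambda>(x, y). w x y) \<in> borel_measurable (?M \<Otimes>\<^sub>M ?M)"
      using w_meas by (simp cong: measurable_cong_sets)
    show "\<bar>w x y\<bar> \<le> 1" for x y by (auto simp: w_def)
    show "AE z in ?M \<Otimes>\<^sub>M ?M. w (fst z) (snd z) = - w (snd z) (fst z) \<and>
      w (fst z) (snd z) \<in> subdiff_abs (u (snd z) - u (fst z))"
      using w0_props ww0 P.AE_pair_swap[OF ww0] by eventually_elim auto
    show "AE x in ?M. \<eta> x = - (\<integral>y. K' x y * w x y \<partial>?M)"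
      using \<eta> P.AE_pair[OF ww0] P.AE_pair[OF KK']
    proof eventually_elim
      case (elim x)
      have ae: "AE y in ?M. K x y * w0 x y = K' x y * w x y"
        using elim(2,3) by eventually_elim simp
      have "(\<lambda>y. K' x y * w x y) \<in> borel_measurable ?M" by measurable
      then have m: "(\<lambda>y. K' x y * w x y) \<in> borel_measurable borel" by (simp cong: measurable_cong_sets)
      show ?case using elim(1) integral_lebesgue_on_eq[OF Omega_borel m ae] by simp
    qed
  qed
qed

subsection \<open>Uniqueness\<close>

lemma sets_pair_borel_on: "sets (borel_on S \<Otimes>\<^sub>M borel_on S') = sets (borel \<Otimes>\<^sub>M borel)"
  by (auto intro!: sets_pair_measure_cong)

text \<open>It recovers the value at every single time from a weak derivative, L^1 continuity and
  the initial trace. \<open>D\<close> carries the meaningful time slices, while the Borel function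
  \<open>D'\<close>, equal to it almost everywhere on the product, is used for Fubini.\<close>

lemma weak_derivative_trace:
  fixes D D' V :: "real^'d \<Rightarrow> real \<Rightarrow> real"
  assumes T: "0 < T"
    and V [measurable]: "(\<lambda>(x, s). V x s) \<in> borel_measurable (borel \<Otimes>\<^sub>M borel)"
    and V_int: "integrable (borel_on Omega \<Otimes>\<^sub>M borel_on {0..T}) (\<lambda>(x, s). V x s)"
    and D' [measurable]: "(\<lambda>(x, s). D' x s) \<in> borel_measurable (borel \<Otimes>\<^sub>M borel)"
    and D'_int: "integrable (borel_on Omega \<Otimes>\<^sub>M borel_on {0..T}) (\<lambda>(x, s). D' x s)"
    and DD': "AE z in borel_on Omega \<Otimes>\<^sub>M borel_on {0..T}. D (fst z) (snd z) = D' (fst z) (snd z)"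
    and D_int: "\<And>t. t \<in> {0..T} \<Longrightarrow> integrable (lebesgue_on Omega) (\<lambda>x. D x t)"
    and D_cont: "\<And>t. t \<in> {0..T} \<Longrightarrow>
      ((\<lambda>s. \<integral>x. \<bar>D x s - D x t\<bar> \<partial>lebesgue_on Omega) \<longlongrightarrow> 0) (at t within {0..T})"
    and D0: "AE x in borel_on Omega. D x 0 = 0"
    and weak: "\<And>\<phi>. test_fun T \<phi> \<Longrightarrow> AE x in borel_on Omega.
      (\<integral>t. D' x t * deriv \<phi> t \<partial>borel_on {0..T}) = - (\<integral>t. V x t * \<phi> t \<partial>borel_on {0..T})"
    and t: "t \<in> {0..T}"
  shows "AE x in borel_on Omega. D x t = cum T (V x) t"
proof -
  let ?M = "borel_on (Omega :: (real^'d) set)" and ?I = "borel_on {0..T}"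
  let ?L = "lebesgue_on (Omega :: (real^'d) set)"
  interpret M: finite_measure ?M by (rule finite_measure_Omega)
  interpret I: finite_measure ?I by (rule finite_measure_Icc)
  interpret MI: pair_sigma_finite ?M ?I ..
  interpret IM: pair_sigma_finite ?I ?M ..
  define E where "E x t = cum T (V x) t" for x t
  have V_M: "(\<lambda>(x, s). V x s) \<in> borel_measurable (?M \<Otimes>\<^sub>M borel)"
    using V by (simp cong: measurable_cong_sets)
  have E_meas [measurable]: "(\<lambda>(x, t). E x t) \<in> borel_measurable (borel \<Otimes>\<^sub>M borel)"
  proof -
    have "(\<lambda>p. cum T (V (fst p)) (snd p)) \<in> borel_measurable (borel \<Otimes>\<^sub>M borel)"
      by (rule borel_measurable_cum) measurable
    then show ?thesis by (simp add: E_def case_prod_beta')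
  qed
  have E_pair: "integrable (?M \<Otimes>\<^sub>M ?I) (\<lambda>(x, t). E x t)"
    unfolding E_def by (rule M.integrable_pair_cum(1)[OF V_M V_int])
  have E_M: "integrable ?M (\<lambda>x. E x t)" for t
    unfolding E_def by (rule M.integrable_pair_cum(2)[OF V_M V_int])
  have E_L: "integrable ?L (\<lambda>x. E x t)" for t
    by (subst integrable_lebesgue_on_iff[where f' = "\<lambda>x. E x t"]) (auto intro: E_M)
  \<comment> \<open>Pairing with a bounded function of \<open>x\<close> reduces the claim to continuous functions of time.\<close>
  have G_const: "(\<integral>x. (D x t - E x t) * \<psi> x \<partial>?L) = 0"
    if \<psi> [measurable]: "\<psi> \<in> borel_measurable borel" and \<psi>1: "\<And>x. \<bar>\<psi> x\<bar> \<le> 1" for \<psi>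
  proof -
    have \<psi>L [measurable]: "\<psi> \<in> borel_measurable ?L"
      by (rule borel_measurable_lebesgue_onI[of _ \<psi>]) auto
    have mult_int: "integrable ?L (\<lambda>x. f x * \<psi> x)" if "integrable ?L f" for f
      by (rule Bochner_Integration.integrable_bound[OF that])
        (use that \<psi>1 in \<open>auto simp: abs_mult intro!: mult_left_le\<close>)
    define G where "G t = (\<integral>x. (D x t - E x t) * \<psi> x \<partial>?L)" for t
    have G_diff: "\<bar>G s - G r\<bar> \<le> (\<integral>x. \<bar>D x s - D x r\<bar> \<partial>?L) + (\<integral>x. \<bar>E x s - E x r\<bar> \<partial>?M)"
      if "s \<in> {0..T}" "r \<in> {0..T}" for s r
    proof -
      note ints = D_int[OF that(1)] D_int[OF that(2)] E_L[of s] E_L[of r]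
      have "G s - G r = (\<integral>x. (D x s - E x s) * \<psi> x - (D x r - E x r) * \<psi> x \<partial>?L)"
        unfolding G_def using ints
        by (intro Bochner_Integration.integral_diff[symmetric] mult_int Bochner_Integration.integrable_diff)
      also have "\<dots> = (\<integral>x. ((D x s - D x r) - (E x s - E x r)) * \<psi> x \<partial>?L)"
        by (intro Bochner_Integration.integral_cong) (auto simp: algebra_simps)
      also have "\<bar>\<dots>\<bar> \<le> (\<integral>x. \<bar>((D x s - D x r) - (E x s - E x r)) * \<psi> x\<bar> \<partial>?L)"
        by (rule integral_abs_bound)
      also have "\<dots> \<le> (\<integral>x. \<bar>D x s - D x r\<bar> + \<bar>E x s - E x r\<bar> \<partial>?L)"
      proof (rule integral_mono)
        show "integrable ?L (\<lambda>x. \<bar>((D x s - D x r) - (E x s - E x r)) * \<psi> x\<bar>)"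
          using ints by (intro integrable_abs mult_int Bochner_Integration.integrable_diff)
        show "integrable ?L (\<lambda>x. \<bar>D x s - D x r\<bar> + \<bar>E x s - E x r\<bar>)"
          using ints by (intro integrable_abs Bochner_Integration.integrable_diff
              Bochner_Integration.integrable_add)
        fix x
        have "\<bar>((D x s - D x r) - (E x s - E x r)) * \<psi> x\<bar> \<le> \<bar>(D x s - D x r) - (E x s - E x r)\<bar>"
          unfolding abs_mult using \<psi>1[of x] by (intro mult_left_le) auto
        then show "\<bar>((D x s - D x r) - (E x s - E x r)) * \<psi> x\<bar> \<le> \<bar>D x s - D x r\<bar> + \<bar>E x s - E x r\<bar>"
          by linarith
      qed
      also have "\<dots> = (\<integral>x. \<bar>D x s - D x r\<bar> \<partial>?L) + (\<integral>x. \<bar>E x s - E x r\<bar> \<partial>?L)"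
        using ints by (intro Bochner_Integration.integral_add integrable_abs Bochner_Integration.integrable_diff)
      also have "(\<integral>x. \<bar>E x s - E x r\<bar> \<partial>?L) = (\<integral>x. \<bar>E x s - E x r\<bar> \<partial>?M)"
        by (rule integral_lebesgue_on_eq) auto
      finally show ?thesis .
    qed
    have G_cont: "continuous_on {0..T} G"
      unfolding continuous_on_def
    proof
      fix r assume r: "r \<in> {0..T}"
      have "((\<lambda>s. (\<integral>x. \<bar>D x s - D x r\<bar> \<partial>?L) + (\<integral>x. \<bar>E x s - E x r\<bar> \<partial>?M)) \<longlongrightarrow> 0 + 0) (at r within {0..T})"
        unfolding E_def by (intro tendsto_add D_cont r M.cum_L1_continuous[OF V_M V_int])
      then have lim0: "((\<lambda>s. (\<integral>x. \<bar>D x s - D x r\<bar> \<partial>?L) + (\<integral>x. \<bar>E x s - E x r\<bar> \<partial>?M)) \<longlongrightarrow> 0) (at r within {0..T})"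
        by simp
      have "((\<lambda>s. G s - G r) \<longlongrightarrow> 0) (at r within {0..T})"
      proof (rule Lim_null_comparison[OF _ lim0])
        have "\<forall>\<^sub>F s in at r within {0..T}. s \<in> {0..T}" by (simp add: eventually_at_filter)
        then show "\<forall>\<^sub>F s in at r within {0..T}. norm (G s - G r)
            \<le> (\<integral>x. \<bar>D x s - D x r\<bar> \<partial>?L) + (\<integral>x. \<bar>E x s - E x r\<bar> \<partial>?M)"
          by eventually_elim (use G_diff r in auto)
      qed
      then show "(G \<longlongrightarrow> G r) (at r within {0..T})" by (simp add: Lim_null[of G])
    qed
    have G_weak: "(\<integral>t. indicator {0..T} t * (G t * deriv \<phi> t) \<partial>lborel) = 0" if \<phi>: "test_fun T \<phi>" for \<phi>
    proof -
      note [measurable] = test_fun_measurable[OF \<phi>]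
      obtain B where B: "\<And>t. \<bar>deriv \<phi> t\<bar> \<le> B" "\<And>t. \<bar>\<phi> t\<bar> \<le> B"
        using test_fun_deriv_bounded[OF \<phi>] by blast
      define W where "W x t = (D' x t - E x t) * \<psi> x * deriv \<phi> t" for x t
      have W_int: "integrable (?M \<Otimes>\<^sub>M ?I) (\<lambda>(x, t). W x t)"
      proof (rule Bochner_Integration.integrable_bound)
        show "integrable (?M \<Otimes>\<^sub>M ?I) (\<lambda>z. B * ((case z of (x, t) \<Rightarrow> D' x t) - (case z of (x, t) \<Rightarrow> E x t)))"
          by (intro integrable_mult_right Bochner_Integration.integrable_diff D'_int E_pair)
        have "(\<lambda>(x, t). W x t) \<in> borel_measurable (borel \<Otimes>\<^sub>M borel)" unfolding W_def by measurable
        then show "(\<lambda>(x, t). W x t) \<in> borel_measurable (?M \<Otimes>\<^sub>M ?I)"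
          by (simp add: measurable_cong_sets[OF sets_pair_borel_on refl])
        show "AE z in ?M \<Otimes>\<^sub>M ?I. norm (case z of (x, t) \<Rightarrow> W x t)
            \<le> norm (B * ((case z of (x, t) \<Rightarrow> D' x t) - (case z of (x, t) \<Rightarrow> E x t)))"
        proof (rule AE_I2)
          fix z :: "(real^'d) \<times> real"
          obtain x t where z: "z = (x, t)" by (cases z)
          have "\<bar>\<psi> x\<bar> * \<bar>deriv \<phi> t\<bar> \<le> 1 * \<bar>B\<bar>"
            using \<psi>1[of x] B(1)[of t] by (intro mult_mono) auto
          then have "\<bar>D' x t - E x t\<bar> * (\<bar>\<psi> x\<bar> * \<bar>deriv \<phi> t\<bar>) \<le> \<bar>D' x t - E x t\<bar> * \<bar>B\<bar>"
            by (intro mult_left_mono) auto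
          then show "norm (case z of (x, t) \<Rightarrow> W x t)
              \<le> norm (B * ((case z of (x, t) \<Rightarrow> D' x t) - (case z of (x, t) \<Rightarrow> E x t)))"
            by (simp add: z W_def abs_mult mult_ac)
        qed
      qed
      \<comment> \<open>\<open>D\<close> and \<open>D'\<close> agree on almost every time slice
        only, which is enough under a time integral; the continuity of \<open>G\<close> was shown
        with \<open>D\<close> itself.\<close>
      have G_AE: "AE t in ?I. G t * deriv \<phi> t = (\<integral>x. W x t \<partial>?M)"
        using IM.AE_pair[OF MI.AE_pair_swap[OF DD']]
      proof eventually_elim
        case (elim t)
        have "G t = (\<integral>x. (D' x t - E x t) * \<psi> x \<partial>?M)"
          unfolding G_def
        proof (rule integral_lebesgue_on_eq)
          show "AE x in ?M. (D x t - E x t) * \<psi> x = (D' x t - E x t) * \<psi> x"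
            using elim by eventually_elim simp
        qed auto
        then show ?case by (simp add: W_def)
      qed
      have "(\<integral>t. indicator {0..T} t * (G t * deriv \<phi> t) \<partial>lborel)
          = (\<integral>t. indicator {0..T} t * (\<integral>x. W x t \<partial>?M) \<partial>lborel)"
      proof (rule integral_cong_AE)
        have "(\<lambda>t. indicator {0..T} t *\<^sub>R G t) \<in> borel_measurable borel"
          by (rule borel_measurable_continuous_on_indicator[OF _ G_cont]) auto
        then have "(\<lambda>t. (indicator {0..T} t * G t) * deriv \<phi> t) \<in> borel_measurable lborel" by simp
        then show "(\<lambda>t. indicator {0..T} t * (G t * deriv \<phi> t)) \<in> borel_measurable lborel"
          by (simp add: mult.assoc)
        have "(\<lambda>t. \<integral>x. W x t \<partial>?M) \<in> borel_measurable ?I"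
          by (rule borel_measurable_integrable[OF MI.integrable_snd[OF W_int]])
        then have [measurable]: "(\<lambda>t. \<integral>x. W x t \<partial>?M) \<in> borel_measurable borel"
          by (simp cong: measurable_cong_sets)
        show "(\<lambda>t. indicator {0..T} t * (\<integral>x. W x t \<partial>?M)) \<in> borel_measurable lborel" by measurable
        show "AE t in lborel. indicator {0..T} t * (G t * deriv \<phi> t) = indicator {0..T} t * (\<integral>x. W x t \<partial>?M)"
          using G_AE by (subst (asm) AE_borel_on) (auto simp: indicator_def elim!: eventually_mono)
      qed
      also have "\<dots> = (\<integral>t. \<integral>x. W x t \<partial>?M \<partial>?I)"
        using borel_measurable_integrable[OF MI.integrable_snd[OF W_int]]
        by (intro integral_borel_on[symmetric]) (auto cong: measurable_cong_sets)
      also have "\<dots> = (\<integral>x. \<integral>t. W x t \<partial>?I \<partial>?M)"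
        by (rule MI.Fubini_integral[OF W_int])
      also have "\<dots> = 0"
      proof (rule integral_eq_zero_AE)
        have "AE x in ?M. integrable ?I (V x)" "AE x in ?M. integrable ?I (D' x)" "AE x in ?M. integrable ?I (E x)"
          using MI.AE_integrable_fst'[OF V_int] MI.AE_integrable_fst'[OF D'_int] MI.AE_integrable_fst'[OF E_pair]
          by simp_all
        with weak[OF \<phi>] show "AE x in ?M. (\<integral>t. W x t \<partial>?I) = 0"
        proof eventually_elim
          case (elim x)
          have mint: "integrable ?I (\<lambda>t. H t * deriv \<phi> t)" if "integrable ?I H" for H
          proof (rule Bochner_Integration.integrable_bound[of _ "\<lambda>t. H t * B"])
            show "AE t in ?I. norm (H t * deriv \<phi> t) \<le> norm (H t * B)"
              using B(1) by (auto simp: abs_mult intro!: mult_left_mono order_trans[OF B(1) abs_ge_self])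
            show "(\<lambda>t. H t * deriv \<phi> t) \<in> borel_measurable ?I"
              using borel_measurable_integrable[OF that] by measurable
          qed (use that in simp)
          have "(\<integral>t. W x t \<partial>?I) = (\<integral>t. \<psi> x * (D' x t * deriv \<phi> t - E x t * deriv \<phi> t) \<partial>?I)"
            unfolding W_def by (intro Bochner_Integration.integral_cong) (auto simp: algebra_simps)
          also have "\<dots> = \<psi> x * ((\<integral>t. D' x t * deriv \<phi> t \<partial>?I) - (\<integral>t. E x t * deriv \<phi> t \<partial>?I))"
            using mint[OF elim(3)] mint[OF elim(4)] by simp
          also have "\<dots> = 0"
            using elim(1) cum_weak_derivative[OF \<phi> elim(2), of 0] by (simp add: E_def)
          finally show ?case .
        qed
      qed
      finally show ?thesis .
    qed
    have "G t = G 0" using T t by (intro du_Bois_Reymond_continuous[OF G_cont T G_weak]) auto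
    also have "G 0 = 0"
    proof -
      have "AE x in ?L. (D x 0 - E x 0) * \<psi> x = 0"
        using D0 unfolding AE_lebesgue_on_iff[OF Omega_borel]
        by eventually_elim (simp add: E_def cum_nonpos)
      then show ?thesis unfolding G_def by (rule integral_eq_zero_AE)
    qed
    finally show ?thesis by (simp add: G_def)
  qed
  have "integrable ?L (\<lambda>x. D x t - E x t)" using D_int[OF t] E_L by simp
  then obtain q where q [measurable]: "q \<in> borel_measurable borel" and
    Dq: "AE x in ?M. D x t - E x t = q x" and q_int: "integrable ?M q"
    using integrable_borel_representative[OF Omega_borel] by blast
  \<comment> \<open>The sign of the difference at the given time is a bounded Borel function of
    \<open>x\<close>; pairing with it produces the L^1 norm.\<close>
  have "0 = (\<integral>x. (D x t - E x t) * sgn (q x) \<partial>?L)"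
    by (rule G_const[symmetric]) (auto simp: sgn_real_def)
  also have "\<dots> = (\<integral>x. \<bar>q x\<bar> \<partial>?M)"
  proof (rule integral_lebesgue_on_eq)
    show "AE x in ?M. (D x t - E x t) * sgn (q x) = \<bar>q x\<bar>"
      using Dq by eventually_elim (simp add: abs_sgn[symmetric])
  qed auto
  finally have "AE x in ?M. \<bar>q x\<bar> = 0"
    using q_int by (subst integral_nonneg_eq_0_iff_AE[symmetric]) auto
  with Dq show ?thesis by eventually_elim (simp add: E_def)
qed

lemma borel_on_Omega_Ioo:
  "borel_on (Omega :: (real^'d) set) \<Otimes>\<^sub>M borel_on {0..T} = borel_on (Omega \<times> {0<..<T})"
  "Omega \<times> {0<..<T} \<in> sets (borel :: ((real^'d) \<times> real) measure)"
proof -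
  have "emeasure lborel {0<..<T} < \<infinity>"
    by (rule emeasure_bounded_finite[OF bounded_subset[of "{0..T}"]]) auto
  then show "borel_on (Omega :: (real^'d) set) \<Otimes>\<^sub>M borel_on {0..T} = borel_on (Omega \<times> {0<..<T})"
    unfolding borel_on_Icc_Ioo by (intro borel_on_prod Omega_borel borel_open[OF open_greaterThanLessThan])
qed (intro borel_Times Omega_borel borel_open[OF open_greaterThanLessThan])

lemma weak_time_deriv_representative:
  fixes u v :: "real^'d \<Rightarrow> real \<Rightarrow> real"
  assumes "weak_time_deriv T u v"
  obtains u' v' where
    "(\<lambda>(x, s). u' x s) \<in> borel_measurable (borel \<Otimes>\<^sub>M borel)"
    "integrable (borel_on Omega \<Otimes>\<^sub>M borel_on {0..T}) (\<lambda>(x, s). u' x s)"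
    "AE z in borel_on Omega \<Otimes>\<^sub>M borel_on {0..T}. u (fst z) (snd z) = u' (fst z) (snd z)"
    "(\<lambda>(x, s). v' x s) \<in> borel_measurable (borel \<Otimes>\<^sub>M borel)"
    "integrable (borel_on Omega \<Otimes>\<^sub>M borel_on {0..T}) (\<lambda>(x, s). v' x s)"
    "AE z in borel_on Omega \<Otimes>\<^sub>M borel_on {0..T}. v (fst z) (snd z) = v' (fst z) (snd z)"
    "\<And>\<phi>. test_fun T \<phi> \<Longrightarrow> AE x in borel_on Omega.
      (\<integral>t. u' x t * deriv \<phi> t \<partial>borel_on {0..T}) = - (\<integral>t. v' x t * \<phi> t \<partial>borel_on {0..T})"
proof -
  let ?M = "borel_on (Omega :: (real^'d) set)" and ?I = "borel_on {0..T}"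
  interpret M: finite_measure ?M by (rule finite_measure_Omega)
  interpret I: finite_measure ?I by (rule finite_measure_Icc)
  interpret MI: pair_sigma_finite ?M ?I ..
  note S = borel_on_Omega_Ioo(2)[where T = T and 'd = 'd]
  have ints: "integrable (lebesgue_on (Omega \<times> {0<..<T})) (\<lambda>z. u (fst z) (snd z))"
    "integrable (lebesgue_on (Omega \<times> {0<..<T})) (\<lambda>z. v (fst z) (snd z))"
    and weak: "\<And>\<phi>. test_fun T \<phi> \<Longrightarrow> AE x in ?M. (\<integral>t. u x t * deriv \<phi> t \<partial>lebesgue_on {0<..<T})
             = - (\<integral>t. v x t * \<phi> t \<partial>lebesgue_on {0<..<T})"
    using assms by (auto simp: weak_time_deriv_def AE_lebesgue_on_iff)
  obtain U where U: "U \<in> borel_measurable borel" "AE z in ?M \<Otimes>\<^sub>M ?I. u (fst z) (snd z) = U z"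
    "integrable (?M \<Otimes>\<^sub>M ?I) U"
    unfolding borel_on_Omega_Ioo by (rule integrable_borel_representative[OF S ints(1)])
  obtain W where W: "W \<in> borel_measurable borel" "AE z in ?M \<Otimes>\<^sub>M ?I. v (fst z) (snd z) = W z"
    "integrable (?M \<Otimes>\<^sub>M ?I) W"
    unfolding borel_on_Omega_Ioo by (rule integrable_borel_representative[OF S ints(2)])
  have [measurable]: "U \<in> borel_measurable (borel \<Otimes>\<^sub>M borel)" "W \<in> borel_measurable (borel \<Otimes>\<^sub>M borel)"
    using U(1) W(1) by (simp_all only: borel_prod)
  show thesis
  proof (rule that[of "\<lambda>x s. U (x, s)" "\<lambda>x s. W (x, s)"])
    fix \<phi> assume \<phi>: "test_fun T \<phi>"
    note [measurable] = test_fun_measurable[OF \<phi>]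
    show "AE x in ?M. (\<integral>t. U (x, t) * deriv \<phi> t \<partial>?I) = - (\<integral>t. W (x, t) * \<phi> t \<partial>?I)"
      using weak[OF \<phi>] MI.AE_pair[OF U(2)] MI.AE_pair[OF W(2)]
    proof eventually_elim
      case (elim x)
      have "(\<integral>t. u x t * deriv \<phi> t \<partial>lebesgue_on {0<..<T}) = (\<integral>t. U (x, t) * deriv \<phi> t \<partial>?I)"
        unfolding borel_on_Icc_Ioo
      proof (rule integral_lebesgue_on_eq)
        show "AE t in borel_on {0<..<T}. u x t * deriv \<phi> t = U (x, t) * deriv \<phi> t"
          using elim(2) unfolding borel_on_Icc_Ioo by eventually_elim simp
      qed auto
      moreover have "(\<integral>t. v x t * \<phi> t \<partial>lebesgue_on {0<..<T}) = (\<integral>t. W (x, t) * \<phi> t \<partial>?I)"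
        unfolding borel_on_Icc_Ioo
      proof (rule integral_lebesgue_on_eq)
        show "AE t in borel_on {0<..<T}. v x t * \<phi> t = W (x, t) * \<phi> t"
          using elim(3) unfolding borel_on_Icc_Ioo by eventually_elim simp
      qed auto
      ultimately show ?case using elim(1) by simp
    qed
  qed (use U(2,3) W(2,3) in simp_all)
qed

text \<open>Since the equation reads \<open>-\<eta> + f\<close>, the source cancels in the
  difference of two solutions, whose time derivative is \<open>\<eta>2 - \<eta>1\<close>.
  Monotonicity of the subdifferential is the error-free case of
  \<open>kernel_almost_dissipative\<close>.\<close>

lemma one_laplacian_dissipative:
  fixes K :: "real^'d \<Rightarrow> real^'d \<Rightarrow> real"
  assumes lap: "one_laplacian K u1 \<eta>1" "one_laplacian K u2 \<eta>2"
    and K': "kernel_space (borel_on Omega) K' C"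
    and KK': "AE z in borel_on Omega \<Otimes>\<^sub>M borel_on Omega. K (fst z) (snd z) = K' (fst z) (snd z)"
    and d: "integrable (borel_on Omega) d" "AE x in borel_on Omega. u1 x - u2 x = d x"
    and e [measurable]: "e \<in> borel_measurable borel" and ae_e: "AE x in borel_on Omega. e x = \<eta>2 x - \<eta>1 x"
  shows "(\<integral>x. e x * d x \<partial>borel_on Omega) \<le> 0" "AE x in borel_on Omega. \<bar>e x\<bar> \<le> 2 * C"
proof -
  let ?M = "borel_on (Omega :: (real^'d) set)"
  interpret kernel_space ?M K' C by (rule K')
  obtain w1 where w1: "(\<lambda>(x, y). w1 x y) \<in> borel_measurable (?M \<Otimes>\<^sub>M ?M)" "\<And>x y. \<bar>w1 x y\<bar> \<le> 1"
    "AE z in ?M \<Otimes>\<^sub>M ?M. w1 (fst z) (snd z) = - w1 (snd z) (fst z) \<and>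
      w1 (fst z) (snd z) \<in> subdiff_abs (u1 (snd z) - u1 (fst z))"
    "AE x in ?M. \<eta>1 x = - (\<integral>y. K' x y * w1 x y \<partial>?M)"
    by (rule one_laplacian_representative[OF lap(1) K' KK'], rule that)
  obtain w2 where w2: "(\<lambda>(x, y). w2 x y) \<in> borel_measurable (?M \<Otimes>\<^sub>M ?M)" "\<And>x y. \<bar>w2 x y\<bar> \<le> 1"
    "AE z in ?M \<Otimes>\<^sub>M ?M. w2 (fst z) (snd z) = - w2 (snd z) (fst z) \<and>
      w2 (fst z) (snd z) \<in> subdiff_abs (u2 (snd z) - u2 (fst z))"
    "AE x in ?M. \<eta>2 x = - (\<integral>y. K' x y * w2 x y \<partial>?M)"
    by (rule one_laplacian_representative[OF lap(2) K' KK'], rule that)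
  note [measurable] = w1(1) w2(1)
  define \<omega> where "\<omega> x y = w1 x y - w2 x y" for x y
  have [measurable]: "(\<lambda>(x, y). \<omega> x y) \<in> borel_measurable (?M \<Otimes>\<^sub>M ?M)" unfolding \<omega>_def by measurable
  have \<omega>2: "\<bar>\<omega> x y\<bar> \<le> 2" for x y using w1(2)[of x y] w2(2)[of x y] by (simp add: \<omega>_def)
  have e_eq: "AE x in ?M. e x = (\<integral>y. K' x y * \<omega> x y \<partial>?M)"
    using ae_e w1(4) w2(4)
  proof eventually_elim
    case (elim x)
    have "integrable ?M (\<lambda>y. K' x y * w1 x y)" "integrable ?M (\<lambda>y. K' x y * w2 x y)"
      by (rule K_mult_integrable[where c = 1]; use w1(2) w2(2) in simp)+
    then show ?case using elim by (simp add: \<omega>_def right_diff_distrib)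
  qed
  show "AE x in ?M. \<bar>e x\<bar> \<le> 2 * C"
    using e_eq
  proof eventually_elim
    case (elim x)
    have "\<bar>\<integral>y. K' x y * \<omega> x y \<partial>?M\<bar> \<le> C * 2" by (rule K_mult_integral_le) (use \<omega>2 in auto)
    then show ?case using elim by simp
  qed
  have [measurable]: "d \<in> borel_measurable ?M" using d(1) by auto
  have "(\<integral>x. e x * d x \<partial>?M) = (\<integral>x. d x * (\<integral>y. K' x y * \<omega> x y \<partial>?M) \<partial>?M)"
    using e_eq by (intro integral_cong_AE) (auto elim!: eventually_mono)
  also have "\<dots> \<le> 0 / 2 * (C * measure ?M UNIV)"
  proof (rule kernel_almost_dissipative[OF d(1) _ \<omega>2])
    show "AE z in ?M \<Otimes>\<^sub>M ?M. \<omega> (fst z) (snd z) = - \<omega> (snd z) (fst z)"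
      using w1(3) w2(3) by eventually_elim (simp add: \<omega>_def)
    show "AE z in ?M \<Otimes>\<^sub>M ?M. - 0 \<le> (d (snd z) - d (fst z)) * \<omega> (fst z) (snd z)"
      using w1(3) w2(3) AE_fst_snd[OF d(2)]
    proof eventually_elim
      case (elim z)
      have "0 \<le> ((u1 (snd z) - u1 (fst z)) - (u2 (snd z) - u2 (fst z))) * (w1 (fst z) (snd z) - w2 (fst z) (snd z))"
        using elim by (intro subdiff_abs_monotone) auto
      also have "(u1 (snd z) - u1 (fst z)) - (u2 (snd z) - u2 (fst z)) = d (snd z) - d (fst z)"
        using elim by simp
      finally show ?case by (simp add: \<omega>_def)
    qed
  qed auto
  finally show "(\<integral>x. e x * d x \<partial>?M) \<le> 0" by simp
qed

lemma solution_P1_unique: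
  fixes K :: "real^'d \<Rightarrow> real^'d \<Rightarrow> real"
  assumes T: "0 < T" and K: "H1 K" "H2 K" "H3 K"
    and sol: "solution_P1 K f g T u1" "solution_P1 K f g T u2" and t: "t \<in> {0..T}"
  shows "AE x in borel_on Omega. u1 x t = u2 x t"
proof -
  let ?M = "borel_on (Omega :: (real^'d) set)" and ?I = "borel_on {0..T}"
  let ?L = "lebesgue_on (Omega :: (real^'d) set)"
  obtain K' C where K': "kernel_space ?M K' C"
    and KK': "AE z in ?M \<Otimes>\<^sub>M ?M. K (fst z) (snd z) = K' (fst z) (snd z)"
    by (rule kernel_representative[OF K])
  interpret kernel_space ?M K' C by (rule K')
  interpret I: finite_measure ?I by (rule finite_measure_Icc)
  interpret MI: pair_sigma_finite ?M ?I ..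
  interpret IM: pair_sigma_finite ?I ?M ..
  have u_int: "integrable ?L (\<lambda>x. u1 x t)" "integrable ?L (\<lambda>x. u2 x t)" if "t \<in> {0..T}" for t
    using sol that unfolding solution_P1_def by auto
  have u_cont: "((\<lambda>s. \<integral>x. \<bar>u1 x s - u1 x t\<bar> \<partial>?L) \<longlongrightarrow> 0) (at t within {0..T})"
    "((\<lambda>s. \<integral>x. \<bar>u2 x s - u2 x t\<bar> \<partial>?L) \<longlongrightarrow> 0) (at t within {0..T})" if "t \<in> {0..T}" for t
    using sol that unfolding solution_P1_def by auto
  have u_0: "AE x in ?M. u1 x 0 = g x" "AE x in ?M. u2 x 0 = g x"
    using sol unfolding solution_P1_def AE_lebesgue_on_iff[OF Omega_borel] by auto
  obtain v1 \<eta>1 where 1: "weak_time_deriv T u1 v1"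
    "AE z in ?M \<Otimes>\<^sub>M ?I. v1 (fst z) (snd z) = - \<eta>1 (fst z) (snd z) + f (fst z) (snd z)"
    "AE t in ?I. one_laplacian K (\<lambda>x. u1 x t) (\<lambda>x. \<eta>1 x t)"
    using sol(1) unfolding solution_P1_def AE_lebesgue_on_iff[OF borel_on_Omega_Ioo(2)]
      AE_lebesgue_on_iff[OF borel_open[OF open_greaterThanLessThan]] borel_on_Omega_Ioo(1)[symmetric]
      borel_on_Icc_Ioo[symmetric] by blast
  obtain v2 \<eta>2 where 2: "weak_time_deriv T u2 v2"
    "AE z in ?M \<Otimes>\<^sub>M ?I. v2 (fst z) (snd z) = - \<eta>2 (fst z) (snd z) + f (fst z) (snd z)"
    "AE t in ?I. one_laplacian K (\<lambda>x. u2 x t) (\<lambda>x. \<eta>2 x t)"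
    using sol(2) unfolding solution_P1_def AE_lebesgue_on_iff[OF borel_on_Omega_Ioo(2)]
      AE_lebesgue_on_iff[OF borel_open[OF open_greaterThanLessThan]] borel_on_Omega_Ioo(1)[symmetric]
      borel_on_Icc_Ioo[symmetric] by blast
  obtain u1' v1' where r1:
    "(\<lambda>(x, s). u1' x s) \<in> borel_measurable (borel \<Otimes>\<^sub>M borel)"
    "integrable (?M \<Otimes>\<^sub>M ?I) (\<lambda>(x, s). u1' x s)"
    "AE z in ?M \<Otimes>\<^sub>M ?I. u1 (fst z) (snd z) = u1' (fst z) (snd z)"
    "(\<lambda>(x, s). v1' x s) \<in> borel_measurable (borel \<Otimes>\<^sub>M borel)"
    "integrable (?M \<Otimes>\<^sub>M ?I) (\<lambda>(x, s). v1' x s)"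
    "AE z in ?M \<Otimes>\<^sub>M ?I. v1 (fst z) (snd z) = v1' (fst z) (snd z)"
    "\<And>\<phi>. test_fun T \<phi> \<Longrightarrow> AE x in ?M.
      (\<integral>t. u1' x t * deriv \<phi> t \<partial>?I) = - (\<integral>t. v1' x t * \<phi> t \<partial>?I)"
    by (rule weak_time_deriv_representative[OF 1(1)], rule that)
  obtain u2' v2' where r2:
    "(\<lambda>(x, s). u2' x s) \<in> borel_measurable (borel \<Otimes>\<^sub>M borel)"
    "integrable (?M \<Otimes>\<^sub>M ?I) (\<lambda>(x, s). u2' x s)"
    "AE z in ?M \<Otimes>\<^sub>M ?I. u2 (fst z) (snd z) = u2' (fst z) (snd z)"
    "(\<lambda>(x, s). v2' x s) \<in> borel_measurable (borel \<Otimes>\<^sub>M borel)"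
    "integrable (?M \<Otimes>\<^sub>M ?I) (\<lambda>(x, s). v2' x s)"
    "AE z in ?M \<Otimes>\<^sub>M ?I. v2 (fst z) (snd z) = v2' (fst z) (snd z)"
    "\<And>\<phi>. test_fun T \<phi> \<Longrightarrow> AE x in ?M.
      (\<integral>t. u2' x t * deriv \<phi> t \<partial>?I) = - (\<integral>t. v2' x t * \<phi> t \<partial>?I)"
    by (rule weak_time_deriv_representative[OF 2(1)], rule that)
  note [measurable] = r1(1,4) r2(1,4)
  define V where "V x s = v1' x s - v2' x s" for x s
  define D' where "D' x s = u1' x s - u2' x s" for x s
  have V_meas [measurable]: "(\<lambda>(x, s). V x s) \<in> borel_measurable (borel \<Otimes>\<^sub>M borel)"
    and D'_meas: "(\<lambda>(x, s). D' x s) \<in> borel_measurable (borel \<Otimes>\<^sub>M borel)"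
    unfolding V_def D'_def by measurable
  have V_M: "(\<lambda>(x, s). V x s) \<in> borel_measurable (?M \<Otimes>\<^sub>M borel)"
    using V_meas by (simp cong: measurable_cong_sets)
  have V_int: "integrable (?M \<Otimes>\<^sub>M ?I) (\<lambda>(x, s). V x s)"
    using Bochner_Integration.integrable_diff[OF r1(5) r2(5)] by (simp add: V_def case_prod_beta')
  have D'_int: "integrable (?M \<Otimes>\<^sub>M ?I) (\<lambda>(x, s). D' x s)"
    using Bochner_Integration.integrable_diff[OF r1(2) r2(2)] by (simp add: D'_def case_prod_beta')
  define E where "E x t = cum T (V x) t" for x t
  have trace: "AE x in ?M. u1 x t - u2 x t = E x t" if t: "t \<in> {0..T}" for t
    unfolding E_def
  proof (rule weak_derivative_trace[OF T V_meas V_int D'_meas D'_int _ _ _ _ _ t])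
    show "AE z in ?M \<Otimes>\<^sub>M ?I. u1 (fst z) (snd z) - u2 (fst z) (snd z) = D' (fst z) (snd z)"
      using r1(3) r2(3) by eventually_elim (simp add: D'_def)
    show "integrable ?L (\<lambda>x. u1 x t - u2 x t)" if "t \<in> {0..T}" for t
      using u_int[OF that] by simp
    show "AE x in ?M. u1 x 0 - u2 x 0 = 0" using u_0 by eventually_elim simp
    show "((\<lambda>s. \<integral>x. \<bar>(u1 x s - u2 x s) - (u1 x r - u2 x r)\<bar> \<partial>?L) \<longlongrightarrow> 0) (at r within {0..T})"
      if r: "r \<in> {0..T}" for r
    proof (rule Lim_null_comparison)
      show "((\<lambda>s. (\<integral>x. \<bar>u1 x s - u1 x r\<bar> \<partial>?L) + (\<integral>x. \<bar>u2 x s - u2 x r\<bar> \<partial>?L)) \<longlongrightarrow> 0) (at r within {0..T})"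
        using tendsto_add[OF u_cont[OF r]] by simp
      have "\<forall>\<^sub>F s in at r within {0..T}. s \<in> {0..T}" by (simp add: eventually_at_filter)
      then show "\<forall>\<^sub>F s in at r within {0..T}. norm (\<integral>x. \<bar>(u1 x s - u2 x s) - (u1 x r - u2 x r)\<bar> \<partial>?L)
          \<le> (\<integral>x. \<bar>u1 x s - u1 x r\<bar> \<partial>?L) + (\<integral>x. \<bar>u2 x s - u2 x r\<bar> \<partial>?L)"
      proof eventually_elim
        case (elim s)
        note ints = u_int[OF elim] u_int[OF r]
        have "(\<integral>x. \<bar>(u1 x s - u2 x s) - (u1 x r - u2 x r)\<bar> \<partial>?L)
            \<le> (\<integral>x. \<bar>u1 x s - u1 x r\<bar> + \<bar>u2 x s - u2 x r\<bar> \<partial>?L)"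
          by (rule integral_mono) (use ints in auto)
        also have "\<dots> = (\<integral>x. \<bar>u1 x s - u1 x r\<bar> \<partial>?L) + (\<integral>x. \<bar>u2 x s - u2 x r\<bar> \<partial>?L)"
          using ints by (intro Bochner_Integration.integral_add integrable_abs Bochner_Integration.integrable_diff)
        finally show ?case by simp
      qed
    qed
    fix \<phi> assume \<phi>: "test_fun T \<phi>"
    note [measurable] = test_fun_measurable[OF \<phi>]
    obtain B where B: "\<And>t. \<bar>deriv \<phi> t\<bar> \<le> B" "\<And>t. \<bar>\<phi> t\<bar> \<le> B"
      using test_fun_deriv_bounded[OF \<phi>] by blast
    have mint: "integrable ?I (\<lambda>t. H t * \<theta> t)"
      if "integrable ?I H" "\<theta> \<in> borel_measurable borel" "\<And>t. \<bar>\<theta> t\<bar> \<le> B" for H \<theta> :: "real \<Rightarrow> real"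
    proof (rule Bochner_Integration.integrable_bound[of _ "\<lambda>t. H t * B"])
      show "AE t in ?I. norm (H t * \<theta> t) \<le> norm (H t * B)"
        by (auto simp: abs_mult intro!: mult_left_mono order_trans[OF that(3) abs_ge_self])
      show "(\<lambda>t. H t * \<theta> t) \<in> borel_measurable ?I"
        using borel_measurable_integrable[OF that(1)] that(2) by measurable
    qed (use that in simp)
    have "AE x in ?M. integrable ?I (u1' x)" "AE x in ?M. integrable ?I (u2' x)"
      "AE x in ?M. integrable ?I (v1' x)" "AE x in ?M. integrable ?I (v2' x)"
      using MI.AE_integrable_fst'[OF r1(2)] MI.AE_integrable_fst'[OF r2(2)]
        MI.AE_integrable_fst'[OF r1(5)] MI.AE_integrable_fst'[OF r2(5)] by simp_all
    with r1(7)[OF \<phi>] r2(7)[OF \<phi>]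
    show "AE x in ?M. (\<integral>t. D' x t * deriv \<phi> t \<partial>?I) = - (\<integral>t. V x t * \<phi> t \<partial>?I)"
    proof eventually_elim
      case (elim x)
      note ints = mint[OF elim(3) _ B(1)] mint[OF elim(4) _ B(1)] mint[OF elim(5) _ B(2)] mint[OF elim(6) _ B(2)]
      show ?case using elim(1,2) ints by (simp add: D'_def V_def left_diff_distrib)
    qed
  qed
  have "AE z in ?M \<Otimes>\<^sub>M ?I. V (fst z) (snd z) = \<eta>2 (fst z) (snd z) - \<eta>1 (fst z) (snd z)"
    using 1(2) 2(2) r1(6) r2(6) by eventually_elim (simp add: V_def)
  from IM.AE_pair[OF MI.AE_pair_swap[OF this]]
  have V_\<eta>: "AE t in ?I. AE x in ?M. V x t = \<eta>2 x t - \<eta>1 x t" by simp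
  have E_int: "integrable ?M (\<lambda>x. E x t)" for t
    unfolding E_def by (rule integrable_pair_cum(2)[OF V_M V_int])
  have "AE t in ?I. t \<in> {0..T}" by (rule AE_in_borel_on) simp
  with V_\<eta> 1(3) 2(3)
  have diss: "AE t in ?I. (\<integral>x. V x t * E x t \<partial>?M) \<le> 0 \<and> (AE x in ?M. \<bar>V x t\<bar> \<le> 2 * C)"
  proof eventually_elim
    case (elim t)
    have m: "(\<lambda>x. V x t) \<in> borel_measurable borel" by measurable
    show ?case
      using one_laplacian_dissipative[OF elim(2,3) K' KK' E_int trace[OF elim(4)] m elim(1)] by blast
  qed
  \<comment> \<open>The derivative is known to be bounded only almost everywhere, whereas the energy
    estimate wants a bound at every point; truncation at \<open>2 * C\<close> supplies it.\<close>
  define Vc where "Vc x s = max (- (2 * C)) (min (2 * C) (V x s))" for x s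
  have Vc_meas: "(\<lambda>(x, s). Vc x s) \<in> borel_measurable (borel \<Otimes>\<^sub>M borel)" unfolding Vc_def by measurable
  note [measurable] = Vc_meas
  have Vc_M: "(\<lambda>(x, s). Vc x s) \<in> borel_measurable (?M \<Otimes>\<^sub>M borel)"
    using Vc_meas by (simp cong: measurable_cong_sets)
  have Vc_bnd: "\<bar>Vc x s\<bar> \<le> 2 * C" for x s using C_nonneg by (auto simp: Vc_def)
  have V_Vc: "AE s in ?I. AE x in ?M. V x s = Vc x s"
    using diss
  proof eventually_elim
    case (elim s)
    then have "AE x in ?M. \<bar>V x s\<bar> \<le> 2 * C" by simp
    then show ?case by eventually_elim (auto simp: Vc_def)
  qed
  have "AE x in ?M. AE s in ?I. V x s = Vc x s"
  \<comment> \<open>Equality of the primitives needs equality at almost every time for a fixed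
    \<open>x\<close>, so the quantifiers are exchanged.\<close>
  proof (subst IM.AE_commute[symmetric])
    have "Measurable.pred (borel \<Otimes>\<^sub>M borel) (\<lambda>p. V (snd p) (fst p) = Vc (snd p) (fst p))" by measurable
    then have "Measurable.pred (?I \<Otimes>\<^sub>M ?M) (\<lambda>p. V (snd p) (fst p) = Vc (snd p) (fst p))"
      by (simp only: measurable_cong_sets[OF sets_pair_borel_on refl])
    then show "{p \<in> space (?I \<Otimes>\<^sub>M ?M). V (snd p) (fst p) = Vc (snd p) (fst p)} \<in> sets (?I \<Otimes>\<^sub>M ?M)"
      by (simp add: pred_def)
  qed (rule V_Vc)
  then have E_Vc: "AE x in ?M. \<forall>t. E x t = cum T (Vc x) t"
  proof eventually_elim
    case (elim x)
    show ?case unfolding E_def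
    proof
      fix t
      show "cum T (V x) t = cum T (Vc x) t"
        by (rule cum_cong_AE) (use elim in \<open>auto elim!: eventually_mono\<close>)
    qed
  qed
  have cumc_meas: "(\<lambda>x. cum T (Vc x) s) \<in> borel_measurable ?M" for s
    by (rule borel_measurable_cum[OF Vc_M]) simp
  have le: "AE s in ?I. (\<integral>x. Vc x s * cum T (Vc x) s \<partial>?M) \<le> 0"
    using diss V_Vc
  proof eventually_elim
    case (elim s)
    have "(\<integral>x. Vc x s * cum T (Vc x) s \<partial>?M) = (\<integral>x. V x s * E x s \<partial>?M)"
    proof (rule integral_cong_AE)
      show "(\<lambda>x. Vc x s * cum T (Vc x) s) \<in> borel_measurable ?M" using cumc_meas[of s] by measurable
      show "(\<lambda>x. V x s * E x s) \<in> borel_measurable ?M" using borel_measurable_integrable[OF E_int[of s]] by measurable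
      show "AE x in ?M. Vc x s * cum T (Vc x) s = V x s * E x s"
        using elim(2) E_Vc by eventually_elim simp
    qed
    then show ?case using elim(1) by simp
  qed
  \<comment> \<open>The energy estimate with \<open>B = 0\<close>: the squared norm of the
    difference is at most 0.\<close>
  note sq = cum_square_integral_le[OF Vc_M Vc_bnd less_imp_le[OF T] order_refl le, of t]
  have "(\<integral>x. (cum T (Vc x) t)\<^sup>2 \<partial>?M) = 0"
    using sq(2) by (intro antisym) auto
  then have "AE x in ?M. (cum T (Vc x) t)\<^sup>2 = 0"
    using sq(1) by (subst integral_nonneg_eq_0_iff_AE[symmetric]) auto
  with trace[OF t] E_Vc show ?thesis by eventually_elim simp
qed

subsection \<open>Existence\<close>

text \<open>Fubini gives integrable time sections for almost every \<open>x\<close>; setting the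
  remaining sections to 0 makes this true for all \<open>x\<close>. Linearity of \<open>cum\<close>
  and the weak derivative formula then apply at every \<open>x\<close>.\<close>

lemma integrable_representative_sections:
  fixes f :: "real^'d \<Rightarrow> real \<Rightarrow> real"
  assumes "integrable (lebesgue_on (Omega \<times> {0..T})) (\<lambda>z. f (fst z) (snd z))"
  obtains f' where "(\<lambda>(x, s). f' x s) \<in> borel_measurable (borel \<Otimes>\<^sub>M borel)"
    "integrable (borel_on Omega \<Otimes>\<^sub>M borel_on {0..T}) (\<lambda>(x, s). f' x s)"
    "AE z in borel_on Omega \<Otimes>\<^sub>M borel_on {0..T}. f (fst z) (snd z) = f' (fst z) (snd z)"
    "\<And>x. integrable (borel_on {0..T}) (f' x)"
proof -
  let ?M = "borel_on (Omega :: (real^'d) set)" and ?I = "borel_on {0..T}"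
  interpret M: finite_measure ?M by (rule finite_measure_Omega)
  interpret I: finite_measure ?I by (rule finite_measure_Icc)
  interpret MI: pair_sigma_finite ?M ?I ..
  have S: "Omega \<times> {0..T} \<in> sets (borel :: ((real^'d) \<times> real) measure)"
    by (intro borel_Times Omega_borel borel_closed[OF closed_atLeastAtMost])
  have prod: "?M \<Otimes>\<^sub>M ?I = borel_on (Omega \<times> {0..T})"
    by (intro borel_on_prod Omega_borel borel_closed[OF closed_atLeastAtMost] emeasure_bounded_finite) simp
  obtain F where F: "F \<in> borel_measurable borel" "AE z in ?M \<Otimes>\<^sub>M ?I. f (fst z) (snd z) = F z"
    "integrable (?M \<Otimes>\<^sub>M ?I) F"
    unfolding prod by (rule integrable_borel_representative[OF S assms])
  have [measurable]: "F \<in> borel_measurable (borel \<Otimes>\<^sub>M borel)" using F(1) by (simp only: borel_prod)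
  define A where "A = {x. (\<integral>\<^sup>+s. ennreal \<bar>F (x, s)\<bar> \<partial>?I) < \<infinity>}"
  have [measurable]: "A \<in> sets borel" unfolding A_def by measurable
  define f' where "f' x s = (if x \<in> A then F (x, s) else 0)" for x s
  have "AE x in ?M. x \<in> A"
    using MI.AE_integrable_fst'[OF F(3)] by eventually_elim (simp add: A_def integrable_iff_bounded)
  then have AE_A: "AE z in ?M \<Otimes>\<^sub>M ?I. fst z \<in> A"
  proof (intro MI.AE_pair_measure)
    have "Measurable.pred (borel \<Otimes>\<^sub>M borel) (\<lambda>z :: (real^'d) \<times> real. fst z \<in> A)" by measurable
    then have "Measurable.pred (?M \<Otimes>\<^sub>M ?I) (\<lambda>z. fst z \<in> A)"
      by (simp only: measurable_cong_sets[OF sets_pair_borel_on refl])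
    then show "{z \<in> space (?M \<Otimes>\<^sub>M ?I). fst z \<in> A} \<in> sets (?M \<Otimes>\<^sub>M ?I)" by (simp add: pred_def)
  qed (auto elim!: eventually_mono)
  have f'_meas: "(\<lambda>(x, s). f' x s) \<in> borel_measurable (borel \<Otimes>\<^sub>M borel)" unfolding f'_def by measurable
  show thesis
  proof (rule that[OF f'_meas])
    show "integrable (?M \<Otimes>\<^sub>M ?I) (\<lambda>(x, s). f' x s)"
      by (rule integrable_cong_AE_imp[OF F(3)])
        (use f'_meas AE_A in \<open>auto simp: f'_def case_prod_beta' measurable_cong_sets[OF sets_pair_borel_on refl]
          elim!: eventually_mono\<close>)
    show "AE z in ?M \<Otimes>\<^sub>M ?I. f (fst z) (snd z) = f' (fst z) (snd z)"
      using F(2) AE_A by eventually_elim (simp add: f'_def)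
    show "integrable ?I (f' x)" for x
    proof (cases "x \<in> A")
      case True
      then have "integrable ?I (\<lambda>s. F (x, s))" by (simp add: A_def integrable_iff_bounded)
      then show ?thesis using True by (simp add: f'_def[abs_def])
    qed (simp add: f'_def[abs_def])
  qed
qed

lemma solution_P1_exists:
  fixes K :: "real^'d \<Rightarrow> real^'d \<Rightarrow> real"
  assumes T: "0 < T" and K: "H1 K" "H2 K" "H3 K"
    and g: "integrable (lebesgue_on Omega) g"
    and f: "integrable (lebesgue_on (Omega \<times> {0..T})) (\<lambda>z. f (fst z) (snd z))"
  obtains u where "solution_P1 K f g T u"
proof -
  let ?M = "borel_on (Omega :: (real^'d) set)" and ?I = "borel_on {0..T}"
  let ?L = "lebesgue_on (Omega :: (real^'d) set)"
  obtain K' C where K': "kernel_space ?M K' C"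
    and KK': "AE z in ?M \<Otimes>\<^sub>M ?M. K (fst z) (snd z) = K' (fst z) (snd z)"
    by (rule kernel_representative[OF K])
  interpret kernel_space ?M K' C by (rule K')
  interpret I: finite_measure ?I by (rule finite_measure_Icc)
  interpret MI: pair_sigma_finite ?M ?I ..
  interpret MIf: finite_measure "?M \<Otimes>\<^sub>M ?I"
    using I.finite_measure_axioms finite_measure_axioms by (rule finite_measure_pair_measure)
  obtain f' where f': "(\<lambda>(x, s). f' x s) \<in> borel_measurable (borel \<Otimes>\<^sub>M borel)"
    "integrable (?M \<Otimes>\<^sub>M ?I) (\<lambda>(x, s). f' x s)"
    "AE z in ?M \<Otimes>\<^sub>M ?I. f (fst z) (snd z) = f' (fst z) (snd z)"
    "\<And>x. integrable ?I (f' x)"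
    by (rule integrable_representative_sections[OF f], rule that)
  obtain g' where g': "g' \<in> borel_measurable borel" "AE x in ?M. g x = g' x" "integrable ?M g'"
    by (rule integrable_borel_representative[OF Omega_borel g])
  note [measurable] = f'(1) g'(1)
  \<comment> \<open>The trajectory driven by the data alone; what remains for the delay scheme is
    the part driven by the kernel.\<close>
  define h where "h x t = g' x + cum T (f' x) t" for x t
  have h_meas: "(\<lambda>(x, t). h x t) \<in> borel_measurable (?M \<Otimes>\<^sub>M borel)"
  proof -
    have [measurable]: "(\<lambda>p. cum T (f' (fst p)) (snd p)) \<in> borel_measurable (borel \<Otimes>\<^sub>M borel)"
      by (rule borel_measurable_cum) measurable
    have "(\<lambda>p. g' (fst p) + cum T (f' (fst p)) (snd p)) \<in> borel_measurable (borel \<Otimes>\<^sub>M borel)"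
      by measurable
    then show ?thesis by (simp add: h_def case_prod_beta' cong: measurable_cong_sets)
  qed
  interpret delay_scheme ?M K' C h T
    by unfold_locales (use h_meas T in auto)
  obtain w where w: "(\<lambda>(t, x, y). w t x y) \<in> borel_measurable (borel \<Otimes>\<^sub>M (?M \<Otimes>\<^sub>M ?M))"
    "\<And>t x y. \<bar>w t x y\<bar> \<le> 1"
    and w_sub: "AE t in ?I. AE z in ?M \<Otimes>\<^sub>M ?M.
      w t (fst z) (snd z) = - w t (snd z) (fst z) \<and>
      w t (fst z) (snd z) \<in> subdiff_abs
        ((h (snd z) t + cum T (\<lambda>s. \<integral>y. K' (snd z) y * w s (snd z) y \<partial>?M) t)
         - (h (fst z) t + cum T (\<lambda>s. \<integral>y. K' (fst z) y * w s (fst z) y \<partial>?M) t))"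
    by (rule sign_selection_exists, rule that)
  have w_pair: "(\<lambda>(x, y). w t x y) \<in> borel_measurable (?M \<Otimes>\<^sub>M ?M)" for t
    using measurable_compose[OF _ w(1), of "\<lambda>p. (t, p)" "?M \<Otimes>\<^sub>M ?M"] by (simp add: case_prod_beta')
  have w_slice: "w t x \<in> borel_measurable ?M" for t x
    using measurable_compose[OF _ w(1), of "\<lambda>y. (t, x, y)" ?M] by simp
  define b where "b x s = (\<integral>y. K' x y * w s x y \<partial>?M)" for x s
  have "(\<lambda>(x, s). b x s) \<in> borel_measurable (?M \<Otimes>\<^sub>M borel)"
    unfolding b_def by (rule borel_measurable_kernel_integral[OF w(1)])
  then have b_meas [measurable]: "(\<lambda>(x, s). b x s) \<in> borel_measurable (borel \<Otimes>\<^sub>M borel)"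
    by (simp cong: measurable_cong_sets)
  have b_bnd: "\<bar>b x s\<bar> \<le> C" for x s
    using K_mult_integral_le[OF w_slice w(2), of x s x] by (simp add: b_def)
  define v where "v x s = f' x s + b x s" for x s
  have v_meas [measurable]: "(\<lambda>(x, s). v x s) \<in> borel_measurable (borel \<Otimes>\<^sub>M borel)"
    unfolding v_def by measurable
  have v_M: "(\<lambda>(x, s). v x s) \<in> borel_measurable (?M \<Otimes>\<^sub>M borel)"
    using v_meas by (simp cong: measurable_cong_sets)
  have b_sec: "integrable ?I (b x)" for x by (rule integrable_bounded_Icc[OF _ b_bnd]) measurable
  have v_sec: "integrable ?I (v x)" for x using f'(4)[of x] b_sec[of x] by (simp add: v_def[abs_def])
  have b_int: "integrable (?M \<Otimes>\<^sub>M ?I) (\<lambda>(x, s). b x s)"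
  proof (rule MIf.integrable_const_bound[of _ C])
    show "(\<lambda>(x, s). b x s) \<in> borel_measurable (?M \<Otimes>\<^sub>M ?I)"
      using b_meas by (simp only: measurable_cong_sets[OF sets_pair_borel_on refl])
  qed (use b_bnd in auto)
  have v_int: "integrable (?M \<Otimes>\<^sub>M ?I) (\<lambda>(x, s). v x s)"
    using Bochner_Integration.integrable_add[OF f'(2) b_int] by (simp add: v_def case_prod_beta')
  \<comment> \<open>Writing the solution as one primitive of \<open>v\<close> gives the weak
    derivative and the L^1 continuity, while \<open>u_h\<close> gives the form in which the sign
    relation was obtained.\<close>
  define u where "u x t = g' x + cum T (v x) t" for x t
  have u_h: "u x t = h x t + cum T (b x) t" for x t
    unfolding u_def h_def v_def using cum_add[OF f'(4) b_sec, of x x t] by simp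
  have u_meas: "(\<lambda>z. u (fst z) (snd z)) \<in> borel_measurable (borel \<Otimes>\<^sub>M borel)"
  proof -
    have [measurable]: "(\<lambda>p. cum T (v (fst p)) (snd p)) \<in> borel_measurable (borel \<Otimes>\<^sub>M borel)"
      by (rule borel_measurable_cum) measurable
    show ?thesis unfolding u_def by measurable
  qed
  then have u_borel: "(\<lambda>z. u (fst z) (snd z)) \<in> borel_measurable borel" by (simp only: borel_prod)
  have v_borel: "(\<lambda>z. v (fst z) (snd z)) \<in> borel_measurable borel"
    using v_meas by (simp add: borel_prod case_prod_beta')
  have u_sec [measurable]: "(\<lambda>x. u x t) \<in> borel_measurable borel" "u x \<in> borel_measurable borel" for t x
    using measurable_compose[OF _ u_meas, of "\<lambda>x. (x, t)" borel]
      measurable_compose[OF _ u_meas, of "\<lambda>t. (x, t)" borel] by simp_all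
  have cum_M: "integrable ?M (\<lambda>x. cum T (v x) t)" for t by (rule integrable_pair_cum(2)[OF v_M v_int])
  have u_M: "integrable ?M (\<lambda>x. u x t)" for t unfolding u_def using g'(3) cum_M by simp
  have u_L: "integrable ?L (\<lambda>x. u x t)" for t
    using u_M by (subst integrable_lebesgue_on_iff[OF Omega_borel u_sec(1)]) auto
  note S = borel_on_Omega_Ioo(2)[where T = T and 'd = 'd]

  have "solution_P1 K f g T u"
    unfolding solution_P1_def
  proof (intro conjI ballI)
    show "(\<lambda>z. u (fst z) (snd z)) \<in> borel_measurable (lebesgue_on (Omega \<times> {0..T}))"
      by (rule borel_measurable_lebesgue_onI[OF _ u_borel])
        (auto intro!: borel_Times Omega_borel borel_closed[OF closed_atLeastAtMost])
    show "integrable ?L (\<lambda>x. u x t)" for t by (rule u_L)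
    show "AE x in ?L. u x 0 = g x"
      using g'(2) unfolding AE_lebesgue_on_iff[OF Omega_borel]
      by eventually_elim (simp add: u_def cum_nonpos)
    show "((\<lambda>s. \<integral>x. \<bar>u x s - u x t\<bar> \<partial>?L) \<longlongrightarrow> 0) (at t within {0..T})" for t
    proof -
      have "(\<integral>x. \<bar>u x s - u x t\<bar> \<partial>?L) = (\<integral>x. \<bar>cum T (v x) s - cum T (v x) t\<bar> \<partial>?M)" for s
      proof (rule integral_lebesgue_on_eq)
        show "(\<lambda>x. \<bar>cum T (v x) s - cum T (v x) t\<bar>) \<in> borel_measurable borel"
          using borel_measurable_integrable[OF cum_M[of s]] borel_measurable_integrable[OF cum_M[of t]]
          by (simp cong: measurable_cong_sets)
      qed (auto simp: u_def)
      then show ?thesis using cum_L1_continuous[OF v_M v_int, of t "{0..T}"] by simp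
    qed
    show "\<exists>v \<eta>. weak_time_deriv T u v \<and>
        (AE z in lebesgue_on (Omega \<times> {0<..<T}).
            v (fst z) (snd z) = - \<eta> (fst z) (snd z) + f (fst z) (snd z)) \<and>
        (AE t in lebesgue_on {0<..<T}. one_laplacian K (\<lambda>x. u x t) (\<lambda>x. \<eta> x t))"
    \<comment> \<open>The minus sign in the 1-Laplacian makes \<open>- b\<close> the selected
      element, so that \<open>v\<close> equals \<open>f' + b\<close>.\<close>
    proof (rule exI[of _ v], rule exI[of _ "\<lambda>x s. - b x s"], intro conjI)
      show "weak_time_deriv T u v"
        unfolding weak_time_deriv_def
      proof (intro conjI allI impI)
        have "integrable (?M \<Otimes>\<^sub>M ?I) (\<lambda>(x, t). g' x * 1)" by (rule MI.integrable_prod_mult[OF g'(3)]) simp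
        from Bochner_Integration.integrable_add[OF this integrable_pair_cum(1)[OF v_M v_int]]
        have "integrable (?M \<Otimes>\<^sub>M ?I) (\<lambda>z. u (fst z) (snd z))" by (simp add: u_def case_prod_beta')
        then show "integrable (lebesgue_on (Omega \<times> {0<..<T})) (\<lambda>z. u (fst z) (snd z))"
          unfolding borel_on_Omega_Ioo by (subst integrable_lebesgue_on_iff[OF S u_borel]) auto
        have "integrable (?M \<Otimes>\<^sub>M ?I) (\<lambda>z. v (fst z) (snd z))" using v_int by (simp add: case_prod_beta')
        then show "integrable (lebesgue_on (Omega \<times> {0<..<T})) (\<lambda>z. v (fst z) (snd z))"
          unfolding borel_on_Omega_Ioo by (subst integrable_lebesgue_on_iff[OF S v_borel]) auto
        fix \<phi> assume \<phi>: "test_fun T \<phi>"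
        note [measurable] = test_fun_measurable[OF \<phi>]
        show "AE x in ?L. (\<integral>t. u x t * deriv \<phi> t \<partial>lebesgue_on {0<..<T})
            = - (\<integral>t. v x t * \<phi> t \<partial>lebesgue_on {0<..<T})"
        proof (rule AE_I2)
          fix x
          have "(\<integral>t. u x t * deriv \<phi> t \<partial>lebesgue_on {0<..<T}) = (\<integral>t. u x t * deriv \<phi> t \<partial>?I)"
            unfolding borel_on_Icc_Ioo by (rule integral_lebesgue_on_eq) auto
          moreover have "(\<integral>t. v x t * \<phi> t \<partial>lebesgue_on {0<..<T}) = (\<integral>t. v x t * \<phi> t \<partial>?I)"
            unfolding borel_on_Icc_Ioo by (rule integral_lebesgue_on_eq) auto
          ultimately show "(\<integral>t. u x t * deriv \<phi> t \<partial>lebesgue_on {0<..<T})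
              = - (\<integral>t. v x t * \<phi> t \<partial>lebesgue_on {0<..<T})"
            using cum_weak_derivative[OF \<phi> v_sec[of x], of "g' x"] by (simp add: u_def)
        qed
      qed
      show "AE z in lebesgue_on (Omega \<times> {0<..<T}). v (fst z) (snd z) = - (- b (fst z) (snd z)) + f (fst z) (snd z)"
        using f'(3) unfolding AE_lebesgue_on_iff[OF S] borel_on_Omega_Ioo(1)[symmetric]
        by eventually_elim (simp add: v_def)
      show "AE t in lebesgue_on {0<..<T}. one_laplacian K (\<lambda>x. u x t) (\<lambda>x. - b x t)"
        using w_sub
        unfolding AE_lebesgue_on_iff[OF borel_open[OF open_greaterThanLessThan]] borel_on_Icc_Ioo[symmetric]
      proof eventually_elim
        case (elim t)
        have Om2: "(Omega \<times> Omega :: ((real^'d) \<times> (real^'d)) set) \<in> sets borel" by (intro borel_Times Omega_borel)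
        have prod: "?M \<Otimes>\<^sub>M ?M = borel_on (Omega \<times> Omega)" by (rule borel_on_prod) (rule Omega_borel Omega_finite)+
        have w_borel: "(\<lambda>z. w t (fst z) (snd z)) \<in> borel_measurable borel"
          using w_pair[of t]
          by (simp add: case_prod_beta' measurable_cong_sets[OF sets_pair_borel_on refl] borel_prod)
        have b_M: "integrable ?M (\<lambda>x. - b x t)"
        proof (rule integrable_const_bound[of _ C])
          show "(\<lambda>x. - b x t) \<in> borel_measurable ?M" by measurable
        qed (use b_bnd in auto)
        show ?case unfolding one_laplacian_def
        proof (intro conjI exI[of _ "w t"])
          show "integrable ?L (\<lambda>x. u x t)" by (rule u_L)
          show "integrable ?L (\<lambda>x. - b x t)"
            using b_M by (subst integrable_lebesgue_on_iff[where f' = "\<lambda>x. - b x t"]) auto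
          show "(\<lambda>z. w t (fst z) (snd z)) \<in> borel_measurable (lebesgue_on (Omega \<times> Omega))"
            by (rule borel_measurable_lebesgue_onI[OF Om2 w_borel]) simp
          show "AE z in lebesgue_on (Omega \<times> Omega). \<bar>w t (fst z) (snd z)\<bar> \<le> 1 \<and>
              w t (fst z) (snd z) = - w t (snd z) (fst z) \<and>
              w t (fst z) (snd z) \<in> subdiff_abs (u (snd z) t - u (fst z) t)"
            using elim unfolding AE_lebesgue_on_iff[OF Om2] prod[symmetric] u_h b_def[abs_def]
            by eventually_elim (use w(2) in blast)
          show "AE x in ?L. - b x t = - (\<integral>y. K x y * w t x y \<partial>?L)"
            using P.AE_pair[OF KK'] unfolding AE_lebesgue_on_iff[OF Omega_borel]
          proof eventually_elim
            case (elim x)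
            have "(\<integral>y. K x y * w t x y \<partial>?L) = b x t"
              unfolding b_def
            proof (rule integral_lebesgue_on_eq)
              have "(\<lambda>y. K' x y * w t x y) \<in> borel_measurable ?M" using w_slice[of t x] by measurable
              then show "(\<lambda>y. K' x y * w t x y) \<in> borel_measurable borel" by (simp cong: measurable_cong_sets)
              show "AE y in ?M. K x y * w t x y = K' x y * w t x y" using elim by eventually_elim simp
            qed simp
            then show ?case by simp
          qed
        qed
      qed
    qed
  qed
  then show thesis by (rule that)
qed

theorem theorem4p8:
  fixes K :: "real^'d \<Rightarrow> real^'d \<Rightarrow> real"
    and f :: "real^'d \<Rightarrow> real \<Rightarrow> real"
    and g :: "real^'d \<Rightarrow> real"
    and T :: real
  assumes "T > 0"
    and "H1 K" and "H2 K" and "H3 K"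
    and "integrable (lebesgue_on Omega) g"
    and "integrable (lebesgue_on (Omega \<times> {0..T})) (\<lambda>z. f (fst z) (snd z))"
  shows "\<exists>u. solution_P1 K f g T u \<and>
           (\<forall>u'. solution_P1 K f g T u' \<longrightarrow>
              (\<forall>t\<in>{0..T}. AE x in lebesgue_on Omega. u' x t = u x t))"
proof -
  obtain u where u: "solution_P1 K f g T u"
    using solution_P1_exists[OF assms] .
  show ?thesis
  proof (intro exI[of _ u] conjI allI impI ballI)
    fix u' t assume "solution_P1 K f g T u'" "t \<in> {0..T}"
    then show "AE x in lebesgue_on Omega. u' x t = u x t"
      unfolding AE_lebesgue_on_iff[OF Omega_borel]
      by (rule solution_P1_unique[OF assms(1-4) _ u])
  qed (rule u)
qed

end
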